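(* Let $\Lambda=(\lambda_j)_{j\in\mathbb{Z}}$, $M=(\mu_j)_{j\in\mathbb{Z}}\subset\mathbb{R}$ be a supercritical pair (with parameters $(p,q)=(2,2)$) satisfying $$\max\left(\limsup_{j\to\pm\infty}|\lambda_j|(\lambda_{j+1}-\lambda_j),\ \limsup_{j\to\pm\infty}|\mu_j|(\mu_{j+1}-\mu_j)\right)<\frac{1}{2}.$$ If $f\in\mathcal{H}$ and $$\sup_{\lambda\in\Lambda}|f(\lambda)|(1+|\lambda|)^{-N}e^{\pi|\lambda|^2}+\sup_{\mu\in M}|\hat{f}(\mu)|(1+|\mu|)^{-N}e^{\pi|\mu|^2}<\infty$$ for some $N\ge 0$, then $f(x)=P(x)e^{-\pi x^2}$, where $P$ is a polynomial (with complex coefficients) with $\deg P\le N$.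
   Context: Fourier transform: $\hat f(\xi)=\int_{\mathbb{R}}f(x)e^{-2\pi i x\xi}\,dx$. $\mathcal{H}$ is the Fourier-symmetric Sobolev space of all $f\in L^2(\mathbb{R})$ with $\int_{\mathbb{R}}(1+x^2)|f(x)|^2\,dx+\int_{\mathbb{R}}(1+\xi^2)|\hat f(\xi)|^2\,d\xi<\infty$. For $f\in\mathcal{H}$, both $f$ and $\hat f$ have continuous representatives, and pointwise values refer to these. Sequences $\Lambda=(\lambda_j)_{j\in\mathbb{Z}}$ and $M=(\mu_j)_{j\in\mathbb{Z}}$ are ordered increasingly, consist of distinct real numbers, and are unbounded in both directions ($\lambda_j,\mu_j\to\pm\infty$ as $j\to\pm\infty$). A limsup as $j\to\pm\infty$ being bounded means that both the limsup as $j\to+\infty$ and the limsup as $j\to-\infty$ satisfy the bound. The pair $(\Lambda,M)$ is supercritical with parameters $(p,q)$, where $1<p,q<\infty$ and $\frac1p+\frac1q=1$, if there are $\overline{\alpha},\overline{\beta}$ with $\overline{\alpha}^{1/p}\overline{\beta}^{1/q}<\frac12$ such that $\limsup_{j\to\pm\infty}|\lambda_j|^{p-1}(\lambda_{j+1}-\lambda_j)\le\overline{\alpha}$ and $\limsup_{j\to\pm\infty}|\mu_j|^{q-1}(\mu_{j+1}-\mu_j)\le\overline{\beta}$. (For $p=q=2$ this is implied by the displayed density condition of the claim.) The zero polynomial is regarded as having degree at most $N$. *)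

theory Defs
  imports "HOL-Analysis.Analysis" "HOL-Computational_Algebra.Polynomial"
begin

definition fourier :: "(real \<Rightarrow> complex) \<Rightarrow> real \<Rightarrow> complex" where
  "fourier f \<xi> =
     (LINT x|lborel. f x * exp (- 2 * complex_of_real pi * \<i> * complex_of_real x * complex_of_real \<xi>))"

definition square_integrable :: "(real \<Rightarrow> complex) \<Rightarrow> bool" where
  "square_integrable f \<longleftrightarrow>
     f \<in> borel_measurable lborel \<and> integrable lborel (\<lambda>x. (norm (f x))\<^sup>2)"

(* The weight 1 + x^2 makes every member Lebesgue integrable (Cauchy-Schwarz), so here the
   integral defining fourier f converges absolutely, and fourier f is itself the continuous
   representative of the transform. Members are functions, not classes modulo null sets. *)
definition fourier_sobolev :: "(real \<Rightarrow> complex) set" where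
  "fourier_sobolev = {f. square_integrable f \<and>
     (\<integral>\<^sup>+ x. ennreal ((1 + x\<^sup>2) * (norm (f x))\<^sup>2) \<partial>lborel)
     + (\<integral>\<^sup>+ \<xi>. ennreal ((1 + \<xi>\<^sup>2) * (norm (fourier f \<xi>))\<^sup>2) \<partial>lborel) < \<infinity>}"

(* Such an F is unique, because null sets have dense complement. *)
definition continuous_representative :: "(real \<Rightarrow> complex) \<Rightarrow> (real \<Rightarrow> complex) \<Rightarrow> bool" where
  "continuous_representative f F \<longleftrightarrow>
     continuous_on UNIV F \<and> (AE x in lborel. F x = f x)"

definition two_sided_sequence :: "(int \<Rightarrow> real) \<Rightarrow> bool" where
  "two_sided_sequence l \<longleftrightarrow>
     strict_mono l \<and> filterlim l at_top at_top \<and> filterlim l at_bot at_bot"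

(* The larger of the limsups at plus and minus infinity: an upper bound for it
   is an upper bound for both. *)
definition limsup_both :: "(int \<Rightarrow> real) \<Rightarrow> ereal" where
  "limsup_both a =
     max (Limsup at_top (\<lambda>j. ereal (a j))) (Limsup at_bot (\<lambda>j. ereal (a j)))"

(* Nonnegativity of \<alpha> and \<beta>, needed for powr to be the usual power, follows from the
   limsup bounds since the sequences are increasing. *)
definition supercritical_pair ::
    "real \<Rightarrow> real \<Rightarrow> (int \<Rightarrow> real) \<Rightarrow> (int \<Rightarrow> real) \<Rightarrow> bool" where
  "supercritical_pair p q l m \<longleftrightarrow>
     1 < p \<and> 1 < q \<and> 1 / p + 1 / q = 1 \<and>
     two_sided_sequence l \<and> two_sided_sequence m \<and>
     (\<exists>\<alpha> \<beta> :: real.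
        \<alpha> powr (1 / p) * \<beta> powr (1 / q) < 1 / 2 \<and>
        limsup_both (\<lambda>j. \<bar>l j\<bar> powr (p - 1) * (l (j + 1) - l j)) \<le> ereal \<alpha> \<and>
        limsup_both (\<lambda>j. \<bar>m j\<bar> powr (q - 1) * (m (j + 1) - m j)) \<le> ereal \<beta>)"

end

theory Submission
  imports Defs "HOL-Complex_Analysis.Complex_Analysis" "HOL-Probability.Probability"
    "HOL-Real_Asymp.Real_Asymp"
begin

text \<open>
  Let \<open>F\<close> be continuous with transform \<open>G\<close>, and let \<open>W x \<xi>\<close> be the squared modulus of the
  short-time Fourier transform of \<open>F\<close> with a Gaussian window. The window localises \<open>F\<close> at \<open>x\<close>, where
  the gaps between nodes are below \<open>1 / (2 * \<bar>x\<bar>)\<close>, so Wirtinger's inequality between consecutive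
  nodes gives \<open>x\<^sup>2 * \<integral>W x \<xi> d\<xi> \<le> \<gamma> * \<integral>\<xi>\<^sup>2 * W x \<xi> d\<xi>\<close> with \<open>\<gamma> < 1\<close> up to a Gaussian error.
  The same argument for \<open>G\<close> gives the inequality with \<open>x\<close> and \<open>\<xi>\<close> exchanged. Integrating both
  against an increasing weight and using the rearrangement inequality yields
  \<open>F t, G t = O(exp (- a * t\<^sup>2))\<close> for some \<open>a > 0\<close>.

  Now \<open>F\<close> is entire. By the Phragmen-Lindelof principle \<open>F (x + \<i> * y)\<close> is bounded by
  \<open>exp (- a * x\<^sup>2 + 2 * K * \<bar>x * y\<bar> + O(y\<^sup>2))\<close> with \<open>K = sqrt (pi\<^sup>2 - a\<^sup>2) < pi\<close>. Hence near \<open>x0\<close> the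
  function \<open>F x * exp ((a + s) * x\<^sup>2)\<close> essentially has frequencies below \<open>\<bar>x0\<bar>\<close>, and Wirtinger's
  inequality bounds it by its values at the nodes, that is, polynomially. Thus the decay rate \<open>a\<close>
  increases by a fixed amount, as long as it does not exceed \<open>pi\<close>. After finitely many steps \<open>F\<close> and \<open>G\<close> are
  bounded by \<open>exp (- pi * t\<^sup>2)\<close> times a polynomial, and Hardy's argument (Phragmen-Lindelof in the
  four quadrants and Liouville) shows that \<open>F z * exp (pi * z\<^sup>2)\<close> is a polynomial; its degree is read
  off at the nodes.
\<close>

section \<open>Fourier inversion and the Plancherel identity\<close>

text \<open>The Sobolev norm provides second moments only, whereas Hardy's argument needs pointwise
  Gaussian bounds at the critical rate \<open>pi\<close>; the nodes carry such bounds but say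
  nothing about the points between them. Wirtinger's inequality alone gains nothing for a single
  function: it trades mass at position \<open>x\<close> for mass at frequencies of size
  \<open>\<bar>x\<bar>\<close>. The gain comes from trading back. For this both inequalities must
  concern the same quantity, and the Gaussian \<open>exp (- pi * t\<^sup>2)\<close>, being its own
  Fourier transform, makes \<open>W\<close> for \<open>F\<close> and \<open>W\<close> for
  \<open>G\<close> agree up to a quarter turn. The threshold \<open>1 / 2\<close>: a gap
  \<open>h\<close> controls derivatives up to the factor \<open>pi / h\<close>, a frequency
  \<open>\<xi>\<close> contributes \<open>2 * pi * \<bar>\<xi>\<bar>\<close>, so \<open>h\<close>
  matches the frequency \<open>1 / (2 * h)\<close>. The rate \<open>a\<close> obtained in this way
  is small, since window and error terms limit it. To improve it, the position weight has to be
  analytic, so that a shifted contour shows that high frequencies are absent. The strict inequality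
  \<open>K < pi\<close> is what leaves room for the shift, and it becomes better as \<open>a\<close>
  increases, so the size of a step never shrinks.\<close>

lemma gaussian_integral:
  fixes c b :: real
  assumes "c > 0"
  shows "integrable lborel (\<lambda>x. exp (- c * (x - b)\<^sup>2))"
    and "(LINT x|lborel. exp (- c * (x - b)\<^sup>2)) = sqrt (pi / c)"
proof -
  define \<sigma> where "\<sigma> = sqrt (1 / (2 * c))"
  have s2: "\<sigma>\<^sup>2 = 1 / (2 * c)" using assms by (simp add: \<sigma>_def)
  have eq: "(\<lambda>x. exp (- c * (x - b)\<^sup>2)) = (\<lambda>x. sqrt (pi / c) * normal_density b \<sigma> x)"
    using assms by (auto simp: normal_density_def s2 fun_eq_iff)
  have "\<sigma> > 0" using assms by (simp add: \<sigma>_def)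
  then show "integrable lborel (\<lambda>x. exp (- c * (x - b)\<^sup>2))"
    "(LINT x|lborel. exp (- c * (x - b)\<^sup>2)) = sqrt (pi / c)"
    unfolding eq by auto
qed

lemma gaussian_integral_0:
  fixes c :: real
  assumes "c > 0"
  shows "integrable lborel (\<lambda>x. exp (- c * x\<^sup>2))"
    and "(LINT x|lborel. exp (- c * x\<^sup>2)) = sqrt (pi / c)"
  using gaussian_integral[OF assms, of 0] by simp_all

text \<open>The scale \<open>s = sqrt (2 * c)\<close> turns \<open>exp (- c * x\<^sup>2)\<close>
  into a multiple of the standard normal density, whose characteristic function is known.\<close>

lemma gaussian_fourier:
  fixes c t :: real
  assumes "c > 0"
  shows "(LINT x|lborel. complex_of_real (exp (- c * x\<^sup>2)) * cis (t * x))
         = complex_of_real (sqrt (pi / c) * exp (- t\<^sup>2 / (4 * c)))"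
proof -
  define s where "s = sqrt (2 * c)"
  have s: "s > 0" "s\<^sup>2 = 2 * c" using assms by (simp_all add: s_def)
  have "complex_of_real (exp (- (t / s)\<^sup>2 / 2)) = char std_normal_distribution (t / s)"
    by (simp add: char_std_normal_distribution)
  also have "\<dots> = (LINT x|lborel. complex_of_real (std_normal_density x) * cis (t / s * x))"
    unfolding char_def
    by (subst integral_density) (auto simp: scaleR_conv_of_real cis_conv_exp normal_density_nonneg mult_ac)
  also have "\<dots> = \<bar>s\<bar> *\<^sub>R (LINT x|lborel. complex_of_real (std_normal_density (0 + s * x)) * cis (t / s * (0 + s * x)))"
    using s by (intro lborel_integral_real_affine) auto
  also have "(LINT x|lborel. complex_of_real (std_normal_density (0 + s * x)) * cis (t / s * (0 + s * x)))
      = (LINT x|lborel. complex_of_real (1 / sqrt (2 * pi)) * (complex_of_real (exp (- c * x\<^sup>2)) * cis (t * x)))"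
  proof (intro Bochner_Integration.integral_cong refl)
    fix x :: real
    have e: "(s * x)\<^sup>2 = c * x\<^sup>2 * 2" using s by (simp add: power_mult_distrib)
    show "complex_of_real (std_normal_density (0 + s * x)) * cis (t / s * (0 + s * x)) =
      complex_of_real (1 / sqrt (2 * pi)) * (complex_of_real (exp (- c * x\<^sup>2)) * cis (t * x))"
      using s by (simp add: std_normal_density_def e del: power_mult_distrib)
  qed
  also have "\<dots> = complex_of_real (1 / sqrt (2 * pi)) * (LINT x|lborel. complex_of_real (exp (- c * x\<^sup>2)) * cis (t * x))"
    by simp
  finally have "complex_of_real (exp (- (t / s)\<^sup>2 / 2)) =
     complex_of_real (s / sqrt (2 * pi)) * (LINT x|lborel. complex_of_real (exp (- c * x\<^sup>2)) * cis (t * x))"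
    using s by (simp add: scaleR_conv_of_real)
  moreover have "sqrt (2*pi) / s = sqrt (pi / c)"
    by (simp add: s_def real_sqrt_divide[symmetric])
  moreover have "(t / s)\<^sup>2 / 2 = t\<^sup>2 / (4 * c)" using s by (simp add: power_divide)
  ultimately show ?thesis using s
    by (simp add: field_simps flip: of_real_mult) (simp add: field_simps)
qed

lemma fourier_cis: "fourier f \<xi> = (LINT x|lborel. f x * cis (- (2 * pi * \<xi>) * x))"
  unfolding fourier_def cis_conv_exp
  by (intro Bochner_Integration.integral_cong refl) (simp add: mult_ac)

lemma cis_linear_measurable [measurable]: "(\<lambda>x. cis (a * x)) \<in> borel_measurable borel"
  unfolding cis_conv_exp by measurable

lemma integrable_mult_cis:
  fixes f :: "real \<Rightarrow> complex"
  assumes "integrable lborel f"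
  shows "integrable lborel (\<lambda>x. f x * cis (a * x))"
  using assms by (rule Bochner_Integration.integrable_bound) (use assms in \<open>auto simp: norm_mult\<close>)

lemma continuous_on_integral_mult_cis:
  fixes f :: "real \<Rightarrow> complex"
  assumes "integrable lborel f"
  shows "continuous_on UNIV (\<lambda>t. LINT x|lborel. f x * cis (a * t * x))"
  unfolding continuous_on_eq_continuous_within continuous_within_sequentially
proof (intro ballI allI impI, clarsimp simp: o_def)
  fix t :: real and X :: "nat \<Rightarrow> real"
  assume X: "X \<longlonglongrightarrow> t"
  show "(\<lambda>n. LINT x|lborel. f x * cis (a * X n * x)) \<longlonglongrightarrow> (LINT x|lborel. f x * cis (a * t * x))"
    using assms X
    by (intro integral_dominated_convergence[where w="\<lambda>x. norm (f x)"])
       (auto intro!: tendsto_intros AE_I2 simp: norm_mult)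
qed

lemma fourier_continuous:
  assumes "integrable lborel f"
  shows "continuous_on UNIV (fourier f)"
  using continuous_on_integral_mult_cis[OF assms, of "- (2*pi)"]
  by (simp add: fourier_cis[abs_def])

lemma fourier_norm_le: "norm (fourier f \<xi>) \<le> (LINT x|lborel. norm (f x))"
  unfolding fourier_cis
  by (rule order_trans[OF integral_norm_bound]) (simp add: norm_mult)

text \<open>Fubini. With a damped or modulated Gaussian in one factor, this identity yields
  inversion, Plancherel and the phase-plane symmetry of the short-time transform.\<close>

lemma fourier_multiplication:
  fixes f h :: "real \<Rightarrow> complex"
  assumes "integrable lborel f" "integrable lborel h"
  shows "(LINT x|lborel. f x * fourier h x) = (LINT x|lborel. fourier f x * h x)"
proof -
  have [measurable]: "f \<in> borel_measurable borel" "h \<in> borel_measurable borel" using assms by auto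
  have 1: "integrable (lborel \<Otimes>\<^sub>M lborel) (\<lambda>(x, y). f x * h y)"
    by (intro lborel_pair.Fubini_integrable)
      (use assms in \<open>auto simp: norm_mult intro!: integrable_mult_right integrable_mult_left\<close>)
  have 2: "integrable (lborel \<Otimes>\<^sub>M lborel) (\<lambda>(x, y). f x * (h y * cis (- (2 * pi * x) * y)))"
    by (rule Bochner_Integration.integrable_bound[OF 1])
       (auto simp: norm_mult cis_conv_exp split_beta')
  have "(LINT x|lborel. f x * fourier h x) = (LINT x|lborel. (LINT y|lborel. f x * (h y * cis (- (2 * pi * x) * y))))"
    unfolding fourier_cis by simp
  also have "\<dots> = (LINT y|lborel. (LINT x|lborel. f x * (h y * cis (- (2 * pi * x) * y))))"
    by (rule lborel_pair.Fubini_integral[OF 2, symmetric])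
  also have "\<dots> = (LINT y|lborel. (LINT x|lborel. f x * cis (- (2 * pi * y) * x) * h y))"
    by (intro Bochner_Integration.integral_cong refl) (simp add: mult_ac)
  also have "\<dots> = (LINT y|lborel. fourier f y * h y)"
    unfolding fourier_cis by simp
  finally show ?thesis .
qed

text \<open>The Fourier transform of \<open>exp (- c * \<xi>\<^sup>2)\<close>: a Gaussian of mass 1
  that concentrates at 0 as \<open>c\<close> tends to 0.\<close>

definition heat :: "real \<Rightarrow> real \<Rightarrow> real" where
  "heat c v = sqrt (pi / c) * exp (- (pi\<^sup>2 / c) * v\<^sup>2)"

lemma heat_nonneg [simp]: "c > 0 \<Longrightarrow> heat c v \<ge> 0"
  by (simp add: heat_def)

lemma heat_measurable [measurable]: "heat c \<in> borel_measurable borel"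
  unfolding heat_def by measurable

lemma integrable_gaussian_cis:
  assumes "c > 0"
  shows "integrable lborel (\<lambda>\<xi>. complex_of_real (exp (- c * \<xi>\<^sup>2)) * cis (a * \<xi>))"
  using gaussian_integral_0(1)[OF assms] by (intro integrable_mult_cis integrable_of_real)

lemma fourier_modulated_gaussian:
  assumes "c > 0"
  shows "fourier (\<lambda>\<xi>. complex_of_real (exp (- c * \<xi>\<^sup>2)) * cis (2 * pi * t * \<xi>)) s
         = complex_of_real (heat c (s - t))"
proof -
  have "fourier (\<lambda>\<xi>. complex_of_real (exp (- c * \<xi>\<^sup>2)) * cis (2 * pi * t * \<xi>)) s
     = (LINT x|lborel. complex_of_real (exp (- c * x\<^sup>2)) * cis ((2 * pi * (t - s)) * x))"
    unfolding fourier_cis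
    by (intro Bochner_Integration.integral_cong refl) (simp add: cis_mult mult.assoc, simp add: algebra_simps)
  also have "\<dots> = complex_of_real (heat c (s - t))"
    unfolding gaussian_fourier[OF assms] heat_def using assms
    by (simp add: field_simps power2_eq_square)
  finally show ?thesis .
qed

text \<open>Gauss summation: damping the inversion integral by
  \<open>exp (- c * \<xi>\<^sup>2)\<close> amounts to averaging \<open>k\<close> against
  \<open>heat c\<close> around \<open>t\<close>.\<close>

lemma fourier_heat:
  fixes k :: "real \<Rightarrow> complex"
  assumes "integrable lborel k" "c > 0"
  shows "(LINT \<xi>|lborel. fourier k \<xi> * (complex_of_real (exp (- c * \<xi>\<^sup>2)) * cis (2 * pi * t * \<xi>)))
         = (LINT s|lborel. k s * complex_of_real (heat c (s - t)))"
  using fourier_multiplication[OF assms(1) integrable_gaussian_cis[OF assms(2), of "2 * pi * t"]]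
  unfolding fourier_modulated_gaussian[OF assms(2)] by (rule sym)

text \<open>Rescaling moves the dependence on \<open>c\<close> from the kernel into the argument of
  \<open>k\<close>, so that a bounded \<open>k\<close> admits a dominating function independent of
  \<open>c\<close>.\<close>

lemma heat_substitution:
  fixes k :: "real \<Rightarrow> complex"
  assumes "c > 0"
  shows "(LINT s|lborel. k s * complex_of_real (heat c (s - t)))
       = (LINT v|lborel. k (t + sqrt c * v) * complex_of_real (sqrt pi * exp (- pi\<^sup>2 * v\<^sup>2)))"
proof -
  have "(LINT s|lborel. k s * complex_of_real (heat c (s - t)))
      = \<bar>sqrt c\<bar> *\<^sub>R (LINT v|lborel. k (t + sqrt c * v) * complex_of_real (heat c ((t + sqrt c * v) - t)))"
    using assms by (intro lborel_integral_real_affine) auto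
  also have "\<dots> = (LINT v|lborel. sqrt c *\<^sub>R (k (t + sqrt c * v) * complex_of_real (heat c ((t + sqrt c * v) - t))))"
    using assms by simp
  also have "\<dots> = (LINT v|lborel. k (t + sqrt c * v) * complex_of_real (sqrt pi * exp (- pi\<^sup>2 * v\<^sup>2)))"
    using assms
    by (intro Bochner_Integration.integral_cong refl)
       (simp add: heat_def real_sqrt_divide power_mult_distrib scaleR_conv_of_real)
  finally show ?thesis .
qed

lemma standard_kernel_integral:
  "integrable lborel (\<lambda>v. sqrt pi * exp (- pi\<^sup>2 * v\<^sup>2))"
  "(LINT v|lborel. sqrt pi * exp (- pi\<^sup>2 * v\<^sup>2)) = 1"
  using gaussian_integral_0[of "pi\<^sup>2"]
  by (simp_all add: real_sqrt_divide power2_eq_square)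

lemma heat_approximation_bounded:
  fixes k :: "real \<Rightarrow> complex"
  assumes [measurable]: "k \<in> borel_measurable borel" and bd: "\<And>x. norm (k x) \<le> B" and "isCont k t"
  shows "(\<lambda>n. LINT s|lborel. k s * complex_of_real (heat (1 / Suc n) (s - t))) \<longlonglongrightarrow> k t"
    and "norm (LINT s|lborel. k s * complex_of_real (heat (1 / Suc n) (s - t))) \<le> B"
proof -
  have eq: "(LINT s|lborel. k s * complex_of_real (heat (1 / Suc n) (s - t))) =
    (LINT v|lborel. k (t + sqrt (1 / Suc n) * v) * complex_of_real (sqrt pi * exp (- pi\<^sup>2 * v\<^sup>2)))" for n
    by (rule heat_substitution) simp
  have B: "B \<ge> 0" using bd[of 0] norm_ge_zero order_trans by blast
  have "(\<lambda>n. LINT v|lborel. k (t + sqrt (1 / Suc n) * v) * complex_of_real (sqrt pi * exp (- pi\<^sup>2 * v\<^sup>2)))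
     \<longlonglongrightarrow> (LINT v|lborel. k t * complex_of_real (sqrt pi * exp (- pi\<^sup>2 * v\<^sup>2)))"
  proof (rule integral_dominated_convergence[where w="\<lambda>v. B * (sqrt pi * exp (- pi\<^sup>2 * v\<^sup>2))"])
    show "AE v in lborel. (\<lambda>n. k (t + sqrt (1 / Suc n) * v) * complex_of_real (sqrt pi * exp (- pi\<^sup>2 * v\<^sup>2)))
         \<longlonglongrightarrow> k t * complex_of_real (sqrt pi * exp (- pi\<^sup>2 * v\<^sup>2))"
    proof (rule AE_I2)
      fix v :: real
      have "(\<lambda>n. t + sqrt (1 / Suc n) * v) \<longlonglongrightarrow> t + sqrt 0 * v"
        using LIMSEQ_inverse_real_of_nat by (intro tendsto_intros) (simp add: divide_inverse)
      then have "(\<lambda>n. k (t + sqrt (1 / Suc n) * v)) \<longlonglongrightarrow> k t"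
        using isCont_tendsto_compose[OF assms(3)] by simp
      then show "(\<lambda>n. k (t + sqrt (1 / Suc n) * v) * complex_of_real (sqrt pi * exp (- pi\<^sup>2 * v\<^sup>2)))
         \<longlonglongrightarrow> k t * complex_of_real (sqrt pi * exp (- pi\<^sup>2 * v\<^sup>2))"
        by (intro tendsto_intros)
    qed
    show "AE v in lborel. norm (k (t + sqrt (1 / Suc n) * v) * complex_of_real (sqrt pi * exp (- pi\<^sup>2 * v\<^sup>2)))
        \<le> B * (sqrt pi * exp (- pi\<^sup>2 * v\<^sup>2))" for n
      by (rule AE_I2) (auto simp: norm_mult intro!: mult_right_mono bd)
  qed (use standard_kernel_integral in auto)
  also have "(LINT v|lborel. k t * complex_of_real (sqrt pi * exp (- pi\<^sup>2 * v\<^sup>2))) = k t"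
    using standard_kernel_integral(2) by (subst integral_mult_right_zero, subst integral_complex_of_real) simp
  finally show "(\<lambda>n. LINT s|lborel. k s * complex_of_real (heat (1 / Suc n) (s - t))) \<longlonglongrightarrow> k t"
    by (simp only: eq)
  have "norm (LINT v|lborel. k (t + sqrt (1 / Suc n) * v) * complex_of_real (sqrt pi * exp (- pi\<^sup>2 * v\<^sup>2)))
      \<le> (LINT v|lborel. B * (sqrt pi * exp (- pi\<^sup>2 * v\<^sup>2)))"
    by (rule order_trans[OF integral_norm_bound], rule integral_mono)
       (use standard_kernel_integral B in \<open>auto simp: norm_mult abs_mult intro!: mult_right_mono bd AE_I2
          Bochner_Integration.integrable_bound[OF integrable_mult_right[OF standard_kernel_integral(1), of B]]\<close>)
  also have "\<dots> = B" using standard_kernel_integral(2) by (subst integral_mult_right_zero) simp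
  finally show "norm (LINT s|lborel. k s * complex_of_real (heat (1 / Suc n) (s - t))) \<le> B"
    by (simp only: eq)
qed

text \<open>At a fixed distance from 0 the exponential beats the prefactor
  \<open>sqrt (pi / c)\<close>, so the kernels are bounded uniformly in \<open>n\<close>. This gives
  the dominating function for the far part of an unbounded integrable \<open>k\<close>.\<close>

lemma heat_far_bound:
  assumes "r > 0"
  obtains M where "\<And>n v. \<bar>v\<bar> \<ge> r \<Longrightarrow> heat (1 / Suc n) v \<le> M"
    and "M \<ge> 0"
proof -
  have "(\<lambda>n. heat (1 / Suc n) r) \<longlonglongrightarrow> 0"
    unfolding heat_def using assms by real_asymp
  then obtain M where M: "\<And>n. norm (heat (1 / Suc n) r) \<le> M"
    using convergent_imp_Bseq[OF convergentI] BseqE by metis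
  have "heat (1 / Suc n) v \<le> M" if "\<bar>v\<bar> \<ge> r" for n v
  proof -
    have "r\<^sup>2 \<le> v\<^sup>2" using that assms by (metis abs_le_square_iff abs_of_pos)
    then have "heat (1 / Suc n) v \<le> heat (1 / Suc n) r"
      unfolding heat_def by (auto intro!: mult_left_mono)
    also have "\<dots> \<le> M" using M[of n] by simp
    finally show ?thesis .
  qed
  then show ?thesis using that[of M] M[of 0] norm_ge_zero order_trans by blast
qed

text \<open>An integrable \<open>k\<close> may be unbounded. Continuity bounds it near
  \<open>t\<close>, where \<open>k1\<close> falls under the bounded case; the rest \<open>k2\<close>
  keeps the distance \<open>r\<close> from the peak and is dominated by a multiple of
  \<open>norm (k s)\<close>.\<close>

lemma heat_approximation:
  fixes k :: "real \<Rightarrow> complex"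
  assumes int: "integrable lborel k" and cont: "isCont k t"
  shows "(\<lambda>n. LINT s|lborel. k s * complex_of_real (heat (1 / Suc n) (s - t))) \<longlonglongrightarrow> k t"
proof -
  have [measurable]: "k \<in> borel_measurable borel" using int by auto
  obtain r where r: "r > 0" "\<And>s. \<bar>s - t\<bar> < r \<Longrightarrow> norm (k s - k t) < 1"
    using cont unfolding continuous_at_eps_delta dist_norm real_norm_def by (metis zero_less_one)
  define k1 where "k1 = (\<lambda>s. if \<bar>s - t\<bar> < r then k s else 0)"
  define k2 where "k2 = (\<lambda>s. if \<bar>s - t\<bar> < r then 0 else k s)"
  have [measurable]: "k1 \<in> borel_measurable borel" "k2 \<in> borel_measurable borel"
    unfolding k1_def k2_def by measurable
  have bd1: "norm (k1 s) \<le> norm (k t) + 1" for s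
    using r(2)[of s] norm_triangle_ineq2[of "k s" "k t"] norm_ge_zero[of "k t"] unfolding k1_def
    by (cases "\<bar>s - t\<bar> < r") (simp_all del: norm_ge_zero)
  have "\<forall>\<^sub>F s in nhds t. k1 s = k s"
    using r(1) unfolding eventually_nhds_metric k1_def dist_real_def by auto
  then have "isCont k1 t" using cont isCont_cong by blast
  from heat_approximation_bounded(1)[OF _ bd1 this]
  have lim1: "(\<lambda>n. LINT s|lborel. k1 s * complex_of_real (heat (1 / Suc n) (s - t))) \<longlonglongrightarrow> k t"
    using r(1) by (simp add: k1_def)
  obtain M where M: "\<And>n v. \<bar>v\<bar> \<ge> r \<Longrightarrow> heat (1 / Suc n) v \<le> M" "M \<ge> 0" using heat_far_bound[OF r(1)] by blast
  have bd2: "norm (k2 s * complex_of_real (heat (1 / Suc n) (s - t))) \<le> norm (k s) * M" for s n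
    using M(1)[of "s - t" n] M(2) by (auto simp: k2_def norm_mult intro!: mult_left_mono)
  have bd1': "norm (k1 s * complex_of_real (heat (1 / Suc n) (s - t))) \<le> norm (k s) * sqrt (pi * Suc n)" for s n
    by (auto simp: k1_def norm_mult heat_def intro!: mult_left_mono mult_left_le)
  have int2: "integrable lborel (\<lambda>s. k2 s * complex_of_real (heat (1 / Suc n) (s - t)))" for n
    by (rule Bochner_Integration.integrable_bound[where f="\<lambda>s. norm (k s) * M"])
       (use int bd2 M(2) in auto)
  have int1: "integrable lborel (\<lambda>s. k1 s * complex_of_real (heat (1 / Suc n) (s - t)))" for n
    by (rule Bochner_Integration.integrable_bound[where f="\<lambda>s. norm (k s) * sqrt (pi * Suc n)"])
       (use int bd1'[of _ n] in auto)
  have "(\<lambda>n. LINT s|lborel. k2 s * complex_of_real (heat (1 / Suc n) (s - t))) \<longlonglongrightarrow> (LINT s::real|lborel. 0)"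
  proof (rule integral_dominated_convergence[where w="\<lambda>s. norm (k s) * M"])
    show "AE s in lborel. (\<lambda>n. k2 s * complex_of_real (heat (1 / Suc n) (s - t))) \<longlonglongrightarrow> 0"
    proof (rule AE_I2)
      fix s :: real
      show "(\<lambda>n. k2 s * complex_of_real (heat (1 / Suc n) (s - t))) \<longlonglongrightarrow> 0"
      proof (cases "\<bar>s - t\<bar> < r")
        case False
        then have "\<bar>s - t\<bar> > 0" using r(1) by linarith
        then have "(s - t)\<^sup>2 > 0" by simp
        then have "(\<lambda>n. sqrt (pi / (1 / Suc n)) * exp (- (pi\<^sup>2 / (1 / Suc n)) * (s-t)\<^sup>2)) \<longlonglongrightarrow> 0"
          by real_asymp
        then show ?thesis
          unfolding heat_def by (intro tendsto_mult_right_zero) (auto dest: tendsto_of_real[where 'a=complex])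
      qed (simp add: k2_def)
    qed
  qed (use int bd2 in auto)
  with lim1 have "(\<lambda>n. (LINT s|lborel. k1 s * complex_of_real (heat (1 / Suc n) (s - t)))
     + (LINT s|lborel. k2 s * complex_of_real (heat (1 / Suc n) (s - t)))) \<longlonglongrightarrow> k t + 0"
    by (intro tendsto_add) auto
  moreover have "(LINT s|lborel. k1 s * complex_of_real (heat (1 / Suc n) (s - t)))
     + (LINT s|lborel. k2 s * complex_of_real (heat (1 / Suc n) (s - t)))
     = (LINT s|lborel. k s * complex_of_real (heat (1 / Suc n) (s - t)))" for n
    by (subst Bochner_Integration.integral_add[OF int1 int2, symmetric])
       (intro Bochner_Integration.integral_cong refl, auto simp: k1_def k2_def)
  ultimately show ?thesis by simp
qed

lemma fourier_measurable:
  assumes "integrable lborel k"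
  shows "fourier k \<in> borel_measurable borel"
  using fourier_continuous[OF assms] by (rule borel_measurable_continuous_onI)

theorem fourier_inversion:
  fixes k :: "real \<Rightarrow> complex"
  assumes k: "integrable lborel k" and cont: "isCont k t" and kh: "integrable lborel (fourier k)"
  shows "k t = (LINT \<xi>|lborel. fourier k \<xi> * cis (2 * pi * t * \<xi>))"
proof (rule LIMSEQ_unique)
  show "(\<lambda>n. LINT s|lborel. k s * complex_of_real (heat (1 / Suc n) (s - t))) \<longlonglongrightarrow> k t"
    using heat_approximation[OF k cont] .
  have [measurable]: "fourier k \<in> borel_measurable borel" using k fourier_measurable by auto
  have "(\<lambda>n. LINT \<xi>|lborel. fourier k \<xi> * (complex_of_real (exp (- (1 / Suc n) * \<xi>\<^sup>2)) * cis (2 * pi * t * \<xi>)))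
     \<longlonglongrightarrow> (LINT \<xi>|lborel. fourier k \<xi> * cis (2 * pi * t * \<xi>))"
  proof (rule integral_dominated_convergence[where w="\<lambda>\<xi>. norm (fourier k \<xi>)"])
    show "AE \<xi> in lborel. (\<lambda>n. fourier k \<xi> * (complex_of_real (exp (- (1 / Suc n) * \<xi>\<^sup>2)) * cis (2 * pi * t * \<xi>)))
       \<longlonglongrightarrow> fourier k \<xi> * cis (2 * pi * t * \<xi>)"
    proof (rule AE_I2)
      fix \<xi> :: real
      have "(\<lambda>n. complex_of_real (exp (- (1 / Suc n) * \<xi>\<^sup>2))) \<longlonglongrightarrow> complex_of_real 1"
        by (intro tendsto_of_real) real_asymp
      then have "(\<lambda>n. fourier k \<xi> * (complex_of_real (exp (- (1 / Suc n) * \<xi>\<^sup>2)) * cis (2 * pi * t * \<xi>)))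
       \<longlonglongrightarrow> fourier k \<xi> * (complex_of_real 1 * cis (2 * pi * t * \<xi>))"
        by (intro tendsto_mult tendsto_const)
      then show "(\<lambda>n. fourier k \<xi> * (complex_of_real (exp (- (1 / Suc n) * \<xi>\<^sup>2)) * cis (2 * pi * t * \<xi>)))
       \<longlonglongrightarrow> fourier k \<xi> * cis (2 * pi * t * \<xi>)" by simp
    qed
  qed (use kh in \<open>auto simp: norm_mult intro!: AE_I2 mult_left_le\<close>)
  then show "(\<lambda>n. LINT s|lborel. k s * complex_of_real (heat (1 / Suc n) (s - t)))
     \<longlonglongrightarrow> (LINT \<xi>|lborel. fourier k \<xi> * cis (2 * pi * t * \<xi>))"
    using fourier_heat[OF k, of "1 / Suc n" t for n] by simp
qed

text \<open>Phrased with \<open>ennreal\<close> values so that integrability of the transform need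
  not be checked in applications: if the integral is infinite, nothing is claimed.\<close>

lemma norm_le_nn_integral_fourier:
  fixes k :: "real \<Rightarrow> complex"
  assumes k: "integrable lborel k" and cont: "isCont k t"
  shows "ennreal (norm (k t)) \<le> (\<integral>\<^sup>+\<xi>. ennreal (norm (fourier k \<xi>)) \<partial>lborel)"
proof (cases "(\<integral>\<^sup>+\<xi>. ennreal (norm (fourier k \<xi>)) \<partial>lborel) = \<infinity>")
  case False
  have [measurable]: "fourier k \<in> borel_measurable borel" using k fourier_measurable by auto
  have kh: "integrable lborel (fourier k)"
    using False by (intro integrableI_bounded) (auto simp: less_top)
  have "norm (k t) \<le> (LINT \<xi>|lborel. norm (fourier k \<xi> * cis (2 * pi * t * \<xi>)))"
    by (subst fourier_inversion[OF k cont kh]) (rule integral_norm_bound)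
  also have "\<dots> = (LINT \<xi>|lborel. norm (fourier k \<xi>))" by (simp add: norm_mult)
  finally show ?thesis using kh
    by (subst nn_integral_eq_integral) (auto intro: ennreal_leI)
qed simp

text \<open>The damped integrals \<open>I n\<close> increase to the left-hand side. The
  multiplication formula with \<open>h n\<close>, the damped conjugate of the transform, rewrites
  \<open>I n\<close> as the integral of \<open>k\<close> against the conjugate of its heat average
  \<open>J n\<close>. Since \<open>J n\<close> is bounded by \<open>B\<close>, the function
  \<open>norm (k t) * B\<close> dominates.\<close>

theorem plancherel:
  fixes k :: "real \<Rightarrow> complex"
  assumes k: "integrable lborel k" and cont: "continuous_on UNIV k" and bd: "\<And>x. norm (k x) \<le> B"
  shows "(\<integral>\<^sup>+\<xi>. ennreal ((norm (fourier k \<xi>))\<^sup>2) \<partial>lborel) = (\<integral>\<^sup>+x. ennreal ((norm (k x))\<^sup>2) \<partial>lborel)"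
proof (rule LIMSEQ_unique)
  have [measurable]: "k \<in> borel_measurable borel" "fourier k \<in> borel_measurable borel"
    using k fourier_measurable by auto
  define I where "I n = (\<integral>\<^sup>+\<xi>. ennreal ((norm (fourier k \<xi>))\<^sup>2 * exp (- (1 / Suc n) * \<xi>\<^sup>2)) \<partial>lborel)" for n
  define A where "A = (LINT x|lborel. norm (k x))"
  have B: "B \<ge> 0" using bd[of 0] norm_ge_zero order_trans by blast
  have "I \<longlonglongrightarrow> (\<integral>\<^sup>+\<xi>. ennreal ((norm (fourier k \<xi>))\<^sup>2) \<partial>lborel)"
    unfolding I_def
  proof (rule nn_integral_LIMSEQ)
    show "incseq (\<lambda>n \<xi>. ennreal ((norm (fourier k \<xi>))\<^sup>2 * exp (- (1 / Suc n) * \<xi>\<^sup>2)))"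
      by (auto simp: incseq_def le_fun_def intro!: ennreal_leI mult_left_mono mult_right_mono divide_left_mono)
    show "(\<lambda>n. ennreal ((norm (fourier k \<xi>))\<^sup>2 * exp (- (1 / Suc n) * \<xi>\<^sup>2))) \<longlonglongrightarrow> ennreal ((norm (fourier k \<xi>))\<^sup>2)" for \<xi>
    proof -
      have "(\<lambda>n. exp (- (1 / Suc n) * \<xi>\<^sup>2)) \<longlonglongrightarrow> 1" by real_asymp
      then have "(\<lambda>n. (norm (fourier k \<xi>))\<^sup>2 * exp (- (1 / Suc n) * \<xi>\<^sup>2)) \<longlonglongrightarrow> (norm (fourier k \<xi>))\<^sup>2 * 1"
        by (intro tendsto_mult tendsto_const)
      then show ?thesis by (intro tendsto_ennrealI) simp
    qed
  qed measurable
  then show "I \<longlonglongrightarrow> (\<integral>\<^sup>+\<xi>. ennreal ((norm (fourier k \<xi>))\<^sup>2) \<partial>lborel)" .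
  define J where "J n t = (LINT s|lborel. k s * complex_of_real (heat (1 / Suc n) (s - t)))" for n t
  have Jlim: "(\<lambda>n. J n t) \<longlonglongrightarrow> k t" and Jbd: "norm (J n t) \<le> B" for n t
    unfolding J_def using heat_approximation_bounded[where k=k and t=t and B=B] bd cont
    by (auto simp: continuous_on_eq_continuous_at)
  have Jeq: "J n t = (LINT \<xi>|lborel. fourier k \<xi> * (complex_of_real (exp (- (1 / Suc n) * \<xi>\<^sup>2)) * cis (2 * pi * t * \<xi>)))" for n t
    unfolding J_def by (rule fourier_heat[OF k, symmetric]) simp
  define h where "h n \<xi> = complex_of_real (exp (- (1 / Suc n) * \<xi>\<^sup>2)) * cnj (fourier k \<xi>)" for n \<xi>
  have A: "norm (fourier k \<xi>) \<le> \<bar>A\<bar>" for \<xi>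
    using fourier_norm_le[of k \<xi>] unfolding A_def by linarith
  have [measurable]: "cnj \<in> borel_measurable borel"
    by (intro borel_measurable_continuous_onI continuous_intros)
  have hint: "integrable lborel (h n)" for n
  proof (rule Bochner_Integration.integrable_bound[where f="\<lambda>\<xi>. exp (- (1 / Suc n) * \<xi>\<^sup>2) * A"])
    show "integrable lborel (\<lambda>\<xi>. exp (- (1 / Suc n) * \<xi>\<^sup>2) * A)"
      using gaussian_integral_0(1)[of "1 / Suc n"] by simp
    show "h n \<in> borel_measurable lborel" unfolding h_def[abs_def] by measurable
    show "AE \<xi> in lborel. norm (h n \<xi>) \<le> norm (exp (- (1 / Suc n) * \<xi>\<^sup>2) * A)"
      by (rule AE_I2) (simp add: h_def norm_mult abs_mult A)
  qed
  have hF: "fourier (h n) t = cnj (J n t)" for n t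
  proof -
    have "cnj (J n t) = (LINT \<xi>|lborel. cnj (fourier k \<xi> * (complex_of_real (exp (- (1 / Suc n) * \<xi>\<^sup>2)) * cis (2 * pi * t * \<xi>))))"
      unfolding Jeq by (rule Bochner_Integration.integral_cnj[symmetric])
    also have "\<dots> = fourier (h n) t"
      unfolding fourier_cis h_def
      by (intro Bochner_Integration.integral_cong refl) (simp add: cis_cnj mult_ac)
    finally show ?thesis by simp
  qed
  have [measurable]: "J n \<in> borel_measurable borel" for n
  proof -
    have "(\<lambda>t. cnj (fourier (h n) t)) \<in> borel_measurable borel" using fourier_measurable[OF hint[of n]] by measurable
    then show ?thesis by (simp add: hF)
  qed
  have "(LINT \<xi>|lborel. fourier k \<xi> * h n \<xi>) = complex_of_real (LINT \<xi>|lborel. (norm (fourier k \<xi>))\<^sup>2 * exp (- (1 / Suc n) * \<xi>\<^sup>2))" for n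
    unfolding h_def
    by (subst integral_complex_of_real[symmetric], intro Bochner_Integration.integral_cong refl)
       (simp add: complex_norm_square mult_ac del: of_real_power)
  moreover have "(LINT \<xi>|lborel. fourier k \<xi> * h n \<xi>) = (LINT t|lborel. k t * cnj (J n t))" for n
    using fourier_multiplication[OF k hint[of n]] by (simp add: hF)
  ultimately have eq: "(LINT \<xi>|lborel. (norm (fourier k \<xi>))\<^sup>2 * exp (- (1 / Suc n) * \<xi>\<^sup>2)) = Re (LINT t|lborel. k t * cnj (J n t))" for n
    by (metis Re_complex_of_real)
  have Iint: "I n = ennreal (Re (LINT t|lborel. k t * cnj (J n t)))" for n
    unfolding I_def eq[symmetric]
  proof (rule nn_integral_eq_integral)
    have "(norm (fourier k \<xi>))\<^sup>2 \<le> A\<^sup>2" for \<xi>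
      using fourier_norm_le[of k \<xi>] by (simp add: A_def power_mono)
    then have le: "norm ((norm (fourier k \<xi>))\<^sup>2 * exp (- (1 / Suc n) * \<xi>\<^sup>2)) \<le> norm (A\<^sup>2 * exp (- (1 / Suc n) * \<xi>\<^sup>2))" for \<xi>
      unfolding norm_mult by (intro mult_right_mono) auto
    show "integrable lborel (\<lambda>\<xi>. (norm (fourier k \<xi>))\<^sup>2 * exp (- (1 / Suc n) * \<xi>\<^sup>2))"
    proof (rule Bochner_Integration.integrable_bound[where f="\<lambda>\<xi>. A\<^sup>2 * exp (- (1 / Suc n) * \<xi>\<^sup>2)"])
      show "integrable lborel (\<lambda>\<xi>. A\<^sup>2 * exp (- (1 / Suc n) * \<xi>\<^sup>2))"
        using gaussian_integral_0(1)[of "1 / Suc n"] by simp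
    qed (use le in auto)
  qed auto
  have "(\<lambda>n. LINT t|lborel. k t * cnj (J n t)) \<longlonglongrightarrow> (LINT t|lborel. k t * cnj (k t))"
    by (rule integral_dominated_convergence[where w="\<lambda>t. norm (k t) * B"])
       (use k in \<open>auto simp: norm_mult intro!: AE_I2 tendsto_intros Jlim mult_left_mono Jbd\<close>)
  also have "(LINT t|lborel. k t * cnj (k t)) = complex_of_real (LINT t|lborel. (norm (k t))\<^sup>2)"
    by (subst integral_complex_of_real[symmetric]) (simp add: complex_norm_square del: of_real_power)
  finally have "I \<longlonglongrightarrow> ennreal (LINT t|lborel. (norm (k t))\<^sup>2)"
    unfolding Iint by (intro tendsto_ennrealI) (auto dest: tendsto_Re)
  also have "ennreal (LINT t|lborel. (norm (k t))\<^sup>2) = (\<integral>\<^sup>+x. ennreal ((norm (k x))\<^sup>2) \<partial>lborel)"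
  proof (rule nn_integral_eq_integral[symmetric])
    show "integrable lborel (\<lambda>x. (norm (k x))\<^sup>2)"
      by (rule Bochner_Integration.integrable_bound[where f="\<lambda>x. norm (k x) * B"])
         (use k bd B in \<open>auto simp: power2_eq_square intro!: mult_left_mono AE_I2\<close>)
  qed auto
  finally show "I \<longlonglongrightarrow> (\<integral>\<^sup>+x. ennreal ((norm (k x))\<^sup>2) \<partial>lborel)" .
qed

section \<open>Wirtinger's inequality\<close>

text \<open>Obtained by integrating \<open>(norm (\<phi>' + T * \<phi>))\<^sup>2 \<ge> 0\<close> for
  \<open>T t = \<omega> * tan (\<omega> * (t - c))\<close>, \<open>c\<close> the midpoint, which solves \<open>T' = \<omega>\<^sup>2 + T\<^sup>2\<close>.\<close>
lemma wirtinger_interval: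
  fixes \<phi> \<phi>' :: "real \<Rightarrow> complex"
  assumes ab: "a \<le> b" and der: "\<And>t. (\<phi> has_vector_derivative \<phi>' t) (at t)"
    and cont': "continuous_on UNIV \<phi>'" and \<omega>: "\<omega> > 0" "\<omega> * (b - a) < pi"
  shows "\<omega>\<^sup>2 * integral {a..b} (\<lambda>t. (norm (\<phi> t))\<^sup>2) \<le> integral {a..b} (\<lambda>t. (norm (\<phi>' t))\<^sup>2)
     + \<omega> * tan (\<omega> * (b - a) / 2) * ((norm (\<phi> a))\<^sup>2 + (norm (\<phi> b))\<^sup>2)"
proof -
  define c where "c = (a + b) / 2"
  define T where "T t = \<omega> * tan (\<omega> * (t - c))" for t
  define \<Psi> where "\<Psi> t = T t * (\<phi> t \<bullet> \<phi> t)" for t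
  define \<Psi>' where "\<Psi>' t = (\<omega>\<^sup>2 + (T t)\<^sup>2) * (\<phi> t \<bullet> \<phi> t) + 2 * T t * (\<phi> t \<bullet> \<phi>' t)" for t
  \<comment> \<open>Half the interval, scaled by \<open>\<omega>\<close>, is shorter than
    \<open>pi / 2\<close>, so the tangent has no pole on \<open>{a..b}\<close>.\<close>
  have cosnz: "cos (\<omega> * (t - c)) \<noteq> 0" if "t \<in> {a..b}" for t
  proof -
    have "\<bar>t - c\<bar> \<le> (b - a) / 2" using that by (auto simp: c_def abs_le_iff field_simps)
    then have "\<omega> * \<bar>t - c\<bar> \<le> \<omega> * ((b - a) / 2)" using \<omega> by (intro mult_left_mono) auto
    also have "\<dots> < pi / 2" using \<omega> by simp
    finally have "\<bar>\<omega> * (t - c)\<bar> < pi / 2" using \<omega> by (simp add: abs_mult)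
    then have "cos (\<omega> * (t - c)) > 0" by (intro cos_gt_zero_pi) linarith+
    then show ?thesis by simp
  qed
  have contphi: "continuous_on {a..b} \<phi>" "continuous_on {a..b} \<phi>'"
    using has_vector_derivative_continuous[OF der] continuous_on_subset[OF cont']
    by (auto intro!: continuous_at_imp_continuous_on)
  have contT: "continuous_on {a..b} T"
    unfolding T_def using cosnz by (intro continuous_intros) auto
  have derPsi: "(\<Psi> has_vector_derivative \<Psi>' t) (at t within {a..b})" if t: "t \<in> {a..b}" for t
  proof -
    have "(T has_real_derivative \<omega> * (inverse ((cos (\<omega> * (t - c)))\<^sup>2) * \<omega>)) (at t)"
      unfolding T_def using cosnz[OF t] by (auto intro!: derivative_eq_intros)
    moreover have "inverse ((cos (\<omega> * (t - c)))\<^sup>2) = 1 + (tan (\<omega> * (t - c)))\<^sup>2"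
      using tan_sec[OF cosnz[OF t]] by (simp add: power_inverse)
    ultimately have "(T has_real_derivative \<omega>\<^sup>2 + (T t)\<^sup>2) (at t)"
      by (simp add: T_def power2_eq_square algebra_simps)
    moreover have "((\<lambda>t. \<phi> t \<bullet> \<phi> t) has_real_derivative 2 * (\<phi> t \<bullet> \<phi>' t)) (at t)"
      using bounded_bilinear.has_vector_derivative[OF bounded_bilinear_inner der der, of t]
      by (simp add: has_real_derivative_iff_has_vector_derivative inner_commute)
    ultimately have "(\<Psi> has_real_derivative \<Psi>' t) (at t)"
      unfolding \<Psi>_def[abs_def] \<Psi>'_def by (auto intro!: derivative_eq_intros simp: algebra_simps)
    then show ?thesis
      by (simp add: has_real_derivative_iff_has_vector_derivative has_vector_derivative_at_within)
  qed
  have contPsi': "continuous_on {a..b} \<Psi>'"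
    unfolding \<Psi>'_def by (intro continuous_intros contphi contT)
  have int: "integral {a..b} \<Psi>' = \<Psi> b - \<Psi> a"
    using fundamental_theorem_of_calculus[OF ab derPsi] by (intro integral_unique) auto
  have "0 \<le> integral {a..b} (\<lambda>t. (norm (\<phi>' t + T t *\<^sub>R \<phi> t))\<^sup>2)"
    by (intro integral_nonneg integrable_continuous_interval continuous_intros contphi contT) auto
  also have "\<dots> = integral {a..b} (\<lambda>t. ((norm (\<phi>' t))\<^sup>2 - \<omega>\<^sup>2 * (norm (\<phi> t))\<^sup>2) + \<Psi>' t)"
    unfolding \<Psi>'_def power2_norm_eq_inner
    by (intro integral_cong) (simp add: inner_add inner_commute algebra_simps power2_eq_square)
  also have "\<dots> = (integral {a..b} (\<lambda>t. (norm (\<phi>' t))\<^sup>2) - \<omega>\<^sup>2 * integral {a..b} (\<lambda>t. (norm (\<phi> t))\<^sup>2)) + integral {a..b} \<Psi>'"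
    by (subst integral_add integral_diff,
        (intro integrable_continuous_interval continuous_intros contphi contPsi')+)+ auto
  also have "integral {a..b} \<Psi>' = \<omega> * tan (\<omega> * (b - a) / 2) * ((norm (\<phi> a))\<^sup>2 + (norm (\<phi> b))\<^sup>2)"
  proof -
    have e: "\<omega> * (b - c) = \<omega> * (b - a) / 2" "\<omega> * (a - c) = - (\<omega> * (b - a) / 2)"
      by (simp_all add: c_def field_simps)
    show ?thesis unfolding int \<Psi>_def T_def e tan_minus by (simp add: power2_norm_eq_inner distrib_left)
  qed
  finally show ?thesis by linarith
qed

text \<open>Makes the boundary term of a gap proportional to its length, so that the boundary terms
  of a chain add up to its total length.\<close>

lemma tan_le_div_cos:
  fixes x y :: real
  assumes "0 \<le> x" "x \<le> y" "y < pi / 2"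
  shows "tan x \<le> x / cos y"
proof -
  have c: "cos y > 0" using assms by (intro cos_gt_zero_pi) auto
  have "cos y \<le> cos x" using assms by (intro cos_monotone_0_pi_le) auto
  then show ?thesis unfolding tan_def using sin_x_le_x[OF assms(1)] c assms
    by (intro frac_le) auto
qed

text \<open>The interval inequality summed over consecutive gaps. Gaps are bounded from above only,
  so there is no control over the number of nodes; for this reason the error is expressed through
  \<open>t n - t 0\<close>.\<close>

lemma wirtinger_chain:
  fixes \<phi> \<phi>' :: "real \<Rightarrow> complex" and t :: "nat \<Rightarrow> real"
  assumes der: "\<And>t. (\<phi> has_vector_derivative \<phi>' t) (at t)"
    and cont': "continuous_on UNIV \<phi>'" and \<omega>: "\<omega> > 0" "\<omega> * h < pi"
    and t: "\<And>i. i < n \<Longrightarrow> t i \<le> t (Suc i) \<and> t (Suc i) - t i \<le> h"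
    and m: "\<And>i. i \<le> n \<Longrightarrow> norm (\<phi> (t i)) \<le> m"
  shows "t 0 \<le> t n \<and> \<omega>\<^sup>2 * integral {t 0..t n} (\<lambda>t. (norm (\<phi> t))\<^sup>2) \<le> integral {t 0..t n} (\<lambda>t. (norm (\<phi>' t))\<^sup>2)
     + \<omega>\<^sup>2 * m\<^sup>2 / cos (\<omega> * h / 2) * (t n - t 0)"
  using t m
proof (induction n)
  case (Suc n)
  have IH: "t 0 \<le> t n" "\<omega>\<^sup>2 * integral {t 0..t n} (\<lambda>t. (norm (\<phi> t))\<^sup>2) \<le> integral {t 0..t n} (\<lambda>t. (norm (\<phi>' t))\<^sup>2)
     + \<omega>\<^sup>2 * m\<^sup>2 / cos (\<omega> * h / 2) * (t n - t 0)"
    using Suc.IH Suc.prems by auto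
  define L where "L = t (Suc n) - t n"
  have L: "L \<ge> 0" "L \<le> h" "t n \<le> t (Suc n)" using Suc.prems(1)[of n] by (auto simp: L_def)
  have "\<omega> * L \<le> \<omega> * h" using L \<omega> by (intro mult_left_mono) auto
  then have wL: "\<omega> * L < pi" "\<omega> * L / 2 \<le> \<omega> * h / 2" using \<omega> by linarith+
  have c: "cos (\<omega> * h / 2) > 0"
    using \<omega> L wL by (intro cos_gt_zero_pi) (auto intro: less_le_trans[of _ 0])
  have tan: "tan (\<omega> * L / 2) \<le> \<omega> * L / 2 / cos (\<omega> * h / 2)"
    using \<omega> L wL by (intro tan_le_div_cos) auto
  have cont: "continuous_on S \<phi>" "continuous_on S \<phi>'" for S
    using has_vector_derivative_continuous[OF der] continuous_on_subset[OF cont']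
    by (auto intro!: continuous_at_imp_continuous_on)
  have m0: "m \<ge> 0" using Suc.prems(2)[of 0] norm_ge_zero order_trans by blast
  have sq: "(norm (\<phi> (t n)))\<^sup>2 \<le> m\<^sup>2" "(norm (\<phi> (t (Suc n))))\<^sup>2 \<le> m\<^sup>2"
    using Suc.prems(2)[of n] Suc.prems(2)[of "Suc n"] by (auto intro: power_mono)
  have "\<omega>\<^sup>2 * integral {t n..t (Suc n)} (\<lambda>t. (norm (\<phi> t))\<^sup>2) \<le> integral {t n..t (Suc n)} (\<lambda>t. (norm (\<phi>' t))\<^sup>2)
     + \<omega> * tan (\<omega> * L / 2) * ((norm (\<phi> (t n)))\<^sup>2 + (norm (\<phi> (t (Suc n))))\<^sup>2)"
    using wirtinger_interval[OF L(3) der cont' \<omega>(1)] wL(1) by (simp add: L_def)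
  also have "\<omega> * tan (\<omega> * L / 2) * ((norm (\<phi> (t n)))\<^sup>2 + (norm (\<phi> (t (Suc n))))\<^sup>2)
      \<le> \<omega> * (\<omega> * L / 2 / cos (\<omega> * h / 2)) * (m\<^sup>2 + m\<^sup>2)"
    using \<omega> L c tan sq by (intro mult_mono mult_left_mono add_mono mult_nonneg_nonneg divide_nonneg_nonneg) auto
  also have "\<dots> = \<omega>\<^sup>2 * m\<^sup>2 / cos (\<omega> * h / 2) * L" by (simp add: power2_eq_square)
  finally have step: "\<omega>\<^sup>2 * integral {t n..t (Suc n)} (\<lambda>t. (norm (\<phi> t))\<^sup>2) \<le> integral {t n..t (Suc n)} (\<lambda>t. (norm (\<phi>' t))\<^sup>2)
     + \<omega>\<^sup>2 * m\<^sup>2 / cos (\<omega> * h / 2) * L" by simp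
  have comb: "integral {t 0..t (Suc n)} (\<lambda>t. (norm (f t))\<^sup>2) = integral {t 0..t n} (\<lambda>t. (norm (f t))\<^sup>2) + integral {t n..t (Suc n)} (\<lambda>t. (norm (f t))\<^sup>2)"
    if "continuous_on UNIV f" for f :: "real \<Rightarrow> complex"
    using IH(1) L(3) that continuous_on_subset
    by (intro Henstock_Kurzweil_Integration.integral_combine[symmetric] integrable_continuous_interval continuous_intros) blast+
  show ?case
    unfolding comb[OF cont(1)] comb[OF cont(2)]
  proof
    have "\<omega>\<^sup>2 * m\<^sup>2 / cos (\<omega> * h / 2) * (t (Suc n) - t 0) = \<omega>\<^sup>2 * m\<^sup>2 / cos (\<omega> * h / 2) * (t n - t 0) + \<omega>\<^sup>2 * m\<^sup>2 / cos (\<omega> * h / 2) * L"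
      unfolding distrib_left[symmetric] by (simp add: L_def)
    then show "\<omega>\<^sup>2 * (integral {t 0..t n} (\<lambda>t. (norm (\<phi> t))\<^sup>2) + integral {t n..t (Suc n)} (\<lambda>t. (norm (\<phi> t))\<^sup>2))
       \<le> integral {t 0..t n} (\<lambda>t. (norm (\<phi>' t))\<^sup>2) + integral {t n..t (Suc n)} (\<lambda>t. (norm (\<phi>' t))\<^sup>2)
         + \<omega>\<^sup>2 * m\<^sup>2 / cos (\<omega> * h / 2) * (t (Suc n) - t 0)"
      unfolding distrib_left[of "\<omega>\<^sup>2"] using IH(2) step by linarith
  qed (use IH L in linarith)
qed simp

section \<open>Fourier-Laplace integrals of functions with Gaussian decay\<close>

text \<open>Completing the square: half of the Gaussian absorbs the polynomial and the exponential
  factor together.\<close>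

lemma exp_gaussian_domination:
  fixes b c \<xi> :: real
  assumes "c > 0"
  shows "(1 + \<bar>\<xi>\<bar>) ^ p * exp (b * \<bar>\<xi>\<bar>) * exp (- c * \<xi>\<^sup>2)
       \<le> exp ((real p + b)\<^sup>2 / (2 * c)) * exp (- (c / 2) * \<xi>\<^sup>2)"
proof -
  have "(1 + \<bar>\<xi>\<bar>) ^ p \<le> exp \<bar>\<xi>\<bar> ^ p" by (intro power_mono) auto
  also have "\<dots> = exp (real p * \<bar>\<xi>\<bar>)" by (simp add: exp_of_nat_mult)
  finally have "(1 + \<bar>\<xi>\<bar>) ^ p * exp (b * \<bar>\<xi>\<bar>) * exp (- c * \<xi>\<^sup>2) \<le> exp (real p * \<bar>\<xi>\<bar>) * exp (b * \<bar>\<xi>\<bar>) * exp (- c * \<xi>\<^sup>2)"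
    by (intro mult_right_mono) auto
  also have "\<dots> = exp ((real p + b) * \<bar>\<xi>\<bar> - c * \<xi>\<^sup>2)" by (simp add: exp_add[symmetric] algebra_simps)
  also have "\<dots> \<le> exp ((real p + b)\<^sup>2 / (2 * c) - (c / 2) * \<xi>\<^sup>2)"
  proof -
    have "0 \<le> ((real p + b) - c * \<bar>\<xi>\<bar>)\<^sup>2 / (2 * c)" using assms by simp
    also have "\<dots> = (real p + b)\<^sup>2 / (2 * c) - (real p + b) * \<bar>\<xi>\<bar> + c / 2 * \<xi>\<^sup>2"
      using assms by (simp add: power2_eq_square field_simps)
    finally show ?thesis by simp
  qed
  also have "\<dots> = exp ((real p + b)\<^sup>2 / (2 * c)) * exp (- (c / 2) * \<xi>\<^sup>2)" by (simp add: exp_add[symmetric])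
  finally show ?thesis .
qed

lemma integrable_gaussian_weight:
  fixes b c :: real
  assumes "c > 0"
  shows "integrable lborel (\<lambda>\<xi>. (1 + \<bar>\<xi>\<bar>) ^ p * exp (b * \<bar>\<xi>\<bar>) * exp (- c * \<xi>\<^sup>2))"
proof (rule Bochner_Integration.integrable_bound)
  show "integrable lborel (\<lambda>\<xi>. exp ((real p + b)\<^sup>2 / (2 * c)) * exp (- (c / 2) * \<xi>\<^sup>2))"
    using gaussian_integral_0(1)[of "c/2"] assms by simp
  show "AE \<xi> in lborel. norm ((1 + \<bar>\<xi>\<bar>) ^ p * exp (b * \<bar>\<xi>\<bar>) * exp (- c * \<xi>\<^sup>2))
     \<le> norm (exp ((real p + b)\<^sup>2 / (2 * c)) * exp (- (c / 2) * \<xi>\<^sup>2))"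
    using exp_gaussian_domination[OF assms] by (intro AE_I2) (simp add: abs_mult)
qed simp

text \<open>The inverse Fourier transform at a complex argument: real \<open>z\<close> gives the
  usual inversion integral, and Gaussian decay of \<open>\<psi>\<close> makes the function
  entire.\<close>

definition fourier_laplace :: "(real \<Rightarrow> complex) \<Rightarrow> complex \<Rightarrow> complex" where
  "fourier_laplace \<psi> z = (LINT \<xi>|lborel. \<psi> \<xi> * exp (2 * of_real pi * \<i> * of_real \<xi> * z))"

lemma norm_exp_fourier: "norm (exp (2 * of_real pi * \<i> * of_real \<xi> * z)) = exp (- (2 * pi * \<xi> * Im z))"
  by (simp add: norm_exp_eq_Re mult.assoc)

lemma norm_exp_fourier_le:
  "norm (exp (2 * of_real pi * \<i> * of_real \<xi> * z)) \<le> exp (2 * pi * \<bar>Im z\<bar> * \<bar>\<xi>\<bar>)"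
proof -
  have "- (\<xi> * Im z) \<le> \<bar>Im z\<bar> * \<bar>\<xi>\<bar>" by (metis abs_ge_minus_self abs_mult mult.commute)
  then have "(2 * pi) * - (\<xi> * Im z) \<le> (2 * pi) * (\<bar>Im z\<bar> * \<bar>\<xi>\<bar>)" by (intro mult_left_mono) auto
  then show ?thesis unfolding norm_exp_fourier by (simp add: mult_ac)
qed

lemma integrable_fourier_laplace:
  fixes \<psi> :: "real \<Rightarrow> complex"
  assumes [measurable]: "\<psi> \<in> borel_measurable borel" and c: "c > 0"
    and bd: "\<And>\<xi>. norm (\<psi> \<xi>) \<le> D * (1 + \<bar>\<xi>\<bar>) ^ p * exp (- c * \<xi>\<^sup>2)"
  shows "integrable lborel (\<lambda>\<xi>. \<psi> \<xi> * exp (2 * of_real pi * \<i> * of_real \<xi> * z))"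
proof (rule Bochner_Integration.integrable_bound)
  show "integrable lborel (\<lambda>\<xi>. D * ((1 + \<bar>\<xi>\<bar>) ^ p * exp ((2 * pi * \<bar>Im z\<bar>) * \<bar>\<xi>\<bar>) * exp (- c * \<xi>\<^sup>2)))"
    using integrable_gaussian_weight[OF c] by simp
  show "AE \<xi> in lborel. norm (\<psi> \<xi> * exp (2 * of_real pi * \<i> * of_real \<xi> * z))
     \<le> norm (D * ((1 + \<bar>\<xi>\<bar>) ^ p * exp ((2 * pi * \<bar>Im z\<bar>) * \<bar>\<xi>\<bar>) * exp (- c * \<xi>\<^sup>2)))"
  proof (rule AE_I2)
    fix \<xi> :: real
    have "norm (\<psi> \<xi> * exp (2 * of_real pi * \<i> * of_real \<xi> * z))
        \<le> (D * (1 + \<bar>\<xi>\<bar>) ^ p * exp (- c * \<xi>\<^sup>2)) * exp ((2 * pi * \<bar>Im z\<bar>) * \<bar>\<xi>\<bar>)"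
      unfolding norm_mult using bd[of \<xi>] order_trans[OF norm_ge_zero bd[of \<xi>]]
      by (intro mult_mono norm_exp_fourier_le) auto
    then show "norm (\<psi> \<xi> * exp (2 * of_real pi * \<i> * of_real \<xi> * z))
     \<le> norm (D * ((1 + \<bar>\<xi>\<bar>) ^ p * exp ((2 * pi * \<bar>Im z\<bar>) * \<bar>\<xi>\<bar>) * exp (- c * \<xi>\<^sup>2)))"
      by (simp add: mult_ac)
  qed
qed measurable

lemma norm_difference_quotient:
  fixes a d h :: complex
  assumes "h \<noteq> 0"
  shows "norm h * norm (a / h - d) = norm (a - h * d)"
  using assms by (simp add: norm_mult[symmetric] right_diff_distrib)

text \<open>Differentiation under the integral. The second-order Taylor remainder of the exponential
  leaves an error \<open>(norm h)\<^sup>2 * M\<close>, where \<open>M\<close> is the integral of a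
  majorant independent of \<open>h\<close>.\<close>

lemma fourier_laplace_has_field_derivative:
  fixes \<psi> :: "real \<Rightarrow> complex"
  assumes [measurable]: "\<psi> \<in> borel_measurable borel" and c: "c > 0"
    and bd: "\<And>\<xi>. norm (\<psi> \<xi>) \<le> D * (1 + \<bar>\<xi>\<bar>) ^ p * exp (- c * \<xi>\<^sup>2)"
  shows "(fourier_laplace \<psi> has_field_derivative
     fourier_laplace (\<lambda>\<xi>. \<psi> \<xi> * (2 * of_real pi * \<i> * of_real \<xi>)) z) (at z)"
proof -
  define w where "w \<xi> = 2 * of_real pi * \<i> * complex_of_real \<xi>" for \<xi>
  have [measurable]: "w \<in> borel_measurable borel" unfolding w_def by measurable
  have nw: "norm (w \<xi>) = 2 * pi * \<bar>\<xi>\<bar>" for \<xi> by (simp add: w_def norm_mult)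
  have D: "D \<ge> 0" using order_trans[OF norm_ge_zero bd[of 0]] by simp
  \<comment> \<open>The two additional powers come from \<open>(norm (w \<xi> * h))\<^sup>2\<close>,
    the \<open>+ 1\<close> in the exponent from the factor
    \<open>exp (2 * pi * \<bar>\<xi>\<bar>)\<close> that covers all
    \<open>norm h \<le> 1\<close>.\<close>
  define G where "G \<xi> = D * (4 * pi\<^sup>2) * ((1 + \<bar>\<xi>\<bar>) ^ (p + 2) * exp (2 * pi * (\<bar>Im z\<bar> + 1) * \<bar>\<xi>\<bar>) * exp (- c * \<xi>\<^sup>2))" for \<xi>
  have Gint: "integrable lborel G"
    unfolding G_def by (intro integrable_mult_right integrable_gaussian_weight c)
  define M where "M = (LINT \<xi>|lborel. G \<xi>)"
  have bd': "norm (\<psi> \<xi> * w \<xi>) \<le> (D * (2 * pi)) * (1 + \<bar>\<xi>\<bar>) ^ Suc p * exp (- c * \<xi>\<^sup>2)" for \<xi>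
  proof -
    have "norm (\<psi> \<xi> * w \<xi>) \<le> (D * (1 + \<bar>\<xi>\<bar>) ^ p * exp (- c * \<xi>\<^sup>2)) * (2 * pi * (1 + \<bar>\<xi>\<bar>))"
      unfolding norm_mult nw using bd[of \<xi>] D by (intro mult_mono) auto
    then show ?thesis by (simp only: mult_ac power_Suc)
  qed
  have int0: "integrable lborel (\<lambda>\<xi>. \<psi> \<xi> * exp (w \<xi> * z))" for z
    unfolding w_def by (rule integrable_fourier_laplace[OF _ c bd]) simp
  have int1: "integrable lborel (\<lambda>\<xi>. \<psi> \<xi> * w \<xi> * exp (w \<xi> * z))" for z
    using integrable_fourier_laplace[OF _ c bd'] by (simp add: w_def)
  have Phi: "fourier_laplace \<psi> z = (LINT \<xi>|lborel. \<psi> \<xi> * exp (w \<xi> * z))" for z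
    by (simp add: fourier_laplace_def w_def)
  have Phi': "fourier_laplace (\<lambda>\<xi>. \<psi> \<xi> * (2 * of_real pi * \<i> * of_real \<xi>)) z = (LINT \<xi>|lborel. \<psi> \<xi> * w \<xi> * exp (w \<xi> * z))" (is "?d = _")
    by (simp add: fourier_laplace_def w_def)
  have main: "norm (fourier_laplace \<psi> (z + h) - fourier_laplace \<psi> z - h * ?d) \<le> (norm h)\<^sup>2 * M" if h: "norm h \<le> 1" for h
  proof -
    have "fourier_laplace \<psi> (z + h) - fourier_laplace \<psi> z - h * ?d
       = (LINT \<xi>|lborel. \<psi> \<xi> * exp (w \<xi> * (z + h)) - \<psi> \<xi> * exp (w \<xi> * z) - h * (\<psi> \<xi> * w \<xi> * exp (w \<xi> * z)))"
      unfolding Phi Phi' using int0 int1 by simp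
    also have "norm \<dots> \<le> (LINT \<xi>|lborel. (norm h)\<^sup>2 * G \<xi>)"
    proof (rule order_trans[OF integral_norm_bound], rule integral_mono)
      show "integrable lborel (\<lambda>\<xi>. norm (\<psi> \<xi> * exp (w \<xi> * (z + h)) - \<psi> \<xi> * exp (w \<xi> * z) - h * (\<psi> \<xi> * w \<xi> * exp (w \<xi> * z))))"
        using int0 int1 by simp
      show "integrable lborel (\<lambda>\<xi>. (norm h)\<^sup>2 * G \<xi>)" using Gint by simp
      fix \<xi> :: real
      have eq: "\<psi> \<xi> * exp (w \<xi> * (z + h)) - \<psi> \<xi> * exp (w \<xi> * z) - h * (\<psi> \<xi> * w \<xi> * exp (w \<xi> * z))
        = \<psi> \<xi> * exp (w \<xi> * z) * (exp (w \<xi> * h) - (1 + w \<xi> * h))"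
        by (simp add: algebra_simps exp_add)
      have 1: "norm (exp (w \<xi> * h) - (1 + w \<xi> * h)) \<le> exp \<bar>Re (w \<xi> * h)\<bar> * (norm (w \<xi> * h))\<^sup>2"
        using Taylor_exp[of "w \<xi> * h" 1] by (simp add: numeral_2_eq_2)
      have "\<bar>Re (w \<xi> * h)\<bar> \<le> norm (w \<xi> * h)" by (rule abs_Re_le_cmod)
      also have "\<dots> \<le> 2 * pi * \<bar>\<xi>\<bar>" using h by (simp add: norm_mult nw mult_left_le)
      finally have 2: "exp \<bar>Re (w \<xi> * h)\<bar> \<le> exp (2 * pi * \<bar>\<xi>\<bar>)" by simp
      have 3: "norm (exp (w \<xi> * z)) \<le> exp (2 * pi * \<bar>Im z\<bar> * \<bar>\<xi>\<bar>)"
        using norm_exp_fourier_le[of \<xi> z] by (simp add: w_def)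
      have "norm (\<psi> \<xi> * exp (w \<xi> * z) * (exp (w \<xi> * h) - (1 + w \<xi> * h)))
        \<le> (D * (1 + \<bar>\<xi>\<bar>) ^ p * exp (- c * \<xi>\<^sup>2)) * exp (2 * pi * \<bar>Im z\<bar> * \<bar>\<xi>\<bar>) * (exp (2 * pi * \<bar>\<xi>\<bar>) * (norm (w \<xi> * h))\<^sup>2)"
        unfolding norm_mult using bd[of \<xi>] 3 D
        by (intro mult_mono order_trans[OF 1[unfolded norm_mult]] 2 order_refl) auto
      also have "\<dots> = D * (4 * pi\<^sup>2) * (norm h)\<^sup>2 * ((1 + \<bar>\<xi>\<bar>) ^ p * \<bar>\<xi>\<bar>\<^sup>2 * (exp (2 * pi * \<bar>Im z\<bar> * \<bar>\<xi>\<bar>) * exp (2 * pi * \<bar>\<xi>\<bar>)) * exp (- c * \<xi>\<^sup>2))"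
        by (simp add: norm_mult nw power_mult_distrib)
      also have "\<dots> = D * (4 * pi\<^sup>2) * (norm h)\<^sup>2 * ((1 + \<bar>\<xi>\<bar>) ^ p * \<bar>\<xi>\<bar>\<^sup>2 * exp (2 * pi * (\<bar>Im z\<bar> + 1) * \<bar>\<xi>\<bar>) * exp (- c * \<xi>\<^sup>2))"
        by (simp add: exp_add[symmetric] algebra_simps)
      also have "\<dots> \<le> D * (4 * pi\<^sup>2) * (norm h)\<^sup>2 * ((1 + \<bar>\<xi>\<bar>) ^ p * (1 + \<bar>\<xi>\<bar>)\<^sup>2 * exp (2 * pi * (\<bar>Im z\<bar> + 1) * \<bar>\<xi>\<bar>) * exp (- c * \<xi>\<^sup>2))"
        using D by (intro mult_left_mono mult_right_mono power_mono) auto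
      also have "\<dots> = (norm h)\<^sup>2 * G \<xi>" unfolding G_def power_add by (simp add: mult_ac)
      finally show "norm (\<psi> \<xi> * exp (w \<xi> * (z + h)) - \<psi> \<xi> * exp (w \<xi> * z) - h * (\<psi> \<xi> * w \<xi> * exp (w \<xi> * z)))
         \<le> (norm h)\<^sup>2 * G \<xi>" unfolding eq .
    qed
    also have "\<dots> = (norm h)\<^sup>2 * M" by (simp add: M_def)
    finally show ?thesis .
  qed
  show ?thesis
    unfolding DERIV_def LIM_eq
  proof (intro allI impI)
    fix r :: real assume r: "r > 0"
    define s where "s = min 1 (r / (\<bar>M\<bar> + 1))"
    have "norm ((fourier_laplace \<psi> (z + h) - fourier_laplace \<psi> z) / h - ?d) < r"
      if "h \<noteq> 0" "norm (h - 0) < s" for h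
    proof -
      have "norm h * norm ((fourier_laplace \<psi> (z + h) - fourier_laplace \<psi> z) / h - ?d) = norm (fourier_laplace \<psi> (z + h) - fourier_laplace \<psi> z - h * ?d)"
        by (rule norm_difference_quotient[OF that(1)])
      also have "\<dots> \<le> norm h * (norm h * M)" using main[of h] that by (simp add: s_def power2_eq_square)
      finally have "norm ((fourier_laplace \<psi> (z + h) - fourier_laplace \<psi> z) / h - ?d) \<le> norm h * M"
        using that(1) by simp
      also have "\<dots> \<le> norm h * (\<bar>M\<bar> + 1)" by (intro mult_left_mono) auto
      also have "\<dots> < r / (\<bar>M\<bar> + 1) * (\<bar>M\<bar> + 1)" using that(2) by (intro mult_strict_right_mono) (auto simp: s_def)
      also have "\<dots> = r" by simp
      finally show ?thesis .
    qed
    moreover have "s > 0" using r by (simp add: s_def)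
    ultimately show "\<exists>s>0. \<forall>x. x \<noteq> 0 \<and> norm (x - 0) < s \<longrightarrow>
        norm ((fourier_laplace \<psi> (z + x) - fourier_laplace \<psi> z) / x - ?d) < r" by blast
  qed
qed


section \<open>Wirtinger's inequality without differentiability\<close>

lemma nn_integral_Icc_eq_integral:
  fixes f :: "real \<Rightarrow> real"
  assumes "continuous_on {a..b} f" "\<And>x. f x \<ge> 0"
  shows "(\<integral>\<^sup>+x. ennreal (f x) * indicator {a..b} x \<partial>lborel) = ennreal (integral {a..b} f)"
proof -
  have int: "set_integrable lborel {a..b} f" by (rule borel_integrable_atLeastAtMost'[OF assms(1)])
  have "(\<integral>\<^sup>+x. ennreal (f x) * indicator {a..b} x \<partial>lborel) = (\<integral>\<^sup>+x. ennreal (indicator {a..b} x *\<^sub>R f x) \<partial>lborel)"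
    by (intro nn_integral_cong) (auto simp: indicator_def)
  also have "\<dots> = ennreal (LINT x|lborel. indicator {a..b} x *\<^sub>R f x)"
    using int assms(2) by (intro nn_integral_eq_integral) (auto simp: set_integrable_def)
  also have "\<dots> = ennreal (integral {a..b} f)"
    using set_borel_integral_eq_integral(2)[OF int] by (simp add: set_lebesgue_integral_def)
  finally show ?thesis .
qed

lemma nn_integral_reflect:
  fixes f :: "real \<Rightarrow> ennreal"
  assumes [measurable]: "f \<in> borel_measurable borel"
  shows "(\<integral>\<^sup>+x. f (- x) \<partial>lborel) = (\<integral>\<^sup>+x. f x \<partial>lborel)"
  using nn_integral_real_affine[of f "-1" 0] by simp

text \<open>The convolution with \<open>heat c\<close>, defined on the Fourier side, where
  differentiation is multiplication by \<open>2 * pi * \<i> * \<xi>\<close> and the damping only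
  decreases the transform.\<close>

definition mollify :: "real \<Rightarrow> (real \<Rightarrow> complex) \<Rightarrow> real \<Rightarrow> complex" where
  "mollify c k t = fourier_laplace (\<lambda>\<xi>. fourier k \<xi> * complex_of_real (exp (- c * \<xi>\<^sup>2))) (complex_of_real t)"

lemma mollify_eq_heat:
  fixes k :: "real \<Rightarrow> complex"
  assumes "integrable lborel k" "c > 0"
  shows "mollify c k t = (LINT s|lborel. k s * complex_of_real (heat c (s - t)))"
  unfolding fourier_heat[OF assms, symmetric] mollify_def fourier_laplace_def cis_conv_exp
  by (intro Bochner_Integration.integral_cong refl) (simp add: mult_ac)

text \<open>The bound on the derivative does not involve \<open>c\<close>: it is Plancherel for the
  transform of \<open>k\<close> times \<open>2 * pi * \<i> * \<xi>\<close>, with the damping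
  estimated by 1. Hence it survives the limit in which the mollification disappears.\<close>

lemma mollify_deriv:
  fixes k :: "real \<Rightarrow> complex"
  assumes k: "integrable lborel k" and c: "c > 0"
  obtains k' where "\<And>t. (mollify c k has_vector_derivative k' t) (at t)" "continuous_on UNIV k'"
    and "(\<integral>\<^sup>+t. ennreal ((norm (k' t))\<^sup>2) \<partial>lborel) \<le> ennreal (4 * pi\<^sup>2) * (\<integral>\<^sup>+\<xi>. ennreal (\<xi>\<^sup>2 * (norm (fourier k \<xi>))\<^sup>2) \<partial>lborel)"
proof -
  have [measurable]: "fourier k \<in> borel_measurable borel" using k by (rule fourier_measurable)
  have contF: "continuous_on UNIV (fourier k)" using k by (rule fourier_continuous)
  define A where "A = (LINT x|lborel. norm (k x))"
  have A: "norm (fourier k \<xi>) \<le> A" for \<xi> unfolding A_def by (rule fourier_norm_le)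
  then have A0: "A \<ge> 0" using norm_ge_zero order_trans by blast
  define \<psi> where "\<psi> \<xi> = fourier k \<xi> * complex_of_real (exp (- c * \<xi>\<^sup>2))" for \<xi>
  define p where "p \<xi> = \<psi> \<xi> * (2 * of_real pi * \<i> * of_real \<xi>)" for \<xi>
  have bd: "norm (\<psi> \<xi>) \<le> A * (1 + \<bar>\<xi>\<bar>) ^ 0 * exp (- c * \<xi>\<^sup>2)" for \<xi>
    using A by (auto simp: \<psi>_def norm_mult intro!: mult_right_mono)
  have bdp: "norm (p \<xi>) \<le> A * (2 * pi) * (1 + \<bar>\<xi>\<bar>) ^ 1 * exp (- c * \<xi>\<^sup>2)" for \<xi>
  proof -
    have "norm (p \<xi>) = norm (\<psi> \<xi>) * (2 * pi * \<bar>\<xi>\<bar>)" by (simp add: p_def norm_mult)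
    also have "\<dots> \<le> (A * exp (- c * \<xi>\<^sup>2)) * (2 * pi * (1 + \<bar>\<xi>\<bar>))"
      using bd[of \<xi>] A0 by (intro mult_mono) auto
    finally show ?thesis by (simp only: mult_ac power_one_right)
  qed
  have mp: "p \<in> borel_measurable borel" unfolding p_def \<psi>_def by measurable
  have contp: "continuous_on UNIV p" unfolding p_def \<psi>_def by (intro continuous_intros contF)
  have intp: "integrable lborel p"
    using integrable_fourier_laplace[OF mp c bdp, of 0] by simp
  have pbd: "norm (p \<xi>) \<le> A * (2 * pi) * exp ((real 1 + 0)\<^sup>2 / (2 * c))" for \<xi>
  proof -
    have "(1 + \<bar>\<xi>\<bar>) ^ 1 * exp (- c * \<xi>\<^sup>2) \<le> exp ((real 1 + 0)\<^sup>2 / (2 * c)) * exp (- (c / 2) * \<xi>\<^sup>2)"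
      using exp_gaussian_domination[OF c, of \<xi> 1 0] by simp
    also have "\<dots> \<le> exp ((real 1 + 0)\<^sup>2 / (2 * c)) * 1" using c by (intro mult_left_mono) auto
    finally have "A * (2 * pi) * ((1 + \<bar>\<xi>\<bar>) ^ 1 * exp (- c * \<xi>\<^sup>2)) \<le> A * (2 * pi) * exp ((real 1 + 0)\<^sup>2 / (2 * c))"
      using A0 by (intro mult_left_mono) auto
    then show ?thesis using bdp[of \<xi>] by (simp only: mult.assoc)
  qed
  define k' where "k' t = fourier_laplace p (complex_of_real t)" for t
  have k'F: "k' t = fourier p (- t)" for t
    unfolding k'_def fourier_laplace_def fourier_def
    by (intro Bochner_Integration.integral_cong refl) (simp add: mult_ac)
  show ?thesis
  proof (rule that[of k'])
    fix t :: real
    have m\<psi>: "\<psi> \<in> borel_measurable borel" unfolding \<psi>_def by measurable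
    show "(mollify c k has_vector_derivative k' t) (at t)"
      using has_vector_derivative_real_field[OF fourier_laplace_has_field_derivative[OF m\<psi> c bd, of "complex_of_real t"]]
      by (simp add: o_def mollify_def[abs_def] \<psi>_def k'_def p_def[abs_def])
  next
    have "continuous_on UNIV (fourier p \<circ> uminus)"
      by (intro continuous_on_compose continuous_intros continuous_on_subset[OF fourier_continuous[OF intp]]) auto
    then show "continuous_on UNIV k'" by (simp add: o_def k'F[abs_def])
  next
    have "(\<integral>\<^sup>+t. ennreal ((norm (k' t))\<^sup>2) \<partial>lborel) = (\<integral>\<^sup>+t. ennreal ((norm (fourier p t))\<^sup>2) \<partial>lborel)"
      using nn_integral_reflect[of "\<lambda>t. ennreal ((norm (fourier p t))\<^sup>2)"] fourier_measurable[OF intp]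
      by (simp add: k'F)
    also have "\<dots> = (\<integral>\<^sup>+\<xi>. ennreal ((norm (p \<xi>))\<^sup>2) \<partial>lborel)"
      by (rule plancherel[OF intp contp pbd])
    also have "\<dots> \<le> (\<integral>\<^sup>+\<xi>. ennreal (4 * pi\<^sup>2) * ennreal (\<xi>\<^sup>2 * (norm (fourier k \<xi>))\<^sup>2) \<partial>lborel)"
    proof (rule nn_integral_mono)
      fix \<xi> :: real
      have "exp (- c * \<xi>\<^sup>2) \<le> 1" using c by simp
      then have "norm (\<psi> \<xi>) \<le> norm (fourier k \<xi>)" by (simp add: \<psi>_def norm_mult mult_left_le)
      then have "norm (p \<xi>) \<le> 2 * pi * \<bar>\<xi>\<bar> * norm (fourier k \<xi>)"
        by (simp add: p_def norm_mult mult_left_mono mult.commute)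
      then have "(norm (p \<xi>))\<^sup>2 \<le> (2 * pi * \<bar>\<xi>\<bar> * norm (fourier k \<xi>))\<^sup>2" by (intro power_mono) auto
      also have "\<dots> = 4 * pi\<^sup>2 * (\<xi>\<^sup>2 * (norm (fourier k \<xi>))\<^sup>2)" by (simp add: power_mult_distrib)
      finally show "ennreal ((norm (p \<xi>))\<^sup>2) \<le> ennreal (4 * pi\<^sup>2) * ennreal (\<xi>\<^sup>2 * (norm (fourier k \<xi>))\<^sup>2)"
        by (subst ennreal_mult[symmetric]) (auto intro: ennreal_leI)
    qed
    also have "\<dots> = ennreal (4 * pi\<^sup>2) * (\<integral>\<^sup>+\<xi>. ennreal (\<xi>\<^sup>2 * (norm (fourier k \<xi>))\<^sup>2) \<partial>lborel)"
      by (rule nn_integral_cmult) simp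
    finally show "(\<integral>\<^sup>+t. ennreal ((norm (k' t))\<^sup>2) \<partial>lborel) \<le> ennreal (4 * pi\<^sup>2) * (\<integral>\<^sup>+\<xi>. ennreal (\<xi>\<^sup>2 * (norm (fourier k \<xi>))\<^sup>2) \<partial>lborel)" .
  qed
qed

text \<open>Here \<open>k\<close> need not be differentiable; the derivative is replaced by the
  second moment of the transform, which may be infinite. The chain inequality is applied to
  mollifications of \<open>k\<close>, and the node and mass terms pass to the limit.\<close>

lemma wirtinger_fourier:
  fixes k :: "real \<Rightarrow> complex" and t :: "nat \<Rightarrow> real"
  assumes k: "integrable lborel k" and cont: "continuous_on UNIV k" and B: "\<And>x. norm (k x) \<le> B"
    and \<omega>: "\<omega> > 0" "\<omega> * h < pi" "h \<ge> 0"
    and t: "\<And>i. i < n \<Longrightarrow> t i \<le> t (Suc i) \<and> t (Suc i) - t i \<le> h"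
    and m: "\<And>i. i \<le> n \<Longrightarrow> norm (k (t i)) \<le> m"
  shows "ennreal (\<omega>\<^sup>2) * (\<integral>\<^sup>+x. ennreal ((norm (k x))\<^sup>2) * indicator {t 0..t n} x \<partial>lborel)
     \<le> ennreal (4 * pi\<^sup>2) * (\<integral>\<^sup>+\<xi>. ennreal (\<xi>\<^sup>2 * (norm (fourier k \<xi>))\<^sup>2) \<partial>lborel)
       + ennreal (\<omega>\<^sup>2 * m\<^sup>2 / cos (\<omega> * h / 2) * (t n - t 0))"
proof -
  have [measurable]: "k \<in> borel_measurable borel" using k by auto
  have isCont: "isCont k x" for x using cont by (simp add: continuous_on_eq_continuous_at)
  define kn where "kn n = mollify (1 / Suc n) k" for n
  have kn_lim: "(\<lambda>n. kn n x) \<longlonglongrightarrow> k x" and kn_bd: "norm (kn n x) \<le> B" for n x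
    unfolding kn_def mollify_eq_heat[OF k zero_less_divide_1_iff[THEN iffD2, OF of_nat_0_less_iff[THEN iffD2, OF zero_less_Suc]]]
    using heat_approximation_bounded[where k=k and t=x and B=B] B isCont by auto
  have cos: "cos (\<omega> * h / 2) > 0"
    using \<omega> by (intro cos_gt_zero_pi) (auto intro: less_le_trans[of _ 0])
  define I where "I j = integral {t 0..t n} (\<lambda>x. (norm (kn j x))\<^sup>2)" for j
  \<comment> \<open>A mollification need not obey the bound \<open>m\<close> at the nodes. Its own
    maximum over the finitely many nodes is used instead, which converges to the maximum
    \<open>M\<close> for \<open>k\<close>.\<close>
  define mj where "mj j = Max ((\<lambda>i. norm (kn j (t i))) ` {..n})" for j
  define R where "R = ennreal (4 * pi\<^sup>2) * (\<integral>\<^sup>+\<xi>. ennreal (\<xi>\<^sup>2 * (norm (fourier k \<xi>))\<^sup>2) \<partial>lborel)"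
  define M where "M = Max ((\<lambda>i. norm (k (t i))) ` {..n})"
  have contkn: "continuous_on UNIV (kn j)" for j
  proof -
    obtain k' where "\<And>t. (kn j has_vector_derivative k' t) (at t)"
      unfolding kn_def by (rule mollify_deriv[OF k, of "1 / Suc j"]) auto
    then show ?thesis by (meson continuous_at_imp_continuous_on has_vector_derivative_continuous)
  qed
  have "t 0 \<le> t i" if "i \<le> n" for i
    using that
  proof (induction i)
    case (Suc i)
    then show ?case using t[of i] by auto
  qed simp
  then have tle: "t 0 \<le> t n" by simp
  have main: "ennreal (\<omega>\<^sup>2 * I j) \<le> R + ennreal (\<omega>\<^sup>2 * (mj j)\<^sup>2 / cos (\<omega> * h / 2) * (t n - t 0))" for j
  proof -
    obtain k' where k': "\<And>t. (kn j has_vector_derivative k' t) (at t)" "continuous_on UNIV k'"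
      "(\<integral>\<^sup>+t. ennreal ((norm (k' t))\<^sup>2) \<partial>lborel) \<le> R"
      unfolding kn_def R_def by (rule mollify_deriv[OF k, of "1 / Suc j"]) auto
    have "norm (kn j (t i)) \<le> mj j" if "i \<le> n" for i unfolding mj_def using that by (intro Max_ge) auto
    from wirtinger_chain[where h=h and n=n and t=t, OF k'(1,2) \<omega>(1,2) t this]
    have "\<omega>\<^sup>2 * I j \<le> integral {t 0..t n} (\<lambda>t. (norm (k' t))\<^sup>2) + \<omega>\<^sup>2 * (mj j)\<^sup>2 / cos (\<omega> * h / 2) * (t n - t 0)"
      unfolding I_def by auto
    then have "ennreal (\<omega>\<^sup>2 * I j) \<le> ennreal (integral {t 0..t n} (\<lambda>t. (norm (k' t))\<^sup>2) + \<omega>\<^sup>2 * (mj j)\<^sup>2 / cos (\<omega> * h / 2) * (t n - t 0))"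
      by (rule ennreal_leI)
    also have "\<dots> = ennreal (integral {t 0..t n} (\<lambda>t. (norm (k' t))\<^sup>2)) + ennreal (\<omega>\<^sup>2 * (mj j)\<^sup>2 / cos (\<omega> * h / 2) * (t n - t 0))"
      using cos tle k'(2) by (intro ennreal_plus integral_nonneg integrable_continuous_interval continuous_intros) (auto intro: continuous_on_subset)
    also have "ennreal (integral {t 0..t n} (\<lambda>t. (norm (k' t))\<^sup>2)) = (\<integral>\<^sup>+x. ennreal ((norm (k' x))\<^sup>2) * indicator {t 0..t n} x \<partial>lborel)"
      using k'(2) by (intro nn_integral_Icc_eq_integral[symmetric] continuous_intros) (auto intro: continuous_on_subset)
    also have "\<dots> \<le> (\<integral>\<^sup>+x. ennreal ((norm (k' x))\<^sup>2) \<partial>lborel)"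
      by (intro nn_integral_mono) (auto simp: indicator_def)
    also have "\<dots> \<le> R" by (rule k')
    finally show ?thesis by (auto simp: add_right_mono)
  qed
  have "(\<lambda>j. LINT x:{t 0..t n}|lborel. (norm (kn j x))\<^sup>2) \<longlonglongrightarrow> (LINT x:{t 0..t n}|lborel. (norm (k x))\<^sup>2)"
    unfolding set_lebesgue_integral_def
  proof (rule integral_dominated_convergence[where w="\<lambda>x. indicator {t 0..t n} x *\<^sub>R B\<^sup>2"])
    show "AE x in lborel. norm (indicator {t 0..t n} x *\<^sub>R (norm (kn j x))\<^sup>2) \<le> indicator {t 0..t n} x *\<^sub>R B\<^sup>2" for j
      by (rule AE_I2) (auto simp: indicator_def power_mono kn_bd)
    show "(\<lambda>x. indicator {t 0..t n} x *\<^sub>R (norm (kn j x))\<^sup>2) \<in> borel_measurable lborel" for j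
      using borel_measurable_continuous_onI[OF contkn[of j]] by measurable
  qed (auto intro!: AE_I2 tendsto_intros kn_lim integrable_real_indicator simp: emeasure_lborel_Icc_eq)
  moreover have "(LINT x:{t 0..t n}|lborel. (norm (f x))\<^sup>2) = integral {t 0..t n} (\<lambda>x. (norm (f x))\<^sup>2)" if "continuous_on UNIV f" for f :: "real \<Rightarrow> complex"
    using that by (intro set_borel_integral_eq_integral(2) borel_integrable_atLeastAtMost' continuous_intros) (auto intro: continuous_on_subset)
  ultimately have Ilim: "I \<longlonglongrightarrow> integral {t 0..t n} (\<lambda>x. (norm (k x))\<^sup>2)"
    unfolding I_def[abs_def] using contkn cont by simp
  have mlim: "mj \<longlonglongrightarrow> M"
    unfolding mj_def[abs_def] M_def
  proof -
    have "(\<lambda>j. Max ((\<lambda>i. norm (kn j (t i))) ` A)) \<longlonglongrightarrow> Max ((\<lambda>i. norm (k (t i))) ` A)" if "finite A" "A \<noteq> {}" for A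
      using that
    proof (induction A rule: finite_ne_induct)
      case (singleton x) then show ?case by (auto intro!: tendsto_intros kn_lim)
    next
      case (insert x F)
      then show ?case by (simp add: Max_insert) (intro tendsto_max tendsto_norm kn_lim)
    qed
    then show "(\<lambda>j. Max ((\<lambda>i. norm (kn j (t i))) ` {..n})) \<longlonglongrightarrow> Max ((\<lambda>i. norm (k (t i))) ` {..n})" by auto
  qed
  have "ennreal (\<omega>\<^sup>2 * integral {t 0..t n} (\<lambda>x. (norm (k x))\<^sup>2)) \<le> R + ennreal (\<omega>\<^sup>2 * M\<^sup>2 / cos (\<omega> * h / 2) * (t n - t 0))"
  proof (rule LIMSEQ_le)
    show "(\<lambda>j. ennreal (\<omega>\<^sup>2 * I j)) \<longlonglongrightarrow> ennreal (\<omega>\<^sup>2 * integral {t 0..t n} (\<lambda>x. (norm (k x))\<^sup>2))"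
      by (intro tendsto_ennrealI tendsto_intros Ilim)
    show "(\<lambda>j. R + ennreal (\<omega>\<^sup>2 * (mj j)\<^sup>2 / cos (\<omega> * h / 2) * (t n - t 0))) \<longlonglongrightarrow> R + ennreal (\<omega>\<^sup>2 * M\<^sup>2 / cos (\<omega> * h / 2) * (t n - t 0))"
      using cos by (intro tendsto_add tendsto_ennrealI tendsto_intros mlim) auto
  qed (use main in auto)
  also have "\<dots> \<le> R + ennreal (\<omega>\<^sup>2 * m\<^sup>2 / cos (\<omega> * h / 2) * (t n - t 0))"
  proof -
    have "M \<le> m" "0 \<le> M" unfolding M_def using m by (auto simp: Max_ge_iff)
    then have "M\<^sup>2 \<le> m\<^sup>2" by (intro power_mono)
    then show ?thesis using cos tle by (intro add_left_mono ennreal_leI mult_right_mono divide_right_mono mult_left_mono) auto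
  qed
  also have "ennreal (\<omega>\<^sup>2 * integral {t 0..t n} (\<lambda>x. (norm (k x))\<^sup>2)) = ennreal (\<omega>\<^sup>2) * (\<integral>\<^sup>+x. ennreal ((norm (k x))\<^sup>2) * indicator {t 0..t n} x \<partial>lborel)"
    using cont by (subst nn_integral_Icc_eq_integral)
      (auto intro!: continuous_intros ennreal_mult integral_nonneg integrable_continuous_interval intro: continuous_on_subset)
  finally show ?thesis unfolding R_def .
qed

text \<open>The critical gap at \<open>x\<close> is \<open>1 / (2 * \<bar>x\<bar>)\<close>: below it, Wirtinger's inequality controls
  functions with frequencies up to \<open>\<bar>x\<bar>\<close>.\<close>
definition sampling :: "real set \<Rightarrow> real \<Rightarrow> real \<Rightarrow> real \<Rightarrow> bool" where
  "sampling S \<gamma> \<eta> X \<longleftrightarrow> (\<forall>x. \<bar>x\<bar> \<ge> X \<longrightarrow> (\<exists>(t :: nat \<Rightarrow> real) n.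
     t 0 \<le> x - \<eta> * \<bar>x\<bar> \<and> x + \<eta> * \<bar>x\<bar> \<le> t n \<and>
     (\<forall>i\<le>n. t i \<in> S \<and> \<bar>x\<bar> / 2 \<le> \<bar>t i\<bar> \<and> \<bar>t i\<bar> \<le> 2 * \<bar>x\<bar>) \<and>
     (\<forall>i<n. t i \<le> t (Suc i) \<and> t (Suc i) - t i \<le> \<gamma> / (2 * \<bar>x\<bar>))))"

text \<open>The only place where the density of the nodes meets the analysis; it serves both the
  short-time transform and the improvement of the decay rate. The left-hand side is confined to the
  vicinity of \<open>x\<close>, because only there the gaps are known to be below
  \<open>\<gamma> / (2 * \<bar>x\<bar>)\<close>.\<close>

lemma sampling_inequality:
  assumes "0 < \<gamma>" "\<gamma> < 1" "X > 0" and samp: "sampling S \<gamma> \<eta> X"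
    and k: "integrable lborel k" and cont: "continuous_on UNIV k" and B: "\<And>x. norm (k x) \<le> B"
    and x: "\<bar>x\<bar> \<ge> X"
    and m: "\<And>t. t \<in> S \<Longrightarrow> \<bar>x\<bar> / 2 \<le> \<bar>t\<bar> \<Longrightarrow> \<bar>t\<bar> \<le> 2 * \<bar>x\<bar> \<Longrightarrow> norm (k t) \<le> m"
  shows "ennreal (x\<^sup>2) * (\<integral>\<^sup>+t. ennreal ((norm (k t))\<^sup>2) * indicator {x - \<eta> * \<bar>x\<bar>..x + \<eta> * \<bar>x\<bar>} t \<partial>lborel)
     \<le> ennreal \<gamma> * (\<integral>\<^sup>+\<xi>. ennreal (\<xi>\<^sup>2 * (norm (fourier k \<xi>))\<^sup>2) \<partial>lborel)
       + ennreal (4 / cos (pi * sqrt \<gamma> / 2) * \<bar>x\<bar> ^ 3 * m\<^sup>2)"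
proof -
  have x0: "\<bar>x\<bar> > 0" "x \<noteq> 0" using x assms by auto
  obtain t n where t: "t 0 \<le> x - \<eta> * \<bar>x\<bar>" "x + \<eta> * \<bar>x\<bar> \<le> t n"
     and tS: "\<And>i. i \<le> n \<Longrightarrow> t i \<in> S \<and> \<bar>x\<bar> / 2 \<le> \<bar>t i\<bar> \<and> \<bar>t i\<bar> \<le> 2 * \<bar>x\<bar>"
     and tg: "\<And>i. i < n \<Longrightarrow> t i \<le> t (Suc i) \<and> t (Suc i) - t i \<le> \<gamma> / (2 * \<bar>x\<bar>)"
    using samp x unfolding sampling_def by blast
  \<comment> \<open>The gap would admit any value below
    \<open>2 * pi * \<bar>x\<bar> / \<gamma>\<close>. The choice keeps a factor
    \<open>sqrt \<gamma>\<close> in reserve: \<open>\<omega> * h = pi * sqrt \<gamma>\<close> stays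
    away from the pole of the tangent, and
    \<open>4 * pi\<^sup>2 / \<omega>\<^sup>2 = \<gamma> / x\<^sup>2\<close> still gains the factor
    \<open>\<gamma>\<close>.\<close>
  define \<omega> where "\<omega> = 2 * pi * \<bar>x\<bar> / sqrt \<gamma>"
  define h where "h = \<gamma> / (2 * \<bar>x\<bar>)"
  have \<omega>h: "\<omega> * h = pi * sqrt \<gamma>" using x0 assms(1) by (simp add: \<omega>_def h_def real_div_sqrt field_simps)
  have lt: "pi * sqrt \<gamma> < pi" using assms(1,2) by simp
  have \<omega>2: "\<omega>\<^sup>2 = 4 * pi\<^sup>2 * x\<^sup>2 / \<gamma>" using assms(1) by (simp add: \<omega>_def power_divide power_mult_distrib)
  have cos: "cos (pi * sqrt \<gamma> / 2) > 0"
    using lt assms(1) by (intro cos_gt_zero_pi) (auto intro: less_le_trans[of _ 0])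
  define J where "J = (\<integral>\<^sup>+t. ennreal ((norm (k t))\<^sup>2) * indicator {x - \<eta> * \<bar>x\<bar>..x + \<eta> * \<bar>x\<bar>} t \<partial>lborel)"
  define Q where "Q = (\<integral>\<^sup>+\<xi>. ennreal (\<xi>\<^sup>2 * (norm (fourier k \<xi>))\<^sup>2) \<partial>lborel)"
  have "ennreal (\<omega>\<^sup>2) * J \<le> ennreal (\<omega>\<^sup>2) * (\<integral>\<^sup>+x. ennreal ((norm (k x))\<^sup>2) * indicator {t 0..t n} x \<partial>lborel)"
    unfolding J_def using t by (intro mult_left_mono nn_integral_mono) (auto simp: indicator_def)
  also have "\<dots> \<le> ennreal (4 * pi\<^sup>2) * Q + ennreal (\<omega>\<^sup>2 * m\<^sup>2 / cos (\<omega> * h / 2) * (t n - t 0))"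
    unfolding Q_def
  proof (rule wirtinger_fourier[OF k cont B])
    show "\<omega> > 0" using x0 assms(1) by (simp add: \<omega>_def)
    show "\<omega> * h < pi" using \<omega>h lt by simp
    show "h \<ge> 0" using assms(1) by (simp add: h_def)
  qed (use tg tS m in \<open>auto simp: h_def\<close>)
  \<comment> \<open>All nodes of the chain lie within \<open>2 * \<bar>x\<bar>\<close> of 0, so its
    length is at most \<open>4 * \<bar>x\<bar>\<close>. Together with the \<open>x\<^sup>2\<close>
    in \<open>\<omega>\<^sup>2\<close> this is the origin of the cube.\<close>
  also have "ennreal (\<omega>\<^sup>2 * m\<^sup>2 / cos (\<omega> * h / 2) * (t n - t 0)) \<le> ennreal (4 * pi\<^sup>2 * x\<^sup>2 / \<gamma> * m\<^sup>2 / cos (pi * sqrt \<gamma> / 2) * (4 * \<bar>x\<bar>))"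
    unfolding \<omega>h \<omega>2 using tS[of 0] tS[of n] cos assms(1)
    by (intro ennreal_leI mult_left_mono) auto
  finally have "ennreal (\<gamma> / (4 * pi\<^sup>2)) * (ennreal (\<omega>\<^sup>2) * J) \<le> ennreal (\<gamma> / (4 * pi\<^sup>2)) * (ennreal (4 * pi\<^sup>2) * Q + ennreal (4 * pi\<^sup>2 * x\<^sup>2 / \<gamma> * m\<^sup>2 / cos (pi * sqrt \<gamma> / 2) * (4 * \<bar>x\<bar>)))"
    by (auto intro: mult_left_mono add_left_mono)
  also have "\<dots> = ennreal (\<gamma> / (4 * pi\<^sup>2) * (4 * pi\<^sup>2)) * Q
      + ennreal (\<gamma> / (4 * pi\<^sup>2) * (4 * pi\<^sup>2 * x\<^sup>2 / \<gamma> * m\<^sup>2 / cos (pi * sqrt \<gamma> / 2) * (4 * \<bar>x\<bar>)))"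
    unfolding distrib_left mult.assoc[symmetric, of "ennreal _" "ennreal _" Q] using assms(1) cos
    by (subst (1 2) ennreal_mult) auto
  also have "\<gamma> / (4 * pi\<^sup>2) * (4 * pi\<^sup>2) = \<gamma>" by simp
  also have "\<gamma> / (4 * pi\<^sup>2) * (4 * pi\<^sup>2 * x\<^sup>2 / \<gamma> * m\<^sup>2 / cos (pi * sqrt \<gamma> / 2) * (4 * \<bar>x\<bar>))
      = 4 / cos (pi * sqrt \<gamma> / 2) * (\<bar>x\<bar>\<^sup>2 * \<bar>x\<bar>) * m\<^sup>2" using assms(1) by simp
  also have "\<bar>x\<bar>\<^sup>2 * \<bar>x\<bar> = \<bar>x\<bar> ^ 3" by (simp add: power3_eq_cube power2_eq_square)
  also have "ennreal (\<gamma> / (4 * pi\<^sup>2)) * (ennreal (\<omega>\<^sup>2) * J) = ennreal (x\<^sup>2) * J"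
    unfolding mult.assoc[symmetric] \<omega>2 using assms(1) by (subst ennreal_mult[symmetric]) auto
  finally show ?thesis unfolding J_def Q_def .
qed

section \<open>Joint Gaussian decay\<close>

text \<open>The width is such that the Gaussian is its own Fourier transform; this makes position
  and frequency interchangeable below.\<close>

definition window :: "(real \<Rightarrow> complex) \<Rightarrow> real \<Rightarrow> real \<Rightarrow> complex" where
  "window k x t = k t * complex_of_real (exp (- pi * (t - x)\<^sup>2))"

definition stft :: "(real \<Rightarrow> complex) \<Rightarrow> real \<Rightarrow> real \<Rightarrow> complex" where
  "stft k x = fourier (window k x)"

lemma norm_window: "norm (window k x t) = norm (k t) * exp (- pi * (t - x)\<^sup>2)"
  by (simp add: window_def norm_mult)

lemma norm_window_le: "norm (window k x t) \<le> norm (k t)"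
  unfolding norm_window by (intro mult_left_le) auto

lemma integrable_window: "integrable lborel k \<Longrightarrow> integrable lborel (window k x)"
  by (rule Bochner_Integration.integrable_bound[of _ k])
     (simp_all add: norm_window_le, simp add: window_def[abs_def])

lemma continuous_window: "continuous_on UNIV k \<Longrightarrow> continuous_on UNIV (window k x)"
  unfolding window_def[abs_def] by (intro continuous_intros)

lemma stft_measurable [measurable]:
  assumes "k \<in> borel_measurable borel"
  shows "(\<lambda>p. stft k (fst p) (snd p)) \<in> borel_measurable (borel \<Otimes>\<^sub>M borel)"
proof -
  note [measurable] = assms
  show ?thesis
    unfolding stft_def fourier_def window_def by measurable
qed

text \<open>For Gaussians the Fourier transform exchanges shift and modulation, up to signs and a
  constant phase.\<close>

lemma fourier_modulated_window:
  "fourier (\<lambda>s. complex_of_real (exp (- pi * (s - \<xi>)\<^sup>2)) * cis (- (2 * pi * \<eta>) * s)) t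
   = cis (- (2 * pi * \<xi>) * (\<eta> + t)) * complex_of_real (exp (- pi * (t + \<eta>)\<^sup>2))"
proof -
  have "fourier (\<lambda>s. complex_of_real (exp (- pi * (s - \<xi>)\<^sup>2)) * cis (- (2 * pi * \<eta>) * s)) t
    = (LINT s|lborel. complex_of_real (exp (- pi * (s - \<xi>)\<^sup>2)) * cis (- (2 * pi * (\<eta> + t)) * s))"
    unfolding fourier_cis
    by (intro Bochner_Integration.integral_cong refl) (simp add: cis_mult mult.assoc, simp add: algebra_simps)
  also have "\<dots> = (LINT s|lborel. complex_of_real (exp (- pi * s\<^sup>2)) * cis (- (2 * pi * (\<eta> + t)) * (\<xi> + s)))"
    by (subst lborel_integral_real_affine[where c=1 and t=\<xi>]) auto
  also have "\<dots> = (LINT s|lborel. cis (- (2 * pi * \<xi>) * (\<eta> + t)) * (complex_of_real (exp (- pi * s\<^sup>2)) * cis ((- (2 * pi * (\<eta> + t))) * s)))"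
  proof (intro Bochner_Integration.integral_cong refl)
    fix s :: real
    have "cis (- (2 * pi * (\<eta> + t)) * (\<xi> + s)) = cis (- (2 * pi * \<xi>) * (\<eta> + t)) * cis ((- (2 * pi * (\<eta> + t))) * s)"
      unfolding cis_mult by (rule arg_cong[where f=cis]) (simp add: algebra_simps)
    then show "complex_of_real (exp (- pi * s\<^sup>2)) * cis (- (2 * pi * (\<eta> + t)) * (\<xi> + s))
      = cis (- (2 * pi * \<xi>) * (\<eta> + t)) * (complex_of_real (exp (- pi * s\<^sup>2)) * cis ((- (2 * pi * (\<eta> + t))) * s))"
      by simp
  qed
  also have "\<dots> = cis (- (2 * pi * \<xi>) * (\<eta> + t)) * complex_of_real (exp (- pi * (t + \<eta>)\<^sup>2))"
  proof -
    have "(- (2 * pi * (\<eta> + t)))\<^sup>2 / (4 * pi) = pi * (t + \<eta>)\<^sup>2" by (simp add: power2_eq_square field_simps)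
    then show ?thesis by (simp only: integral_mult_right_zero gaussian_fourier[OF pi_gt_zero]) simp
  qed
  finally show ?thesis .
qed

text \<open>The Fourier transform acts on the phase plane as a quarter turn. The multiplication
  formula moves it from \<open>F\<close> onto the modulated window at \<open>\<xi>\<close>, which
  becomes a window at \<open>- \<eta>\<close> with modulation \<open>\<xi>\<close>.\<close>

lemma norm_stft_fourier:
  assumes F: "integrable lborel F"
  shows "norm (stft (fourier F) \<xi> \<eta>) = norm (stft F (- \<eta>) \<xi>)"
proof -
  define h where "h s = complex_of_real (exp (- pi * (s - \<xi>)\<^sup>2)) * cis (- (2 * pi * \<eta>) * s)" for s
  have hint: "integrable lborel h"
    unfolding h_def[abs_def] using gaussian_integral(1)[OF pi_gt_zero, of \<xi>]
    by (intro integrable_mult_cis integrable_of_real)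
  have "stft (fourier F) \<xi> \<eta> = (LINT s|lborel. fourier F s * h s)"
    unfolding stft_def fourier_cis[of "window _ _"] window_def h_def by (simp add: mult.assoc)
  also have "\<dots> = (LINT t|lborel. F t * fourier h t)"
    by (rule fourier_multiplication[OF F hint, symmetric])
  also have "\<dots> = (LINT t|lborel. cis (- (2 * pi * \<xi>) * \<eta>) * (window F (- \<eta>) t * cis (- (2 * pi * \<xi>) * t)))"
    unfolding h_def[abs_def] fourier_modulated_window window_def
  proof (intro Bochner_Integration.integral_cong refl)
    fix t :: real
    have "cis (- (2 * pi * \<xi>) * (\<eta> + t)) = cis (- (2 * pi * \<xi>) * \<eta>) * cis (- (2 * pi * \<xi>) * t)"
      unfolding cis_mult by (rule arg_cong[where f=cis]) (simp add: algebra_simps)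
    then show "F t * (cis (- (2 * pi * \<xi>) * (\<eta> + t)) * complex_of_real (exp (- pi * (t + \<eta>)\<^sup>2))) =
      cis (- (2 * pi * \<xi>) * \<eta>) * (F t * complex_of_real (exp (- pi * (t - - \<eta>)\<^sup>2)) * cis (- (2 * pi * \<xi>) * t))"
      by simp
  qed
  also have "\<dots> = cis (- (2 * pi * \<xi>) * \<eta>) * stft F (- \<eta>) \<xi>"
    unfolding stft_def fourier_cis by simp
  finally show ?thesis by (simp add: norm_mult)
qed

lemma nn_integral_stft:
  assumes "integrable lborel k" "continuous_on UNIV k" "\<And>x. norm (k x) \<le> B"
  shows "(\<integral>\<^sup>+\<xi>. ennreal ((norm (stft k x \<xi>))\<^sup>2) \<partial>lborel)
       = (\<integral>\<^sup>+t. ennreal ((norm (k t))\<^sup>2 * exp (- (2 * pi) * (t - x)\<^sup>2)) \<partial>lborel)"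
proof -
  have "(\<integral>\<^sup>+\<xi>. ennreal ((norm (stft k x \<xi>))\<^sup>2) \<partial>lborel) = (\<integral>\<^sup>+t. ennreal ((norm (window k x t))\<^sup>2) \<partial>lborel)"
    unfolding stft_def
    by (rule plancherel[OF integrable_window[OF assms(1)] continuous_window[OF assms(2)] order_trans[OF norm_window_le assms(3)]])
  also have "\<dots> = (\<integral>\<^sup>+t. ennreal ((norm (k t))\<^sup>2 * exp (- (2 * pi) * (t - x)\<^sup>2)) \<partial>lborel)"
    by (intro nn_integral_cong) (simp add: norm_window power_mult_distrib exp_double[symmetric] mult.assoc)
  finally show ?thesis .
qed

lemma poly_gaussian_bound:
  fixes c :: real
  assumes "c > 0"
  shows "(1 + \<bar>x\<bar>) ^ p * exp (- c * x\<^sup>2) \<le> exp ((real p)\<^sup>2 / (2 * c)) * exp (- (c / 2) * x\<^sup>2)"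
  using exp_gaussian_domination[OF assms, of x p 0] by simp

text \<open>The sampling inequality for the windowed function. It covers only
  \<open>\<bar>t - x\<bar> \<le> \<eta> * \<bar>x\<bar>\<close>; farther out the window is Gaussian
  small in \<open>x\<close>. The node values are small as well, since the nodes satisfy
  \<open>\<bar>t\<bar> \<ge> \<bar>x\<bar> / 2\<close>. For \<open>\<bar>x\<bar> < X\<close> the
  total mass \<open>K\<close> is absorbed into the constant.\<close>

lemma stft_localised_sampling:
  assumes \<gamma>: "0 < \<gamma>" "\<gamma> < 1" and \<eta>: "\<eta> > 0" and X: "X > 0" and samp: "sampling S \<gamma> \<eta> X"
    and k: "integrable lborel k" and cont: "continuous_on UNIV k" and B: "\<And>x. norm (k x) \<le> B"
    and S: "\<And>t. t \<in> S \<Longrightarrow> norm (k t) \<le> D * (1 + \<bar>t\<bar>) ^ N * exp (- pi * t\<^sup>2)"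
  obtains E \<delta> where "\<delta> > 0" "E \<ge> 0"
    "\<And>x. ennreal (x\<^sup>2) * (\<integral>\<^sup>+\<xi>. ennreal ((norm (stft k x \<xi>))\<^sup>2) \<partial>lborel)
       \<le> ennreal \<gamma> * (\<integral>\<^sup>+\<xi>. ennreal (\<xi>\<^sup>2 * (norm (stft k x \<xi>))\<^sup>2) \<partial>lborel) + ennreal (E * exp (- \<delta> * x\<^sup>2))"
proof -
  have [measurable]: "k \<in> borel_measurable borel" using k by auto
  have B0: "B \<ge> 0" using B[of 0] norm_ge_zero order_trans by blast
  have intk2: "integrable lborel (\<lambda>t. (norm (k t))\<^sup>2)"
    by (rule Bochner_Integration.integrable_bound[where f="\<lambda>x. B * norm (k x)"])
       (use k B B0 in \<open>auto simp: power2_eq_square intro!: mult_right_mono AE_I2\<close>)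
  define K where "K = (LINT t|lborel. (norm (k t))\<^sup>2)"
  have K0: "K \<ge> 0" unfolding K_def by (intro integral_nonneg_AE) auto
  have nnK: "(\<integral>\<^sup>+t. ennreal ((norm (k t))\<^sup>2) \<partial>lborel) = ennreal K"
    unfolding K_def by (rule nn_integral_eq_integral[OF intk2]) auto
  define C where "C = 4 / cos (pi * sqrt \<gamma> / 2)"
  have C0: "C > 0"
  proof -
    have "pi * sqrt \<gamma> < pi" using \<gamma> by simp
    moreover have "pi * sqrt \<gamma> \<ge> 0" using \<gamma> by simp
    ultimately show ?thesis unfolding C_def using pi_gt_zero by (intro divide_pos_pos cos_gt_zero_pi) linarith+
  qed
  define m where "m x = \<bar>D\<bar> * (1 + 2 * \<bar>x\<bar>) ^ N * exp (- pi * (x / 2)\<^sup>2)" for x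
  \<comment> \<open>Half of each available rate: \<open>2 * pi * \<eta>\<^sup>2\<close> from the
    squared window at distance \<open>\<eta> * \<bar>x\<bar>\<close>, and \<open>pi / 2\<close> from
    the squared node values at distance \<open>\<bar>x\<bar> / 2\<close> from 0. The other halves
    absorb the powers of \<open>x\<close>.\<close>
  define \<delta> where "\<delta> = min (pi * \<eta>\<^sup>2) (pi / 4)"
  have \<delta>: "\<delta> > 0" using \<eta> by (simp add: \<delta>_def)
  define E1 where "E1 = K * exp (2\<^sup>2 / (2 * (2 * pi * \<eta>\<^sup>2)))"
  define E2 where "E2 = C * D\<^sup>2 * 4 ^ N * exp ((real (2 * N + 3))\<^sup>2 / (2 * (pi / 2)))"
  define E3 where "E3 = X\<^sup>2 * K * exp (\<delta> * X\<^sup>2)"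
  have E0: "E1 \<ge> 0" "E2 \<ge> 0" "E3 \<ge> 0" using K0 C0 by (auto simp: E1_def E2_def E3_def)
  have main: "ennreal (x\<^sup>2) * (\<integral>\<^sup>+\<xi>. ennreal ((norm (stft k x \<xi>))\<^sup>2) \<partial>lborel)
       \<le> ennreal \<gamma> * (\<integral>\<^sup>+\<xi>. ennreal (\<xi>\<^sup>2 * (norm (stft k x \<xi>))\<^sup>2) \<partial>lborel) + ennreal ((E1 + E2 + E3) * exp (- \<delta> * x\<^sup>2))" for x
  proof (cases "\<bar>x\<bar> \<ge> X")
    case False
    have "x\<^sup>2 \<le> X\<^sup>2" using False X by (intro abs_le_square_iff[THEN iffD1]) auto
    have "ennreal (x\<^sup>2) * (\<integral>\<^sup>+\<xi>. ennreal ((norm (stft k x \<xi>))\<^sup>2) \<partial>lborel) \<le> ennreal (X\<^sup>2) * ennreal K"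
      unfolding nn_integral_stft[OF k cont B] nnK[symmetric] using \<open>x\<^sup>2 \<le> X\<^sup>2\<close>
      by (intro mult_mono ennreal_leI nn_integral_mono mult_left_le) auto
    also have "\<dots> = ennreal (X\<^sup>2 * K)" using K0 by (simp add: ennreal_mult)
    also have "X\<^sup>2 * K \<le> X\<^sup>2 * K * (exp (\<delta> * X\<^sup>2) * exp (- \<delta> * x\<^sup>2))"
    proof -
      have "1 \<le> exp (\<delta> * X\<^sup>2) * exp (- \<delta> * x\<^sup>2)"
        using \<open>x\<^sup>2 \<le> X\<^sup>2\<close> \<delta> by (simp add: exp_add[symmetric] mult_left_mono)
      then show ?thesis using K0 mult_left_mono[of 1 _ "X\<^sup>2 * K"] by simp
    qed
    also have "\<dots> \<le> (E1 + E2 + E3) * exp (- \<delta> * x\<^sup>2)"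
      unfolding E3_def[symmetric] mult.assoc[symmetric] using E0 by (intro mult_right_mono) auto
    finally show ?thesis by (simp add: ennreal_leI add_increasing)
  next
    case True
    let ?I = "{x - \<eta> * \<bar>x\<bar>..x + \<eta> * \<bar>x\<bar>}"
    have mm: "norm (window k x t) \<le> m x" if "t \<in> S" "\<bar>x\<bar> / 2 \<le> \<bar>t\<bar>" "\<bar>t\<bar> \<le> 2 * \<bar>x\<bar>" for t
    proof -
      define A where "A = (1 + \<bar>t\<bar>) ^ N * exp (- pi * t\<^sup>2)"
      have A: "A > 0" unfolding A_def by (intro mult_pos_pos zero_less_power) auto
      have "0 \<le> D * A / A"
        using order_trans[OF norm_ge_zero S[OF that(1)]] A by (intro divide_nonneg_pos) (simp_all add: A_def mult.assoc)
      then have D0: "D \<ge> 0" using A by simp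
      have "(x / 2)\<^sup>2 \<le> t\<^sup>2" using that(2) by (intro abs_le_square_iff[THEN iffD1]) auto
      then have "D * (1 + \<bar>t\<bar>) ^ N * exp (- pi * t\<^sup>2) \<le> m x"
        unfolding m_def using that(3) D0 by (intro mult_mono power_mono) auto
      then show ?thesis using norm_window_le[of k x t] S[OF that(1)] by linarith
    qed
    have near: "ennreal (x\<^sup>2) * (\<integral>\<^sup>+t. ennreal ((norm (window k x t))\<^sup>2) * indicator ?I t \<partial>lborel)
     \<le> ennreal \<gamma> * (\<integral>\<^sup>+\<xi>. ennreal (\<xi>\<^sup>2 * (norm (stft k x \<xi>))\<^sup>2) \<partial>lborel) + ennreal (C * \<bar>x\<bar> ^ 3 * (m x)\<^sup>2)"
      unfolding stft_def C_def
      by (rule sampling_inequality[OF \<gamma> X samp integrable_window[OF k] continuous_window[OF cont] order_trans[OF norm_window_le B] True mm])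
    have far: "(\<integral>\<^sup>+t. ennreal ((norm (window k x t))\<^sup>2) * indicator (- ?I) t \<partial>lborel) \<le> ennreal (exp (- (2 * pi * \<eta>\<^sup>2) * x\<^sup>2) * K)"
    proof -
      have "(\<integral>\<^sup>+t. ennreal ((norm (window k x t))\<^sup>2) * indicator (- ?I) t \<partial>lborel)
         \<le> (\<integral>\<^sup>+t. ennreal (exp (- (2 * pi * \<eta>\<^sup>2) * x\<^sup>2)) * ennreal ((norm (k t))\<^sup>2) \<partial>lborel)"
      proof (rule nn_integral_mono)
        fix t :: real
        show "ennreal ((norm (window k x t))\<^sup>2) * indicator (- ?I) t \<le> ennreal (exp (- (2 * pi * \<eta>\<^sup>2) * x\<^sup>2)) * ennreal ((norm (k t))\<^sup>2)"
        proof (cases "t \<in> ?I")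
          case False
          then have "\<eta> * \<bar>x\<bar> \<le> \<bar>t - x\<bar>" by auto
          then have "(\<eta> * \<bar>x\<bar>)\<^sup>2 \<le> (t - x)\<^sup>2" using \<eta> by (intro abs_le_square_iff[THEN iffD1]) (auto simp: abs_mult)
          then have "(2 * pi) * (\<eta> * \<bar>x\<bar>)\<^sup>2 \<le> (2 * pi) * (t - x)\<^sup>2" by (intro mult_left_mono) auto
          then have "exp (- pi * (t - x)\<^sup>2) ^ 2 \<le> exp (- (2 * pi * \<eta>\<^sup>2) * x\<^sup>2)"
            by (simp add: exp_double[symmetric] power_mult_distrib mult.assoc)
          then have "(norm (window k x t))\<^sup>2 \<le> exp (- (2 * pi * \<eta>\<^sup>2) * x\<^sup>2) * (norm (k t))\<^sup>2"
            unfolding norm_window power_mult_distrib by (subst mult.commute) (intro mult_right_mono, auto)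
          then show ?thesis using False by (simp add: ennreal_mult[symmetric] ennreal_leI)
        qed simp
      qed
      also have "\<dots> = ennreal (exp (- (2 * pi * \<eta>\<^sup>2) * x\<^sup>2)) * ennreal K"
        unfolding nnK[symmetric] by (rule nn_integral_cmult) simp
      finally show ?thesis using K0 by (simp add: ennreal_mult)
    qed
    have "(\<integral>\<^sup>+\<xi>. ennreal ((norm (stft k x \<xi>))\<^sup>2) \<partial>lborel) = (\<integral>\<^sup>+t. ennreal ((norm (window k x t))\<^sup>2) \<partial>lborel)"
      unfolding stft_def
      by (rule plancherel[OF integrable_window[OF k] continuous_window[OF cont] order_trans[OF norm_window_le B]])
    also have "\<dots> = (\<integral>\<^sup>+t. ennreal ((norm (window k x t))\<^sup>2) * indicator ?I t + ennreal ((norm (window k x t))\<^sup>2) * indicator (- ?I) t \<partial>lborel)"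
      by (intro nn_integral_cong) (auto simp: indicator_def)
    also have "\<dots> = (\<integral>\<^sup>+t. ennreal ((norm (window k x t))\<^sup>2) * indicator ?I t \<partial>lborel) + (\<integral>\<^sup>+t. ennreal ((norm (window k x t))\<^sup>2) * indicator (- ?I) t \<partial>lborel)"
      unfolding window_def[abs_def] by (intro nn_integral_add) auto
    finally have "ennreal (x\<^sup>2) * (\<integral>\<^sup>+\<xi>. ennreal ((norm (stft k x \<xi>))\<^sup>2) \<partial>lborel)
      = ennreal (x\<^sup>2) * (\<integral>\<^sup>+t. ennreal ((norm (window k x t))\<^sup>2) * indicator ?I t \<partial>lborel)
       + ennreal (x\<^sup>2) * (\<integral>\<^sup>+t. ennreal ((norm (window k x t))\<^sup>2) * indicator (- ?I) t \<partial>lborel)"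
      by (simp add: distrib_left)
    also have "\<dots> \<le> (ennreal \<gamma> * (\<integral>\<^sup>+\<xi>. ennreal (\<xi>\<^sup>2 * (norm (stft k x \<xi>))\<^sup>2) \<partial>lborel) + ennreal (C * \<bar>x\<bar> ^ 3 * (m x)\<^sup>2))
       + ennreal (x\<^sup>2) * ennreal (exp (- (2 * pi * \<eta>\<^sup>2) * x\<^sup>2) * K)"
      by (intro add_mono near mult_left_mono far) auto
    also have "\<dots> = ennreal \<gamma> * (\<integral>\<^sup>+\<xi>. ennreal (\<xi>\<^sup>2 * (norm (stft k x \<xi>))\<^sup>2) \<partial>lborel)
      + ennreal (C * \<bar>x\<bar> ^ 3 * (m x)\<^sup>2 + x\<^sup>2 * (exp (- (2 * pi * \<eta>\<^sup>2) * x\<^sup>2) * K))"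
      using C0 K0 by (simp add: ennreal_mult add.assoc)
    also have "\<dots> \<le> ennreal \<gamma> * (\<integral>\<^sup>+\<xi>. ennreal (\<xi>\<^sup>2 * (norm (stft k x \<xi>))\<^sup>2) \<partial>lborel) + ennreal ((E1 + E2 + E3) * exp (- \<delta> * x\<^sup>2))"
    proof (intro add_left_mono ennreal_leI)
      have 1: "x\<^sup>2 * (exp (- (2 * pi * \<eta>\<^sup>2) * x\<^sup>2) * K) \<le> E1 * exp (- \<delta> * x\<^sup>2)"
      proof -
        have "x\<^sup>2 * exp (- (2 * pi * \<eta>\<^sup>2) * x\<^sup>2) \<le> (1 + \<bar>x\<bar>)\<^sup>2 * exp (- (2 * pi * \<eta>\<^sup>2) * x\<^sup>2)"
          by (intro mult_right_mono abs_le_square_iff[THEN iffD1]) auto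
        also have "\<dots> \<le> exp ((real 2)\<^sup>2 / (2 * (2 * pi * \<eta>\<^sup>2))) * exp (- ((2 * pi * \<eta>\<^sup>2) / 2) * x\<^sup>2)"
          using \<eta> by (intro poly_gaussian_bound) auto
        also have "\<dots> \<le> exp ((real 2)\<^sup>2 / (2 * (2 * pi * \<eta>\<^sup>2))) * exp (- \<delta> * x\<^sup>2)"
          by (intro mult_left_mono exp_mono mult_right_mono) (auto simp: \<delta>_def)
        finally have "x\<^sup>2 * exp (- (2 * pi * \<eta>\<^sup>2) * x\<^sup>2) * K \<le> exp (2\<^sup>2 / (2 * (2 * pi * \<eta>\<^sup>2))) * exp (- \<delta> * x\<^sup>2) * K"
          using K0 by (intro mult_right_mono) auto
        then show ?thesis by (simp add: E1_def mult_ac)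
      qed
      have 2: "C * \<bar>x\<bar> ^ 3 * (m x)\<^sup>2 \<le> E2 * exp (- \<delta> * x\<^sup>2)"
      proof -
        have "(m x)\<^sup>2 = D\<^sup>2 * ((1 + 2 * \<bar>x\<bar>)\<^sup>2) ^ N * exp (- (pi / 2) * x\<^sup>2)"
          by (simp add: m_def power_mult_distrib exp_double[symmetric] power_divide power_mult[symmetric] mult.commute)
        also have "\<dots> \<le> D\<^sup>2 * ((2 * (1 + \<bar>x\<bar>))\<^sup>2) ^ N * exp (- (pi / 2) * x\<^sup>2)"
          by (intro mult_right_mono mult_left_mono power_mono) auto
        also have "\<dots> = D\<^sup>2 * 4 ^ N * (1 + \<bar>x\<bar>) ^ (2 * N) * exp (- (pi / 2) * x\<^sup>2)"
          unfolding power_mult_distrib by (simp add: power_mult)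
        finally have "\<bar>x\<bar> ^ 3 * (m x)\<^sup>2 \<le> (1 + \<bar>x\<bar>) ^ 3 * (D\<^sup>2 * 4 ^ N * (1 + \<bar>x\<bar>) ^ (2 * N) * exp (- (pi / 2) * x\<^sup>2))"
          by (intro mult_mono power_mono) auto
        also have "\<dots> = D\<^sup>2 * 4 ^ N * ((1 + \<bar>x\<bar>) ^ (2 * N + 3) * exp (- (pi / 2) * x\<^sup>2))"
          by (simp only: power_add mult_ac)
        also have "\<dots> \<le> D\<^sup>2 * 4 ^ N * (exp ((real (2 * N + 3))\<^sup>2 / (2 * (pi / 2))) * exp (- ((pi / 2) / 2) * x\<^sup>2))"
          by (intro mult_left_mono poly_gaussian_bound) auto
        also have "\<dots> \<le> D\<^sup>2 * 4 ^ N * (exp ((real (2 * N + 3))\<^sup>2 / (2 * (pi / 2))) * exp (- \<delta> * x\<^sup>2))"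
          by (intro mult_left_mono exp_mono mult_right_mono) (auto simp: \<delta>_def)
        finally have "C * (\<bar>x\<bar> ^ 3 * (m x)\<^sup>2) \<le> C * (D\<^sup>2 * 4 ^ N * (exp ((real (2 * N + 3))\<^sup>2 / (2 * (pi / 2))) * exp (- \<delta> * x\<^sup>2)))"
          using C0 by (intro mult_left_mono) auto
        then show ?thesis by (simp only: E2_def mult.assoc)
      qed
      have "E3 * exp (- \<delta> * x\<^sup>2) \<ge> 0" using E0 by simp
      then show "C * \<bar>x\<bar> ^ 3 * (m x)\<^sup>2 + x\<^sup>2 * (exp (- (2 * pi * \<eta>\<^sup>2) * x\<^sup>2) * K) \<le> (E1 + E2 + E3) * exp (- \<delta> * x\<^sup>2)"
        using 1 2 by (simp add: distrib_right)
    qed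
    finally show ?thesis .
  qed
  show ?thesis using that[OF \<delta> _ main] E0 by simp
qed


section \<open>Rearrangement in the phase plane\<close>

lemma one_plus_squares_nonneg: "0 \<le> 1 + x\<^sup>2 + (y :: real)\<^sup>2"
  by simp

lemma ennreal_add_mult:
  assumes "a \<ge> 0" "b \<ge> 0" "c \<ge> 0"
  shows "ennreal (a + b * c) = ennreal a + ennreal b * ennreal c"
  using assms by (simp add: ennreal_mult)

text \<open>The weight \<open>u n x = exp (c * min (x\<^sup>2) n)\<close> is nondecreasing in \<open>\<bar>x\<bar>\<close>, so
  \<open>(u n x - u n \<xi>) * (x\<^sup>2 - \<xi>\<^sup>2) \<ge> 0\<close>; the two hypotheses, integrated against it, therefore feed
  into each other with a total gain of the factor \<open>\<gamma>\<close>. Truncation at \<open>n\<close> makes all integrals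
  finite a priori.\<close>
lemma rearrangement_bound:
  fixes W :: "real \<Rightarrow> real \<Rightarrow> ennreal"
  assumes [measurable]: "(\<lambda>p. W (fst p) (snd p)) \<in> borel_measurable (borel \<Otimes>\<^sub>M borel)"
    and \<gamma>: "0 < \<gamma>" "\<gamma> < 1" and c: "0 < c" "c < \<delta>" and E: "E \<ge> 0"
    and 1: "\<And>x. ennreal (x\<^sup>2) * (\<integral>\<^sup>+\<xi>. W x \<xi> \<partial>lborel) \<le> ennreal \<gamma> * (\<integral>\<^sup>+\<xi>. ennreal (\<xi>\<^sup>2) * W x \<xi> \<partial>lborel) + ennreal (E * exp (- \<delta> * x\<^sup>2))"
    and 2: "\<And>\<xi>. ennreal (\<xi>\<^sup>2) * (\<integral>\<^sup>+x. W x \<xi> \<partial>lborel) \<le> ennreal \<gamma> * (\<integral>\<^sup>+x. ennreal (x\<^sup>2) * W x \<xi> \<partial>lborel) + ennreal (E * exp (- \<delta> * \<xi>\<^sup>2))"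
    and fin: "(\<integral>\<^sup>+p. ennreal (1 + (fst p)\<^sup>2 + (snd p)\<^sup>2) * W (fst p) (snd p) \<partial>(lborel \<Otimes>\<^sub>M lborel)) < \<infinity>"
  shows "(\<integral>\<^sup>+p. ennreal (exp (c / 2 * ((fst p)\<^sup>2 + (snd p)\<^sup>2))) * W (fst p) (snd p) \<partial>(lborel \<Otimes>\<^sub>M lborel)) < \<infinity>"
proof -
  let ?P = "lborel \<Otimes>\<^sub>M lborel :: (real \<times> real) measure"
  have [measurable]: "(\<lambda>p. W (fst p) (snd p)) \<in> borel_measurable ?P" using assms(1) by simp
  have [measurable]: "(\<lambda>p. W (snd p) (fst p)) \<in> borel_measurable (borel \<Otimes>\<^sub>M borel)"
    using measurable_compose[OF _ assms(1), of "\<lambda>p. (snd p, fst p)" "borel \<Otimes>\<^sub>M borel"] by simp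
  have [measurable]: "(\<lambda>y. W x y) \<in> borel_measurable borel" "(\<lambda>y. W y x) \<in> borel_measurable borel" for x
    using measurable_compose[OF _ assms(1), of "\<lambda>y. (x, y)" borel] measurable_compose[OF _ assms(1), of "\<lambda>y. (y, x)" borel]
    by simp_all
  define u :: "nat \<Rightarrow> real \<Rightarrow> real" where "u n x = exp (c * min (x\<^sup>2) (real n))" for n x
  have [measurable]: "u n \<in> borel_measurable borel" for n unfolding u_def by measurable
  have upos: "u n x > 0" for n x by (simp add: u_def)
  define f where "f n p = ennreal (u n (fst p) * (fst p)\<^sup>2 + u n (snd p) * (snd p)\<^sup>2) * W (fst p) (snd p)" for n p
  have [measurable]: "f n \<in> borel_measurable ?P" for n unfolding f_def by measurable
  define I where "I = (LINT x|lborel. exp (- (\<delta> - c) * x\<^sup>2))"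
  have Inn: "(\<integral>\<^sup>+x. ennreal (exp (- (\<delta> - c) * x\<^sup>2)) \<partial>lborel) = ennreal I"
    unfolding I_def using c by (intro nn_integral_eq_integral gaussian_integral_0(1)) auto
  have I0: "I \<ge> 0" unfolding I_def by (intro integral_nonneg_AE) auto
  \<comment> \<open>The weight costs at most \<open>exp (c * x\<^sup>2)\<close>; because of
    \<open>c < \<delta>\<close> the weighted error stays integrable, uniformly in
    \<open>n\<close>.\<close>
  have ue: "u n x * (E * exp (- \<delta> * x\<^sup>2)) \<le> E * exp (- (\<delta> - c) * x\<^sup>2)" for n x
  proof -
    have "u n x \<le> exp (c * x\<^sup>2)" unfolding u_def using c by simp
    then have "u n x * (E * exp (- \<delta> * x\<^sup>2)) \<le> exp (c * x\<^sup>2) * (E * exp (- \<delta> * x\<^sup>2))"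
      using E by (intro mult_right_mono) auto
    also have "\<dots> = E * exp (- (\<delta> - c) * x\<^sup>2)" by (simp add: exp_add[symmetric] algebra_simps)
    finally show ?thesis .
  qed
  have wI: "(\<integral>\<^sup>+x. ennreal (u n x) * ennreal (E * exp (- \<delta> * x\<^sup>2)) \<partial>lborel) \<le> ennreal (E * I)" for n
  proof -
    have "(\<integral>\<^sup>+x. ennreal (u n x) * ennreal (E * exp (- \<delta> * x\<^sup>2)) \<partial>lborel) \<le> (\<integral>\<^sup>+x. ennreal E * ennreal (exp (- (\<delta> - c) * x\<^sup>2)) \<partial>lborel)"
      using E ue[of n] upos[of n] by (intro nn_integral_mono) (simp add: ennreal_mult[symmetric] less_imp_le ennreal_leI)
    also have "\<dots> = ennreal E * ennreal I" unfolding Inn[symmetric] by (rule nn_integral_cmult) simp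
    finally show ?thesis using E I0 by (simp add: ennreal_mult)
  qed
  have bound: "integral\<^sup>N ?P (f n) \<le> ennreal (2 * E * I / (1 - \<gamma>))" for n
  proof -
    have A1: "(\<integral>\<^sup>+p. ennreal (u n (fst p) * (fst p)\<^sup>2) * W (fst p) (snd p) \<partial>?P)
       \<le> ennreal \<gamma> * (\<integral>\<^sup>+p. ennreal (u n (fst p) * (snd p)\<^sup>2) * W (fst p) (snd p) \<partial>?P) + ennreal (E * I)"
    proof -
      have "(\<integral>\<^sup>+p. ennreal (u n (fst p) * (fst p)\<^sup>2) * W (fst p) (snd p) \<partial>?P)
         = (\<integral>\<^sup>+x. (\<integral>\<^sup>+\<xi>. ennreal (u n x * x\<^sup>2) * W x \<xi> \<partial>lborel) \<partial>lborel)"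
        by (subst lborel.nn_integral_fst[symmetric]) auto
      also have "\<dots> = (\<integral>\<^sup>+x. ennreal (u n x) * (ennreal (x\<^sup>2) * (\<integral>\<^sup>+\<xi>. W x \<xi> \<partial>lborel)) \<partial>lborel)"
        using upos[of n] by (intro nn_integral_cong) (simp add: nn_integral_cmult ennreal_mult less_imp_le mult.assoc)
      also have "\<dots> \<le> (\<integral>\<^sup>+x. ennreal (u n x) * (ennreal \<gamma> * (\<integral>\<^sup>+\<xi>. ennreal (\<xi>\<^sup>2) * W x \<xi> \<partial>lborel) + ennreal (E * exp (- \<delta> * x\<^sup>2))) \<partial>lborel)"
        by (intro nn_integral_mono mult_left_mono 1) auto
      also have "\<dots> = (\<integral>\<^sup>+x. ennreal \<gamma> * (\<integral>\<^sup>+\<xi>. ennreal (u n x * \<xi>\<^sup>2) * W x \<xi> \<partial>lborel) + ennreal (u n x) * ennreal (E * exp (- \<delta> * x\<^sup>2)) \<partial>lborel)"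
        using upos[of n]
        by (intro nn_integral_cong) (simp add: nn_integral_cmult[symmetric] ennreal_mult less_imp_le mult_ac distrib_left)
      also have "\<dots> = ennreal \<gamma> * (\<integral>\<^sup>+x. (\<integral>\<^sup>+\<xi>. ennreal (u n x * \<xi>\<^sup>2) * W x \<xi> \<partial>lborel) \<partial>lborel) + (\<integral>\<^sup>+x. ennreal (u n x) * ennreal (E * exp (- \<delta> * x\<^sup>2)) \<partial>lborel)"
        by (subst nn_integral_add) (auto simp: nn_integral_cmult)
      also have "(\<integral>\<^sup>+x. (\<integral>\<^sup>+\<xi>. ennreal (u n x * \<xi>\<^sup>2) * W x \<xi> \<partial>lborel) \<partial>lborel) = (\<integral>\<^sup>+p. ennreal (u n (fst p) * (snd p)\<^sup>2) * W (fst p) (snd p) \<partial>?P)"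
        by (subst lborel.nn_integral_fst[symmetric]) auto
      finally show ?thesis using wI[of n] by (meson add_left_mono order_trans)
    qed
    have A2: "(\<integral>\<^sup>+p. ennreal (u n (snd p) * (snd p)\<^sup>2) * W (fst p) (snd p) \<partial>?P)
       \<le> ennreal \<gamma> * (\<integral>\<^sup>+p. ennreal (u n (snd p) * (fst p)\<^sup>2) * W (fst p) (snd p) \<partial>?P) + ennreal (E * I)"
    proof -
      have "(\<integral>\<^sup>+p. ennreal (u n (snd p) * (snd p)\<^sup>2) * W (fst p) (snd p) \<partial>?P)
         = (\<integral>\<^sup>+\<xi>. (\<integral>\<^sup>+x. ennreal (u n \<xi> * \<xi>\<^sup>2) * W x \<xi> \<partial>lborel) \<partial>lborel)"
        by (subst lborel_pair.nn_integral_snd[symmetric]) auto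
      also have "\<dots> = (\<integral>\<^sup>+\<xi>. ennreal (u n \<xi>) * (ennreal (\<xi>\<^sup>2) * (\<integral>\<^sup>+x. W x \<xi> \<partial>lborel)) \<partial>lborel)"
        using upos[of n] by (intro nn_integral_cong) (simp add: nn_integral_cmult ennreal_mult less_imp_le mult.assoc)
      also have "\<dots> \<le> (\<integral>\<^sup>+\<xi>. ennreal (u n \<xi>) * (ennreal \<gamma> * (\<integral>\<^sup>+x. ennreal (x\<^sup>2) * W x \<xi> \<partial>lborel) + ennreal (E * exp (- \<delta> * \<xi>\<^sup>2))) \<partial>lborel)"
        by (intro nn_integral_mono mult_left_mono 2) auto
      also have "\<dots> = (\<integral>\<^sup>+\<xi>. ennreal \<gamma> * (\<integral>\<^sup>+x. ennreal (u n \<xi> * x\<^sup>2) * W x \<xi> \<partial>lborel) + ennreal (u n \<xi>) * ennreal (E * exp (- \<delta> * \<xi>\<^sup>2)) \<partial>lborel)"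
        using upos[of n]
        by (intro nn_integral_cong) (simp add: nn_integral_cmult[symmetric] ennreal_mult less_imp_le mult_ac distrib_left)
      also have "\<dots> = ennreal \<gamma> * (\<integral>\<^sup>+\<xi>. (\<integral>\<^sup>+x. ennreal (u n \<xi> * x\<^sup>2) * W x \<xi> \<partial>lborel) \<partial>lborel) + (\<integral>\<^sup>+x. ennreal (u n x) * ennreal (E * exp (- \<delta> * x\<^sup>2)) \<partial>lborel)"
        by (subst nn_integral_add) (auto simp: nn_integral_cmult)
      also have "(\<integral>\<^sup>+\<xi>. (\<integral>\<^sup>+x. ennreal (u n \<xi> * x\<^sup>2) * W x \<xi> \<partial>lborel) \<partial>lborel) = (\<integral>\<^sup>+p. ennreal (u n (snd p) * (fst p)\<^sup>2) * W (fst p) (snd p) \<partial>?P)"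
        by (subst lborel_pair.nn_integral_snd[symmetric]) auto
      finally show ?thesis using wI[of n] by (meson add_left_mono order_trans)
    qed
    have swap: "(\<integral>\<^sup>+p. ennreal (u n (fst p) * (snd p)\<^sup>2) * W (fst p) (snd p) \<partial>?P) + (\<integral>\<^sup>+p. ennreal (u n (snd p) * (fst p)\<^sup>2) * W (fst p) (snd p) \<partial>?P)
       \<le> integral\<^sup>N ?P (f n)"
    proof -
      have "u n x * y\<^sup>2 + u n y * x\<^sup>2 \<le> u n x * x\<^sup>2 + u n y * y\<^sup>2" for x y
      proof -
        have "(u n x - u n y) * (x\<^sup>2 - y\<^sup>2) \<ge> 0"
        proof (cases "x\<^sup>2 \<le> y\<^sup>2")
          case True
          then have "u n x \<le> u n y" unfolding u_def using c by (auto intro!: mult_left_mono)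
          then show ?thesis using True by (intro mult_nonpos_nonpos) auto
        next
          case False
          then have "u n y \<le> u n x" unfolding u_def using c by (auto intro!: mult_left_mono)
          then show ?thesis using False by (intro mult_nonneg_nonneg) auto
        qed
        then show ?thesis by (simp add: algebra_simps)
      qed
      then have "(\<integral>\<^sup>+p. ennreal (u n (fst p) * (snd p)\<^sup>2) * W (fst p) (snd p) + ennreal (u n (snd p) * (fst p)\<^sup>2) * W (fst p) (snd p) \<partial>?P) \<le> integral\<^sup>N ?P (f n)"
        unfolding f_def using upos[of n]
        by (intro nn_integral_mono) (auto simp: distrib_right[symmetric] ennreal_plus[symmetric] less_imp_le simp del: ennreal_plus intro!: mult_right_mono ennreal_leI)
      then show ?thesis by (subst (asm) nn_integral_add) auto
    qed
    have split: "integral\<^sup>N ?P (f n) = (\<integral>\<^sup>+p. ennreal (u n (fst p) * (fst p)\<^sup>2) * W (fst p) (snd p) \<partial>?P) + (\<integral>\<^sup>+p. ennreal (u n (snd p) * (snd p)\<^sup>2) * W (fst p) (snd p) \<partial>?P)"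
      unfolding f_def using upos[of n] by (subst nn_integral_add[symmetric]) (auto simp: distrib_right ennreal_plus less_imp_le)
    have "integral\<^sup>N ?P (f n) \<le> (ennreal \<gamma> * (\<integral>\<^sup>+p. ennreal (u n (fst p) * (snd p)\<^sup>2) * W (fst p) (snd p) \<partial>?P) + ennreal (E * I))
       + (ennreal \<gamma> * (\<integral>\<^sup>+p. ennreal (u n (snd p) * (fst p)\<^sup>2) * W (fst p) (snd p) \<partial>?P) + ennreal (E * I))"
      unfolding split by (intro add_mono A1 A2)
    also have "\<dots> = ennreal \<gamma> * ((\<integral>\<^sup>+p. ennreal (u n (fst p) * (snd p)\<^sup>2) * W (fst p) (snd p) \<partial>?P) + (\<integral>\<^sup>+p. ennreal (u n (snd p) * (fst p)\<^sup>2) * W (fst p) (snd p) \<partial>?P)) + ennreal (2 * E * I)"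
      using E I0 by (simp add: distrib_left ennreal_plus[symmetric] add_ac del: ennreal_plus)
    also have "\<dots> \<le> ennreal \<gamma> * integral\<^sup>N ?P (f n) + ennreal (2 * E * I)"
      by (intro add_right_mono mult_left_mono swap) auto
    finally have le: "integral\<^sup>N ?P (f n) \<le> ennreal \<gamma> * integral\<^sup>N ?P (f n) + ennreal (2 * E * I)" .
    have "integral\<^sup>N ?P (f n) \<le> (\<integral>\<^sup>+p. ennreal (exp (c * n)) * (ennreal (1 + (fst p)\<^sup>2 + (snd p)\<^sup>2) * W (fst p) (snd p)) \<partial>?P)"
    proof (rule nn_integral_mono)
      fix p :: "real \<times> real"
      have "u n x \<le> exp (c * n)" for x unfolding u_def using c by simp
      then have "u n (fst p) * (fst p)\<^sup>2 + u n (snd p) * (snd p)\<^sup>2 \<le> exp (c * n) * (fst p)\<^sup>2 + exp (c * n) * (snd p)\<^sup>2"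
        by (intro add_mono mult_right_mono) auto
      also have "\<dots> \<le> exp (c * n) * (1 + (fst p)\<^sup>2 + (snd p)\<^sup>2)" by (simp add: distrib_left)
      finally show "f n p \<le> ennreal (exp (c * n)) * (ennreal (1 + (fst p)\<^sup>2 + (snd p)\<^sup>2) * W (fst p) (snd p))"
        unfolding f_def mult.assoc[symmetric] ennreal_mult[symmetric, OF exp_ge_zero one_plus_squares_nonneg]
        by (intro mult_right_mono ennreal_leI) auto
    qed
    also have "\<dots> = ennreal (exp (c * n)) * (\<integral>\<^sup>+p. (ennreal (1 + (fst p)\<^sup>2 + (snd p)\<^sup>2) * W (fst p) (snd p)) \<partial>?P)"
      by (intro nn_integral_cmult) auto
    also have "\<dots> < \<infinity>" using fin by (simp add: ennreal_mult_less_top)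
    \<comment> \<open>Finiteness of the truncated integral is what allows
      \<open>\<gamma> * s\<close> to be subtracted below; the resulting bound no longer depends on
      \<open>n\<close>.\<close>
    finally obtain s where s: "integral\<^sup>N ?P (f n) = ennreal s" "s \<ge> 0"
      by (cases "integral\<^sup>N ?P (f n)" rule: ennreal_cases) auto
    have "ennreal s \<le> ennreal (\<gamma> * s + 2 * E * I)"
      using le unfolding s(1) using s(2) \<gamma> E I0 by (simp add: ennreal_mult)
    then have "s \<le> \<gamma> * s + 2 * E * I" using s(2) \<gamma> E I0 by (subst (asm) ennreal_le_iff) auto
    then have "s * (1 - \<gamma>) \<le> 2 * E * I" by (simp add: algebra_simps)
    then have "s \<le> 2 * E * I / (1 - \<gamma>)" using \<gamma> by (simp add: pos_le_divide_eq)
    then show ?thesis unfolding s(1) by (rule ennreal_leI)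
  qed
  define g where "g p = ennreal (exp (c * (fst p)\<^sup>2) * (fst p)\<^sup>2 + exp (c * (snd p)\<^sup>2) * (snd p)\<^sup>2) * W (fst p) (snd p)" for p :: "real \<times> real"
  have "(\<lambda>n. integral\<^sup>N ?P (f n)) \<longlonglongrightarrow> integral\<^sup>N ?P g"
  proof (rule nn_integral_LIMSEQ)
    show "incseq f"
      unfolding f_def u_def incseq_def le_fun_def using c
      by (auto intro!: mult_right_mono ennreal_leI add_mono mult_left_mono)
    fix p :: "real \<times> real"
    have ulim: "\<forall>\<^sub>F n in sequentially. u n x = exp (c * x\<^sup>2)" for x
    proof -
      obtain N :: nat where "x\<^sup>2 \<le> N" using real_arch_simple by blast
      then have "\<forall>n\<ge>N. u n x = exp (c * x\<^sup>2)" unfolding u_def by (auto simp: min_def)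
      then show ?thesis unfolding eventually_sequentially by blast
    qed
    have "\<forall>\<^sub>F n in sequentially. f n p = g p"
      using ulim[of "fst p"] ulim[of "snd p"] by eventually_elim (simp add: f_def g_def)
    then show "(\<lambda>n. f n p) \<longlonglongrightarrow> g p" by (rule tendsto_eventually)
  qed measurable
  then have gfin: "integral\<^sup>N ?P g \<le> ennreal (2 * E * I / (1 - \<gamma>))"
    by (rule LIMSEQ_le_const2) (use bound in auto)
  have "(\<integral>\<^sup>+p. ennreal (exp (c / 2 * ((fst p)\<^sup>2 + (snd p)\<^sup>2))) * W (fst p) (snd p) \<partial>?P)
    \<le> (\<integral>\<^sup>+p. g p + ennreal (exp c) * (ennreal (1 + (fst p)\<^sup>2 + (snd p)\<^sup>2) * W (fst p) (snd p)) \<partial>?P)"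
  proof (rule nn_integral_mono)
    fix p :: "real \<times> real"
    obtain x y where p: "p = (x, y)" by (cases p)
    \<comment> \<open>Estimating both squares by the larger one is where the conclusion loses half
      of \<open>c\<close>. For \<open>M \<ge> 1\<close> the factor \<open>M\<close> that is needed
      to reach \<open>g\<close> can be inserted; otherwise the plain second moment suffices.\<close>
    define M where "M = max (x\<^sup>2) (y\<^sup>2)"
    have M0: "M \<ge> 0" by (simp add: M_def le_max_iff_disj)
    have "exp (c / 2 * (x\<^sup>2 + y\<^sup>2)) \<le> exp (c * M)"
    proof -
      have "x\<^sup>2 + y\<^sup>2 \<le> 2 * M" by (simp add: M_def)
      then have "c / 2 * (x\<^sup>2 + y\<^sup>2) \<le> c / 2 * (2 * M)" using c by (intro mult_left_mono) auto
      then show ?thesis by simp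
    qed
    also have "\<dots> \<le> exp (c * M) * M + exp c"
    proof (cases "M \<ge> 1")
      case True
      then have "exp (c * M) * 1 \<le> exp (c * M) * M" by (intro mult_left_mono) auto
      then show ?thesis by (simp add: add_increasing2)
    next
      case False
      then have "c * M \<le> c * 1" using c by (intro mult_left_mono) auto
      then show ?thesis using M0 by (simp add: add_increasing)
    qed
    also have "exp (c * M) * M \<le> exp (c * x\<^sup>2) * x\<^sup>2 + exp (c * y\<^sup>2) * y\<^sup>2"
      by (simp add: M_def max_def)
    also have "exp c \<le> exp c * (1 + x\<^sup>2 + y\<^sup>2)" by simp
    finally have "exp (c / 2 * (x\<^sup>2 + y\<^sup>2)) \<le> (exp (c * x\<^sup>2) * x\<^sup>2 + exp (c * y\<^sup>2) * y\<^sup>2) + exp c * (1 + x\<^sup>2 + y\<^sup>2)" by simp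
    then have "ennreal (exp (c / 2 * (x\<^sup>2 + y\<^sup>2))) \<le> ennreal ((exp (c * x\<^sup>2) * x\<^sup>2 + exp (c * y\<^sup>2) * y\<^sup>2) + exp c * (1 + x\<^sup>2 + y\<^sup>2))"
      by (rule ennreal_leI)
    also have "\<dots> = ennreal (exp (c * x\<^sup>2) * x\<^sup>2 + exp (c * y\<^sup>2) * y\<^sup>2) + ennreal (exp c) * ennreal (1 + x\<^sup>2 + y\<^sup>2)"
      by (rule ennreal_add_mult) auto
    finally have "ennreal (exp (c / 2 * (x\<^sup>2 + y\<^sup>2))) \<le> ennreal (exp (c * x\<^sup>2) * x\<^sup>2 + exp (c * y\<^sup>2) * y\<^sup>2) + ennreal (exp c) * ennreal (1 + x\<^sup>2 + y\<^sup>2)" .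
    then show "ennreal (exp (c / 2 * ((fst p)\<^sup>2 + (snd p)\<^sup>2))) * W (fst p) (snd p)
      \<le> g p + ennreal (exp c) * (ennreal (1 + (fst p)\<^sup>2 + (snd p)\<^sup>2) * W (fst p) (snd p))"
      unfolding g_def p fst_conv snd_conv mult.assoc[symmetric] distrib_right[symmetric] by (intro mult_right_mono) auto
  qed
  also have "\<dots> = integral\<^sup>N ?P g + ennreal (exp c) * (\<integral>\<^sup>+p. ennreal (1 + (fst p)\<^sup>2 + (snd p)\<^sup>2) * W (fst p) (snd p) \<partial>?P)"
    unfolding g_def by (subst nn_integral_add) (auto simp: nn_integral_cmult)
  also have "\<dots> < \<infinity>"
    using fin le_less_trans[OF gfin] by (simp add: ennreal_mult_less_top)
  finally show ?thesis .
qed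


section \<open>From the short-time transform back to the function\<close>

text \<open>Provides the a priori finiteness for the rearrangement argument. After Tonelli the
  Gaussian is integrated over \<open>x\<close> first, which turns \<open>1 + x\<^sup>2\<close> into
  at most a multiple of \<open>1 + t\<^sup>2\<close>.\<close>

lemma nn_integral_stft_moment:
  fixes k :: "real \<Rightarrow> complex"
  assumes k: "integrable lborel k" "continuous_on UNIV k" "\<And>x. norm (k x) \<le> B"
    and fin: "(\<integral>\<^sup>+x. ennreal ((1 + x\<^sup>2) * (norm (k x))\<^sup>2) \<partial>lborel) < \<infinity>"
  shows "(\<integral>\<^sup>+x. ennreal (1 + x\<^sup>2) * (\<integral>\<^sup>+\<xi>. ennreal ((norm (stft k x \<xi>))\<^sup>2) \<partial>lborel) \<partial>lborel) < \<infinity>"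
proof -
  have [measurable]: "k \<in> borel_measurable borel" using k(1) by auto
  define K where "K = (LINT v|lborel. (1 + \<bar>v\<bar>)\<^sup>2 * exp (- (2 * pi) * v\<^sup>2))"
  have intK: "integrable lborel (\<lambda>v. (1 + \<bar>v\<bar>)\<^sup>2 * exp (- (2 * pi) * v\<^sup>2))"
    using integrable_gaussian_weight[of "2 * pi" 2 0] by simp
  have K: "(\<integral>\<^sup>+v. ennreal ((1 + \<bar>v\<bar>)\<^sup>2 * exp (- (2 * pi) * v\<^sup>2)) \<partial>lborel) = ennreal K"
    unfolding K_def by (rule nn_integral_eq_integral[OF intK]) auto
  have inner: "(\<integral>\<^sup>+x. ennreal ((1 + x\<^sup>2) * exp (- (2 * pi) * (t - x)\<^sup>2)) \<partial>lborel) \<le> ennreal (2 * (1 + t\<^sup>2)) * ennreal K" for t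
  proof -
    have "(\<integral>\<^sup>+x. ennreal ((1 + x\<^sup>2) * exp (- (2 * pi) * (t - x)\<^sup>2)) \<partial>lborel)
       = (\<integral>\<^sup>+v. ennreal ((1 + (t + v)\<^sup>2) * exp (- (2 * pi) * v\<^sup>2)) \<partial>lborel)"
      by (subst nn_integral_real_affine[where c=1 and t=t]) auto
    also have "\<dots> \<le> (\<integral>\<^sup>+v. ennreal (2 * (1 + t\<^sup>2)) * ennreal ((1 + \<bar>v\<bar>)\<^sup>2 * exp (- (2 * pi) * v\<^sup>2)) \<partial>lborel)"
    proof (rule nn_integral_mono)
      fix v :: real
      have "0 \<le> (t - v)\<^sup>2" by simp
      then have "1 + (t + v)\<^sup>2 \<le> 2 * (1 + t\<^sup>2) + 2 * v\<^sup>2" by (simp add: power2_eq_square algebra_simps)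
      also have "\<dots> \<le> 2 * (1 + t\<^sup>2) * (1 + v\<^sup>2)" by (simp add: algebra_simps)
      also have "\<dots> \<le> 2 * (1 + t\<^sup>2) * (1 + \<bar>v\<bar>)\<^sup>2" by (intro mult_left_mono) (auto simp: power2_eq_square algebra_simps)
      finally have "(1 + (t + v)\<^sup>2) * exp (- (2 * pi) * v\<^sup>2) \<le> 2 * (1 + t\<^sup>2) * (1 + \<bar>v\<bar>)\<^sup>2 * exp (- (2 * pi) * v\<^sup>2)"
        by (rule mult_right_mono) auto
      then show "ennreal ((1 + (t + v)\<^sup>2) * exp (- (2 * pi) * v\<^sup>2)) \<le> ennreal (2 * (1 + t\<^sup>2)) * ennreal ((1 + \<bar>v\<bar>)\<^sup>2 * exp (- (2 * pi) * v\<^sup>2))"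
        by (subst ennreal_mult[symmetric]) (auto intro!: ennreal_leI simp: mult.assoc)
    qed
    also have "\<dots> = ennreal (2 * (1 + t\<^sup>2)) * ennreal K" unfolding K[symmetric] by (rule nn_integral_cmult) simp
    finally show ?thesis .
  qed
  have "(\<integral>\<^sup>+x. ennreal (1 + x\<^sup>2) * (\<integral>\<^sup>+\<xi>. ennreal ((norm (stft k x \<xi>))\<^sup>2) \<partial>lborel) \<partial>lborel)
    = (\<integral>\<^sup>+x. (\<integral>\<^sup>+t. ennreal (1 + x\<^sup>2) * ennreal ((norm (k t))\<^sup>2 * exp (- (2 * pi) * (t - x)\<^sup>2)) \<partial>lborel) \<partial>lborel)"
    unfolding nn_integral_stft[OF k] by (intro nn_integral_cong nn_integral_cmult[symmetric]) simp
  also have "\<dots> = (\<integral>\<^sup>+t. (\<integral>\<^sup>+x. ennreal (1 + x\<^sup>2) * ennreal ((norm (k t))\<^sup>2 * exp (- (2 * pi) * (t - x)\<^sup>2)) \<partial>lborel) \<partial>lborel)"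
    by (rule lborel_pair.Fubini') measurable
  also have "\<dots> = (\<integral>\<^sup>+t. ennreal ((norm (k t))\<^sup>2) * (\<integral>\<^sup>+x. ennreal ((1 + x\<^sup>2) * exp (- (2 * pi) * (t - x)\<^sup>2)) \<partial>lborel) \<partial>lborel)"
    by (intro nn_integral_cong, subst nn_integral_cmult[symmetric]) (auto simp: ennreal_mult mult_ac intro!: nn_integral_cong)
  also have "\<dots> \<le> (\<integral>\<^sup>+t. ennreal ((norm (k t))\<^sup>2) * (ennreal (2 * (1 + t\<^sup>2)) * ennreal K) \<partial>lborel)"
    by (intro nn_integral_mono mult_left_mono inner) auto
  also have "\<dots> = (\<integral>\<^sup>+t. (ennreal 2 * ennreal K) * ennreal ((1 + t\<^sup>2) * (norm (k t))\<^sup>2) \<partial>lborel)"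
  proof (intro nn_integral_cong)
    fix t :: real
    have "ennreal (2 * (1 + t\<^sup>2)) = ennreal 2 * ennreal (1 + t\<^sup>2)"
      "ennreal ((1 + t\<^sup>2) * (norm (k t))\<^sup>2) = ennreal (1 + t\<^sup>2) * ennreal ((norm (k t))\<^sup>2)"
      by (rule ennreal_mult; simp)+
    then show "ennreal ((norm (k t))\<^sup>2) * (ennreal (2 * (1 + t\<^sup>2)) * ennreal K) = ennreal 2 * ennreal K * ennreal ((1 + t\<^sup>2) * (norm (k t))\<^sup>2)"
      by (simp only: mult_ac)
  qed
  also have "\<dots> = (ennreal 2 * ennreal K) * (\<integral>\<^sup>+t. ennreal ((1 + t\<^sup>2) * (norm (k t))\<^sup>2) \<partial>lborel)"
    by (rule nn_integral_cmult) simp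
  also have "\<dots> < \<infinity>" using fin by (simp add: ennreal_mult_less_top)
  finally show ?thesis .
qed

lemma weighted_amgm:
  fixes a b l :: real
  assumes "l > 0"
  shows "a * b \<le> (l * a\<^sup>2 + b\<^sup>2 / l) / 2"
proof -
  have "0 \<le> (l * a - b)\<^sup>2 / l" using assms by simp
  also have "\<dots> = l * a\<^sup>2 - 2 * (a * b) + b\<^sup>2 / l" using assms by (simp add: power2_eq_square field_simps)
  finally show ?thesis by simp
qed

text \<open>Pointwise recovery from a weighted \<open>L\<^sup>2\<close> norm. At \<open>t\<close>
  the windowed function is bounded by the \<open>L\<^sup>1\<close> norm of its transform. Averaging
  over \<open>x\<close> with a second Gaussian and splitting the product by the weighted mean
  inequality leaves the given finite integral and a pure Gaussian integral.\<close>

lemma gaussian_decay_of_stft: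
  fixes k :: "real \<Rightarrow> complex"
  assumes k: "integrable lborel k" "continuous_on UNIV k" and c: "c > 0"
    and fin: "(\<integral>\<^sup>+p. ennreal (exp (c * ((fst p)\<^sup>2 + (snd p)\<^sup>2))) * ennreal ((norm (stft k (fst p) (snd p)))\<^sup>2) \<partial>(lborel \<Otimes>\<^sub>M lborel)) < \<infinity>"
  obtains C a where "a > 0" "\<And>t. norm (k t) \<le> C * exp (- a * t\<^sup>2)"
proof -
  let ?P = "lborel \<Otimes>\<^sub>M lborel :: (real \<times> real) measure"
  have [measurable]: "k \<in> borel_measurable borel" using k(1) by auto
  have [measurable]: "(\<lambda>p. stft k (fst p) (snd p)) \<in> borel_measurable ?P"
    using stft_measurable[of k] by simp
  define I where "I = (\<integral>\<^sup>+p. ennreal (exp (c * ((fst p)\<^sup>2 + (snd p)\<^sup>2))) * ennreal ((norm (stft k (fst p) (snd p)))\<^sup>2) \<partial>?P)"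
  obtain J where J: "I = ennreal J" "J \<ge> 0" using fin unfolding I_def[symmetric] by (cases I rule: ennreal_cases) auto
  \<comment> \<open>\<open>m\<close> lies below two rates: half of the weight in \<open>x\<close>,
    and \<open>2 * pi\<close> from the squared Gaussian in \<open>t - x\<close>. As
    \<open>t\<^sup>2 \<le> 2 * (x\<^sup>2 + (t - x)\<^sup>2)\<close>, together they give the rate
    \<open>m / 2\<close> in \<open>t\<close>. Half of it pays for the weight
    \<open>exp (- a * t\<^sup>2)\<close> in the mean inequality, and \<open>a = m / 4\<close>
    remains.\<close>
  define m where "m = min (c / 2) (2 * pi)"
  define a where "a = m / 4"
  have m: "m > 0" "m \<le> c / 2" "m \<le> 2 * pi" and a: "a > 0" using c by (auto simp: m_def a_def)
  define L where "L = sqrt (pi / (c / 2)) * sqrt (pi / c)"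
  have gx: "(\<integral>\<^sup>+x. ennreal (exp (- (c / 2) * x\<^sup>2)) \<partial>lborel) = ennreal (sqrt (pi / (c / 2)))"
    using gaussian_integral_0[of "c / 2"] c by (subst nn_integral_eq_integral) auto
  have gy: "(\<integral>\<^sup>+x. ennreal (exp (- c * x\<^sup>2)) \<partial>lborel) = ennreal (sqrt (pi / c))"
    using gaussian_integral_0[of c] c by (subst nn_integral_eq_integral) auto
  have main: "norm (k t) \<le> sqrt 2 * ((J + L) / 2) * exp (- a * t\<^sup>2)" for t
  proof -
    have pt: "ennreal (norm (k t) * exp (- (2 * pi) * (t - x)\<^sup>2)) \<le> (\<integral>\<^sup>+\<xi>. ennreal (norm (stft k x \<xi>) * exp (- pi * (t - x)\<^sup>2)) \<partial>lborel)" for x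
    proof -
      have "ennreal (norm (window k x t)) \<le> (\<integral>\<^sup>+\<xi>. ennreal (norm (stft k x \<xi>)) \<partial>lborel)"
        unfolding stft_def using continuous_window[OF k(2), of x]
        by (intro norm_le_nn_integral_fourier integrable_window k) (simp add: continuous_on_eq_continuous_at)
      then have "ennreal (norm (window k x t)) * ennreal (exp (- pi * (t - x)\<^sup>2)) \<le> (\<integral>\<^sup>+\<xi>. ennreal (norm (stft k x \<xi>)) \<partial>lborel) * ennreal (exp (- pi * (t - x)\<^sup>2))"
        by (rule mult_right_mono) auto
      also have "\<dots> = (\<integral>\<^sup>+\<xi>. ennreal (norm (stft k x \<xi>)) * ennreal (exp (- pi * (t - x)\<^sup>2)) \<partial>lborel)"
      proof (rule nn_integral_multc[symmetric])
        show "(\<lambda>\<xi>. ennreal (norm (stft k x \<xi>))) \<in> borel_measurable lborel"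
          using fourier_measurable[OF integrable_window[OF k(1)], of x] unfolding stft_def by measurable
      qed
      also have "\<dots> = (\<integral>\<^sup>+\<xi>. ennreal (norm (stft k x \<xi>) * exp (- pi * (t - x)\<^sup>2)) \<partial>lborel)"
        by (simp add: ennreal_mult)
      also have "ennreal (norm (window k x t)) * ennreal (exp (- pi * (t - x)\<^sup>2)) = ennreal (norm (k t) * exp (- (2 * pi) * (t - x)\<^sup>2))"
        by (simp add: norm_window ennreal_mult[symmetric] mult.assoc exp_add[symmetric])
      finally show ?thesis .
    qed
    \<comment> \<open>\<open>sqrt (1 / 2)\<close> is the integral of the squared Gaussian over
      \<open>x\<close>; it explains the factor \<open>sqrt 2\<close> in the claim.\<close>
    have "ennreal (norm (k t)) * ennreal (sqrt (1 / 2)) = (\<integral>\<^sup>+x. ennreal (norm (k t)) * ennreal (exp (- (2 * pi) * (t - x)\<^sup>2)) \<partial>lborel)"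
    proof -
      have "(\<integral>\<^sup>+x. ennreal (exp (- (2 * pi) * (t - x)\<^sup>2)) \<partial>lborel) = ennreal (sqrt (pi / (2 * pi)))"
        using gaussian_integral[of "2 * pi" t] unfolding power2_commute[of t]
        by (subst nn_integral_eq_integral) (auto simp del: real_sqrt_eq_iff)
      then show ?thesis by (simp add: nn_integral_cmult)
    qed
    also have "\<dots> \<le> (\<integral>\<^sup>+x. (\<integral>\<^sup>+\<xi>. ennreal (norm (stft k x \<xi>) * exp (- pi * (t - x)\<^sup>2)) \<partial>lborel) \<partial>lborel)"
      using pt by (intro nn_integral_mono) (simp add: ennreal_mult)
    also have "\<dots> = (\<integral>\<^sup>+p. ennreal (norm (stft k (fst p) (snd p)) * exp (- pi * (t - fst p)\<^sup>2)) \<partial>?P)"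
      by (subst lborel.nn_integral_fst[symmetric]) auto
    also have "\<dots> \<le> (\<integral>\<^sup>+p. ennreal (exp (- a * t\<^sup>2) / 2) * (ennreal (exp (c * ((fst p)\<^sup>2 + (snd p)\<^sup>2))) * ennreal ((norm (stft k (fst p) (snd p)))\<^sup>2))
          + ennreal (exp (- a * t\<^sup>2) / 2) * (ennreal (exp (- (c / 2) * (fst p)\<^sup>2)) * ennreal (exp (- c * (snd p)\<^sup>2))) \<partial>?P)"
    proof (rule nn_integral_mono)
      fix p :: "real \<times> real"
      obtain x \<xi> where p: "p = (x, \<xi>)" by (cases p)
      let ?V = "norm (stft k x \<xi>)"
      have "?V * exp (- pi * (t - x)\<^sup>2) \<le> (exp (- a * t\<^sup>2 + c * (x\<^sup>2 + \<xi>\<^sup>2)) * ?V\<^sup>2 + (exp (- pi * (t - x)\<^sup>2))\<^sup>2 / exp (- a * t\<^sup>2 + c * (x\<^sup>2 + \<xi>\<^sup>2))) / 2"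
        by (rule weighted_amgm) simp
      also have "(exp (- pi * (t - x)\<^sup>2))\<^sup>2 / exp (- a * t\<^sup>2 + c * (x\<^sup>2 + \<xi>\<^sup>2)) = exp (- (2 * pi) * (t - x)\<^sup>2 + a * t\<^sup>2 - c * (x\<^sup>2 + \<xi>\<^sup>2))"
        by (simp add: exp_double[symmetric] exp_diff[symmetric])
      also have "\<dots> \<le> exp (- a * t\<^sup>2 - (c / 2) * x\<^sup>2 - c * \<xi>\<^sup>2)"
      proof -
        have "0 \<le> m / 2 * (2 * x - t)\<^sup>2" using m by simp
        then have "2 * a * t\<^sup>2 \<le> m * x\<^sup>2 + m * (t - x)\<^sup>2" by (simp add: a_def power2_eq_square algebra_simps)
        also have "\<dots> \<le> (c / 2) * x\<^sup>2 + (2 * pi) * (t - x)\<^sup>2" using m by (intro add_mono mult_right_mono) auto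
        finally show ?thesis by (simp add: algebra_simps)
      qed
      also have "exp (- a * t\<^sup>2 - (c / 2) * x\<^sup>2 - c * \<xi>\<^sup>2) = exp (- a * t\<^sup>2) * (exp (- (c / 2) * x\<^sup>2) * exp (- c * \<xi>\<^sup>2))"
        by (simp add: exp_add[symmetric])
      also have "exp (- a * t\<^sup>2 + c * (x\<^sup>2 + \<xi>\<^sup>2)) = exp (- a * t\<^sup>2) * exp (c * (x\<^sup>2 + \<xi>\<^sup>2))"
        by (rule exp_add)
      finally have "?V * exp (- pi * (t - x)\<^sup>2) \<le> exp (- a * t\<^sup>2) / 2 * (exp (c * (x\<^sup>2 + \<xi>\<^sup>2)) * ?V\<^sup>2)
         + exp (- a * t\<^sup>2) / 2 * (exp (- (c / 2) * x\<^sup>2) * exp (- c * \<xi>\<^sup>2))"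
        by (simp add: add_divide_distrib mult.assoc)
      then have "ennreal (?V * exp (- pi * (t - x)\<^sup>2)) \<le> ennreal (exp (- a * t\<^sup>2) / 2 * (exp (c * (x\<^sup>2 + \<xi>\<^sup>2)) * ?V\<^sup>2)
         + exp (- a * t\<^sup>2) / 2 * (exp (- (c / 2) * x\<^sup>2) * exp (- c * \<xi>\<^sup>2)))" by (rule ennreal_leI)
      then show "ennreal (norm (stft k (fst p) (snd p)) * exp (- pi * (t - fst p)\<^sup>2)) \<le> ennreal (exp (- a * t\<^sup>2) / 2) * (ennreal (exp (c * ((fst p)\<^sup>2 + (snd p)\<^sup>2))) * ennreal ((norm (stft k (fst p) (snd p)))\<^sup>2))
          + ennreal (exp (- a * t\<^sup>2) / 2) * (ennreal (exp (- (c / 2) * (fst p)\<^sup>2)) * ennreal (exp (- c * (snd p)\<^sup>2)))"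
        unfolding p fst_conv snd_conv by (simp add: ennreal_mult[symmetric] ennreal_plus[symmetric] del: ennreal_plus)
    qed
    also have "\<dots> = ennreal (exp (- a * t\<^sup>2) / 2) * I + ennreal (exp (- a * t\<^sup>2) / 2) * (\<integral>\<^sup>+p. ennreal (exp (- (c / 2) * (fst p)\<^sup>2)) * ennreal (exp (- c * (snd p)\<^sup>2)) \<partial>?P)"
      unfolding I_def by (subst nn_integral_add) (auto simp: nn_integral_cmult)
    also have "(\<integral>\<^sup>+p. ennreal (exp (- (c / 2) * (fst p)\<^sup>2)) * ennreal (exp (- c * (snd p)\<^sup>2)) \<partial>?P) = ennreal L"
    proof -
      have "(\<integral>\<^sup>+p. ennreal (exp (- (c / 2) * (fst p)\<^sup>2)) * ennreal (exp (- c * (snd p)\<^sup>2)) \<partial>?P)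
        = (\<integral>\<^sup>+x. \<integral>\<^sup>+\<xi>. ennreal (exp (- (c / 2) * x\<^sup>2)) * ennreal (exp (- c * \<xi>\<^sup>2)) \<partial>lborel \<partial>lborel)"
        by (subst lborel.nn_integral_fst[symmetric]) auto
      also have "\<dots> = (\<integral>\<^sup>+x. ennreal (exp (- (c / 2) * x\<^sup>2)) * ennreal (sqrt (pi / c)) \<partial>lborel)"
        unfolding gy[symmetric] by (intro nn_integral_cong nn_integral_cmult) simp
      also have "\<dots> = ennreal (sqrt (pi / (c / 2))) * ennreal (sqrt (pi / c))"
        unfolding gx[symmetric] by (rule nn_integral_multc) simp
      also have "\<dots> = ennreal L" using c by (simp add: L_def ennreal_mult)
      finally show ?thesis .
    qed
    also have "ennreal (exp (- a * t\<^sup>2) / 2) * I + ennreal (exp (- a * t\<^sup>2) / 2) * ennreal L = ennreal ((J + L) / 2 * exp (- a * t\<^sup>2))"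
    proof -
      have "L \<ge> 0" using c by (simp add: L_def)
      then have "ennreal (exp (- a * t\<^sup>2) / 2) * I + ennreal (exp (- a * t\<^sup>2) / 2) * ennreal L
         = ennreal (exp (- a * t\<^sup>2) / 2 * J + exp (- a * t\<^sup>2) / 2 * L)"
        using J by (simp add: ennreal_mult[symmetric] ennreal_plus[symmetric] del: ennreal_plus)
      also have "exp (- a * t\<^sup>2) / 2 * J + exp (- a * t\<^sup>2) / 2 * L = (J + L) / 2 * exp (- a * t\<^sup>2)"
        by (simp add: algebra_simps add_divide_distrib)
      finally show ?thesis .
    qed
    finally have "ennreal (norm (k t) * sqrt (1 / 2)) \<le> ennreal ((J + L) / 2 * exp (- a * t\<^sup>2))"
      by (simp add: ennreal_mult)
    moreover have "0 \<le> (J + L) / 2 * exp (- a * t\<^sup>2)" using J c by (simp add: L_def)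
    ultimately have "norm (k t) * sqrt (1 / 2) \<le> (J + L) / 2 * exp (- a * t\<^sup>2)" by (subst (asm) ennreal_le_iff) auto
    then have "sqrt 2 * (norm (k t) * sqrt (1 / 2)) \<le> sqrt 2 * ((J + L) / 2 * exp (- a * t\<^sup>2))" by (intro mult_left_mono) auto
    then show ?thesis by (simp add: real_sqrt_divide mult.assoc)
  qed
  show ?thesis by (rule that[OF a main])
qed

theorem joint_gaussian_decay:
  fixes F :: "real \<Rightarrow> complex"
  defines "G \<equiv> fourier F"
  assumes F: "integrable lborel F" "continuous_on UNIV F" "\<And>x. norm (F x) \<le> B"
    and G: "integrable lborel G" "\<And>x. norm (G x) \<le> B"
    and finF: "(\<integral>\<^sup>+x. ennreal ((1 + x\<^sup>2) * (norm (F x))\<^sup>2) \<partial>lborel) < \<infinity>"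
    and finG: "(\<integral>\<^sup>+x. ennreal ((1 + x\<^sup>2) * (norm (G x))\<^sup>2) \<partial>lborel) < \<infinity>"
    and \<gamma>: "0 < \<gamma>" "\<gamma> < 1" and \<eta>: "\<eta> > 0" and X: "X > 0"
    and samp: "sampling S \<gamma> \<eta> X" "sampling T \<gamma> \<eta> X"
    and S: "\<And>t. t \<in> S \<Longrightarrow> norm (F t) \<le> D * (1 + \<bar>t\<bar>) ^ N * exp (- pi * t\<^sup>2)"
    and T: "\<And>t. t \<in> T \<Longrightarrow> norm (G t) \<le> D * (1 + \<bar>t\<bar>) ^ N * exp (- pi * t\<^sup>2)"
  obtains C a where "a > 0" "\<And>t. norm (F t) \<le> C * exp (- a * t\<^sup>2)" "\<And>t. norm (G t) \<le> C * exp (- a * t\<^sup>2)"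
proof -
  let ?P = "lborel \<Otimes>\<^sub>M lborel :: (real \<times> real) measure"
  have G2: "continuous_on UNIV G" unfolding G_def by (rule fourier_continuous[OF F(1)])
  define W where "W x \<xi> = ennreal ((norm (stft F x \<xi>))\<^sup>2)" for x \<xi>
  have [measurable]: "F \<in> borel_measurable borel" "G \<in> borel_measurable borel" using F(1) G(1) by auto
  \<comment> \<open>Both short-time transforms become one function on the phase plane. The
    inequality for \<open>G\<close> thereby turns into the second hypothesis of the rearrangement
    bound, up to a reflection in \<open>x\<close> which the even weights do not notice.\<close>
  have WG: "ennreal ((norm (stft G \<xi> \<eta>))\<^sup>2) = W (- \<eta>) \<xi>" for \<xi> \<eta>
    unfolding W_def G_def norm_stft_fourier[OF F(1)] ..
  have mW: "(\<lambda>p. W (fst p) (snd p)) \<in> borel_measurable (borel \<Otimes>\<^sub>M borel)"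
    unfolding W_def using stft_measurable[of F] by measurable
  have mWx: "(\<lambda>x. W x \<xi>) \<in> borel_measurable borel" "(\<lambda>\<xi>. W x \<xi>) \<in> borel_measurable borel" for x \<xi>
    using measurable_compose[OF _ mW, of "\<lambda>x. (x, \<xi>)" borel] measurable_compose[OF _ mW, of "\<lambda>\<xi>. (x, \<xi>)" borel] by simp_all
  note [measurable] = mW mWx
  have [measurable]: "(\<lambda>p. W (fst p) (snd p)) \<in> borel_measurable ?P" using mW by simp
  obtain E1 \<delta>1 where 1: "\<delta>1 > 0" "E1 \<ge> 0" "\<And>x. ennreal (x\<^sup>2) * (\<integral>\<^sup>+\<xi>. ennreal ((norm (stft F x \<xi>))\<^sup>2) \<partial>lborel)
       \<le> ennreal \<gamma> * (\<integral>\<^sup>+\<xi>. ennreal (\<xi>\<^sup>2 * (norm (stft F x \<xi>))\<^sup>2) \<partial>lborel) + ennreal (E1 * exp (- \<delta>1 * x\<^sup>2))"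
    using stft_localised_sampling[OF \<gamma> \<eta> X samp(1) F S] by blast
  obtain E2 \<delta>2 where 2: "\<delta>2 > 0" "E2 \<ge> 0" "\<And>x. ennreal (x\<^sup>2) * (\<integral>\<^sup>+\<xi>. ennreal ((norm (stft G x \<xi>))\<^sup>2) \<partial>lborel)
       \<le> ennreal \<gamma> * (\<integral>\<^sup>+\<xi>. ennreal (\<xi>\<^sup>2 * (norm (stft G x \<xi>))\<^sup>2) \<partial>lborel) + ennreal (E2 * exp (- \<delta>2 * x\<^sup>2))"
    using stft_localised_sampling[OF \<gamma> \<eta> X samp(2) G(1) G2 G(2) T] by blast
  define \<delta> where "\<delta> = min \<delta>1 \<delta>2"
  define E where "E = max E1 E2"
  define c where "c = \<delta> / 2"
  have c: "0 < c" "c < \<delta>" using 1(1) 2(1) by (auto simp: c_def \<delta>_def)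
  have E: "E \<ge> 0" using 1(2) by (simp add: E_def le_max_iff_disj)
  have e: "E1 * exp (- \<delta>1 * x\<^sup>2) \<le> E * exp (- \<delta> * x\<^sup>2)" "E2 * exp (- \<delta>2 * x\<^sup>2) \<le> E * exp (- \<delta> * x\<^sup>2)" for x
    using 1(2) 2(2) by (auto simp: E_def \<delta>_def intro!: mult_mono mult_right_mono)
  have refl: "(\<integral>\<^sup>+\<eta>. f \<eta> * W (- \<eta>) \<xi> \<partial>lborel) = (\<integral>\<^sup>+x. f (- x) * W x \<xi> \<partial>lborel)"
    if [measurable]: "f \<in> borel_measurable borel" for f \<xi>
    using nn_integral_reflect[of "\<lambda>x. f (- x) * W x \<xi>"] by simp
  have A1: "ennreal (x\<^sup>2) * (\<integral>\<^sup>+\<xi>. W x \<xi> \<partial>lborel) \<le> ennreal \<gamma> * (\<integral>\<^sup>+\<xi>. ennreal (\<xi>\<^sup>2) * W x \<xi> \<partial>lborel) + ennreal (E * exp (- \<delta> * x\<^sup>2))" for x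
    using order_trans[OF 1(3)[of x] add_left_mono[OF ennreal_leI[OF e(1)]]] by (simp add: W_def ennreal_mult)
  have A2: "ennreal (\<xi>\<^sup>2) * (\<integral>\<^sup>+x. W x \<xi> \<partial>lborel) \<le> ennreal \<gamma> * (\<integral>\<^sup>+x. ennreal (x\<^sup>2) * W x \<xi> \<partial>lborel) + ennreal (E * exp (- \<delta> * \<xi>\<^sup>2))" for \<xi>
    using order_trans[OF 2(3)[of \<xi>] add_left_mono[OF ennreal_leI[OF e(2)]]] refl[of "\<lambda>_. 1" \<xi>] refl[of "\<lambda>x. ennreal (x\<^sup>2)" \<xi>]
    by (simp add: WG ennreal_mult)
  have fin1: "(\<integral>\<^sup>+p. ennreal (1 + (fst p)\<^sup>2) * W (fst p) (snd p) \<partial>?P) < \<infinity>"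
  proof -
    have "(\<integral>\<^sup>+p. ennreal (1 + (fst p)\<^sup>2) * W (fst p) (snd p) \<partial>?P) = (\<integral>\<^sup>+x. \<integral>\<^sup>+\<xi>. ennreal (1 + x\<^sup>2) * W x \<xi> \<partial>lborel \<partial>lborel)"
      by (subst lborel.nn_integral_fst[symmetric]) auto
    also have "\<dots> = (\<integral>\<^sup>+x. ennreal (1 + x\<^sup>2) * (\<integral>\<^sup>+\<xi>. W x \<xi> \<partial>lborel) \<partial>lborel)"
      by (intro nn_integral_cong nn_integral_cmult) simp
    also have "\<dots> < \<infinity>" using nn_integral_stft_moment[OF F finF] by (simp add: W_def)
    finally show ?thesis .
  qed
  have fin2: "(\<integral>\<^sup>+p. ennreal (1 + (snd p)\<^sup>2) * W (fst p) (snd p) \<partial>?P) < \<infinity>"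
  proof -
    have "(\<integral>\<^sup>+p. ennreal (1 + (snd p)\<^sup>2) * W (fst p) (snd p) \<partial>?P) = (\<integral>\<^sup>+\<xi>. \<integral>\<^sup>+x. ennreal (1 + \<xi>\<^sup>2) * W x \<xi> \<partial>lborel \<partial>lborel)"
      by (subst lborel_pair.nn_integral_snd[symmetric]) auto
    also have "\<dots> = (\<integral>\<^sup>+\<xi>. ennreal (1 + \<xi>\<^sup>2) * (\<integral>\<^sup>+x. W x \<xi> \<partial>lborel) \<partial>lborel)"
      by (intro nn_integral_cong nn_integral_cmult) simp
    also have "\<dots> = (\<integral>\<^sup>+\<xi>. ennreal (1 + \<xi>\<^sup>2) * (\<integral>\<^sup>+x. ennreal ((norm (stft G \<xi> x))\<^sup>2) \<partial>lborel) \<partial>lborel)"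
      using refl[of "\<lambda>_. 1"] by (simp add: WG)
    also have "\<dots> < \<infinity>" by (rule nn_integral_stft_moment[OF G(1) G2 G(2) finG])
    finally show ?thesis .
  qed
  have fin: "(\<integral>\<^sup>+p. ennreal (1 + (fst p)\<^sup>2 + (snd p)\<^sup>2) * W (fst p) (snd p) \<partial>?P) < \<infinity>"
  proof -
    have "(\<integral>\<^sup>+p. ennreal (1 + (fst p)\<^sup>2 + (snd p)\<^sup>2) * W (fst p) (snd p) \<partial>?P)
       \<le> (\<integral>\<^sup>+p. ennreal (1 + (fst p)\<^sup>2) * W (fst p) (snd p) + ennreal (1 + (snd p)\<^sup>2) * W (fst p) (snd p) \<partial>?P)"
      unfolding distrib_right[symmetric]
      by (intro nn_integral_mono mult_right_mono) (auto simp: ennreal_plus[symmetric] simp del: ennreal_plus intro!: ennreal_leI)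
    also have "\<dots> = (\<integral>\<^sup>+p. ennreal (1 + (fst p)\<^sup>2) * W (fst p) (snd p) \<partial>?P) + (\<integral>\<^sup>+p. ennreal (1 + (snd p)\<^sup>2) * W (fst p) (snd p) \<partial>?P)"
      by (rule nn_integral_add) auto
    also have "\<dots> < \<infinity>" using fin1 fin2 by simp
    finally show ?thesis .
  qed
  have R: "(\<integral>\<^sup>+p. ennreal (exp (c / 2 * ((fst p)\<^sup>2 + (snd p)\<^sup>2))) * W (fst p) (snd p) \<partial>?P) < \<infinity>"
    by (rule rearrangement_bound[OF mW \<gamma> c E A1 A2 fin])
  have RG: "(\<integral>\<^sup>+p. ennreal (exp (c / 2 * ((fst p)\<^sup>2 + (snd p)\<^sup>2))) * ennreal ((norm (stft G (fst p) (snd p)))\<^sup>2) \<partial>?P) < \<infinity>"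
  proof -
    have "(\<integral>\<^sup>+p. ennreal (exp (c / 2 * ((fst p)\<^sup>2 + (snd p)\<^sup>2))) * ennreal ((norm (stft G (fst p) (snd p)))\<^sup>2) \<partial>?P)
      = (\<integral>\<^sup>+\<xi>. \<integral>\<^sup>+\<eta>. ennreal (exp (c / 2 * (\<xi>\<^sup>2 + \<eta>\<^sup>2))) * ennreal ((norm (stft G \<xi> \<eta>))\<^sup>2) \<partial>lborel \<partial>lborel)"
      using stft_measurable[of G] by (subst lborel.nn_integral_fst[symmetric]) auto
    also have "\<dots> = (\<integral>\<^sup>+\<xi>. \<integral>\<^sup>+x. ennreal (exp (c / 2 * (\<xi>\<^sup>2 + x\<^sup>2))) * W x \<xi> \<partial>lborel \<partial>lborel)"
      unfolding WG by (subst refl) auto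
    also have "\<dots> = (\<integral>\<^sup>+p. ennreal (exp (c / 2 * ((snd p)\<^sup>2 + (fst p)\<^sup>2))) * W (fst p) (snd p) \<partial>?P)"
      by (subst lborel_pair.nn_integral_snd[symmetric]) auto
    also have "\<dots> < \<infinity>" using R by (simp add: add.commute)
    finally show ?thesis .
  qed
  obtain C1 a1 where C1: "a1 > 0" "\<And>t. norm (F t) \<le> C1 * exp (- a1 * t\<^sup>2)"
    using gaussian_decay_of_stft[OF F(1,2) _ R[unfolded W_def]] c by (metis half_gt_zero)
  obtain C2 a2 where C2: "a2 > 0" "\<And>t. norm (G t) \<le> C2 * exp (- a2 * t\<^sup>2)"
    using gaussian_decay_of_stft[OF G(1) G2 _ RG] c by (metis half_gt_zero)
  have C0: "C1 \<ge> 0" "C2 \<ge> 0"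
    using order_trans[OF norm_ge_zero C1(2)[of 0]] order_trans[OF norm_ge_zero C2(2)[of 0]] by auto
  show ?thesis
  proof (rule that[of "min a1 a2" "max C1 C2"])
    fix t :: real
    have "C1 * exp (- a1 * t\<^sup>2) \<le> max C1 C2 * exp (- min a1 a2 * t\<^sup>2)" "C2 * exp (- a2 * t\<^sup>2) \<le> max C1 C2 * exp (- min a1 a2 * t\<^sup>2)"
      using C0 by (auto intro!: mult_mono mult_right_mono)
    then show "norm (F t) \<le> max C1 C2 * exp (- min a1 a2 * t\<^sup>2)" "norm (G t) \<le> max C1 C2 * exp (- min a1 a2 * t\<^sup>2)"
      using C1(2)[of t] C2(2)[of t] by linarith+
  qed (use C1 C2 in auto)
qed

section \<open>Improving the decay rate\<close>

lemma self_le_exp: "(x :: real) \<le> exp x"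
  using exp_ge_add_one_self[of x] by linarith

lemma le_mult_exp_minus:
  fixes a b u :: real
  assumes "a * exp u \<le> b"
  shows "a \<le> b * exp (- u)"
  using assms by (simp add: exp_minus field_simps)

text \<open>\<open>L\<close> is the logarithm of a radius: growth of order 2 competes with damping
  of order \<open>q > 2\<close>.\<close>

lemma exp_growth_limit:
  fixes A b q :: real
  assumes "q > 2" "b > 0"
  shows "((\<lambda>L. exp (A * (1 + exp L ^ 2) - b * exp (q * L))) \<longlongrightarrow> 0) at_top"
proof (rule tendsto_sandwich[OF _ _ tendsto_const])
  define p where "p = q - 2"
  have p: "p > 0" using assms by (simp add: p_def)
  have lim: "filterlim (\<lambda>L. b * exp (p * L)) at_top at_top" using assms(2) p by real_asymp
  have ev: "\<forall>\<^sub>F L in at_top. b * exp (p * L) \<ge> 2 * \<bar>A\<bar> + 1" using lim unfolding filterlim_at_top by blast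
  have ev0: "\<forall>\<^sub>F L::real in at_top. L \<ge> 0" by (rule eventually_ge_at_top)
  show "\<forall>\<^sub>F L in at_top. exp (A * (1 + exp L ^ 2) - b * exp (q * L)) \<le> exp (- L)"
    using ev ev0
  proof eventually_elim
    case (elim L)
    define E where "E = exp (2 * L)"
    have E: "E \<ge> 1" "E \<ge> L" using elim(2) exp_ge_add_one_self[of "2 * L"] unfolding E_def by linarith+
    have "A * (1 + E) \<le> \<bar>A\<bar> * (2 * E)" using E by (intro mult_mono) auto
    moreover have "E * (2 * \<bar>A\<bar> + 1) \<le> E * (b * exp (p * L))" using elim(1) E by (intro mult_left_mono) auto
    moreover have "E * (b * exp (p * L)) = b * exp (q * L)"
      by (simp add: E_def p_def exp_add[symmetric] algebra_simps)
    moreover have "exp L ^ 2 = E" by (simp add: E_def exp_double)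
    moreover have "E * (2 * \<bar>A\<bar> + 1) = \<bar>A\<bar> * (2 * E) + E" by (simp add: algebra_simps)
    ultimately have "A * (1 + exp L ^ 2) - b * exp (q * L) \<le> - L" using E(2) by simp
    then show ?case by simp
  qed
  show "((\<lambda>L::real. exp (- L)) \<longlongrightarrow> 0) at_top" by real_asymp
qed simp

text \<open>In the coordinate \<open>\<zeta> = Ln z\<close> the truncated sector is a rectangle; the factor
  \<open>exp (- \<epsilon> * exp (q * \<zeta>))\<close> with \<open>q > 2\<close> beats the growth of order 2 on its far side.\<close>
lemma phragmen_lindelof_sector:
  fixes h :: "complex \<Rightarrow> complex"
  assumes hol: "h holomorphic_on UNIV" and ang: "\<alpha> < \<beta>" "\<beta> - \<alpha> < pi / 2"
    and growth: "\<And>z. norm (h z) \<le> exp (A * (1 + (norm z)\<^sup>2))" and C: "C > 0"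
    and ray1: "\<And>r. r \<ge> 1 \<Longrightarrow> norm (h (of_real r * cis \<alpha>)) \<le> C * r ^ M"
    and ray2: "\<And>r. r \<ge> 1 \<Longrightarrow> norm (h (of_real r * cis \<beta>)) \<le> C * r ^ M"
    and arc: "\<And>\<theta>. \<alpha> \<le> \<theta> \<Longrightarrow> \<theta> \<le> \<beta> \<Longrightarrow> norm (h (cis \<theta>)) \<le> C"
    and r: "r \<ge> 1" and \<theta>: "\<alpha> \<le> \<theta>" "\<theta> \<le> \<beta>"
  shows "norm (h (of_real r * cis \<theta>)) \<le> C * r ^ M"
proof -
  \<comment> \<open>The midpoint of 2 and \<open>pi / (\<beta> - \<alpha>)\<close>. Above 2 it beats
    the growth; below the other end it keeps \<open>exp (q * (\<zeta> - \<i> * \<mu>))\<close> in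
    the right half plane whenever \<open>Im \<zeta>\<close> lies between \<open>\<alpha>\<close> and
    \<open>\<beta>\<close>.\<close>
  define q where "q = (pi / (\<beta> - \<alpha>) + 2) / 2"
  define \<mu> where "\<mu> = (\<alpha> + \<beta>) / 2"
  define d where "d = (\<beta> - \<alpha>) / 2"
  have d: "d > 0" using ang by (simp add: d_def)
  define w where "w = pi / (\<beta> - \<alpha>)"
  have "2 < w" using ang by (simp add: w_def field_simps)
  then have q: "q > 2" "q < w" by (auto simp: q_def w_def[symmetric])
  have qd: "q * d < pi / 2" using q(2) ang by (simp add: d_def w_def field_simps)
  define cc where "cc = cos (q * d)"
  have cc: "cc > 0" unfolding cc_def using qd q(1) d by (intro cos_gt_zero_pi) (auto intro: less_trans[of _ 0])
  \<comment> \<open>The factor \<open>exp (- M * \<zeta>)\<close> divides by the \<open>M\<close>-th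
    power of \<open>z\<close>, so that the polynomial bounds on the rays become constant
    ones.\<close>
  define H where "H e \<zeta> = h (exp \<zeta>) * exp (- of_nat M * \<zeta>) * exp (- of_real e * exp (of_real q * (\<zeta> - \<i> * of_real \<mu>)))" for e \<zeta>
  have Hhol: "H e holomorphic_on UNIV" for e
  proof -
    have "(h \<circ> exp) holomorphic_on UNIV"
      by (intro holomorphic_on_compose holomorphic_intros holomorphic_on_subset[OF hol]) auto
    then show ?thesis unfolding H_def[abs_def] o_def by (intro holomorphic_intros)
  qed
  have Hnorm: "norm (H e \<zeta>) \<le> norm (h (exp \<zeta>)) * exp (- real M * Re \<zeta>) * exp (- (e * cc) * exp (q * Re \<zeta>))"
    if "e > 0" "\<alpha> \<le> Im \<zeta>" "Im \<zeta> \<le> \<beta>" for e \<zeta>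
  proof -
    have "\<bar>Im \<zeta> - \<mu>\<bar> \<le> d" using that by (auto simp: \<mu>_def d_def abs_le_iff field_simps)
    then have le: "\<bar>q * (Im \<zeta> - \<mu>)\<bar> \<le> q * d" using q by (simp add: abs_mult)
    have "cc \<le> cos \<bar>q * (Im \<zeta> - \<mu>)\<bar>" unfolding cc_def using le qd by (intro cos_monotone_0_pi_le) auto
    then have "exp (q * Re \<zeta>) * cc \<le> exp (q * Re \<zeta>) * cos (q * (Im \<zeta> - \<mu>))" by (simp add: cos_abs_real)
    then have "e * (exp (q * Re \<zeta>) * cc) \<le> e * (exp (q * Re \<zeta>) * cos (q * (Im \<zeta> - \<mu>)))"
      using that by (intro mult_left_mono) auto
    then have "norm (exp (- of_real e * exp (of_real q * (\<zeta> - \<i> * of_real \<mu>)))) \<le> exp (- (e * cc) * exp (q * Re \<zeta>))"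
      by (simp add: norm_exp_eq_Re Re_exp mult_ac)
    then show ?thesis unfolding H_def norm_mult by (intro mult_mono) (auto simp: norm_exp_eq_Re)
  qed
  have key: "norm (H e (Complex (ln r) \<theta>)) \<le> C" if e: "e > 0" for e
  proof -
    have "((\<lambda>L::real. exp (A * (1 + exp L ^ 2) - (e * cc) * exp (q * L))) \<longlongrightarrow> 0) at_top"
      by (rule exp_growth_limit[OF q(1) mult_pos_pos[OF e cc]])
    then have "\<forall>\<^sub>F L in at_top. exp (A * (1 + exp L ^ 2) - (e * cc) * exp (q * L)) < C"
      using C order_tendstoD(2) by blast
    then obtain L0 where L0: "\<And>L. L \<ge> L0 \<Longrightarrow> exp (A * (1 + exp L ^ 2) - (e * cc) * exp (q * L)) < C"
      unfolding eventually_at_top_linorder by blast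
    define L where "L = max (max L0 (ln r)) 1"
    have L: "L \<ge> L0" "L \<ge> ln r" "L > 0" by (auto simp: L_def)
    define R where "R = cbox (Complex 0 \<alpha>) (Complex L \<beta>)"
    show ?thesis
    proof (rule maximum_modulus_frontier[where S=R and f="H e" and \<xi>="Complex (ln r) \<theta>"])
      show "H e holomorphic_on interior R" by (rule holomorphic_on_subset[OF Hhol]) auto
      show "continuous_on (closure R) (H e)"
        by (rule holomorphic_on_imp_continuous_on, rule holomorphic_on_subset[OF Hhol]) auto
      show "bounded R" unfolding R_def by simp
      show "Complex (ln r) \<theta> \<in> R" using L r \<theta> by (simp add: R_def in_cbox_complex_iff)
    next
      fix \<zeta> assume "\<zeta> \<in> frontier R"
      then have \<zeta>: "\<zeta> \<in> cbox (Complex 0 \<alpha>) (Complex L \<beta>)" "\<zeta> \<notin> box (Complex 0 \<alpha>) (Complex L \<beta>)"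
        unfolding frontier_def R_def by (auto simp: interior_cbox)
      have b: "0 \<le> Re \<zeta>" "Re \<zeta> \<le> L" "\<alpha> \<le> Im \<zeta>" "Im \<zeta> \<le> \<beta>"
        using \<zeta>(1) by (auto simp: in_cbox_complex_iff)
      have cs: "Re \<zeta> = 0 \<or> Re \<zeta> = L \<or> Im \<zeta> = \<alpha> \<or> Im \<zeta> = \<beta>"
        using \<zeta>(2) b by (auto simp: in_box_complex_iff)
      have exp: "exp \<zeta> = of_real (exp (Re \<zeta>)) * cis (Im \<zeta>)"
        by (simp add: exp_eq_polar exp_of_real)
      have le1: "exp (- (e * cc) * exp (q * Re \<zeta>)) \<le> 1" using e cc by simp
      have le2: "exp (- real M * Re \<zeta>) \<le> 1" using b by simp
      have pow: "exp (Re \<zeta>) ^ M * exp (- real M * Re \<zeta>) = 1"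
        by (simp add: exp_of_nat_mult[symmetric] exp_add[symmetric])
      have ge1: "exp (Re \<zeta>) \<ge> 1" using b by simp
      have "norm (h (exp \<zeta>)) * exp (- real M * Re \<zeta>) * exp (- (e * cc) * exp (q * Re \<zeta>)) \<le> C"
      proof (cases "Re \<zeta> = L")
        case True
        have "norm (h (exp \<zeta>)) \<le> exp (A * (1 + exp L ^ 2))" using growth[of "exp \<zeta>"] True by (simp add: norm_exp_eq_Re)
        then have "norm (h (exp \<zeta>)) * exp (- real M * Re \<zeta>) * exp (- (e * cc) * exp (q * Re \<zeta>))
          \<le> exp (A * (1 + exp L ^ 2)) * 1 * exp (- (e * cc) * exp (q * L))"
          using le2 True by (intro mult_mono) auto
        also have "\<dots> = exp (A * (1 + exp L ^ 2) - (e * cc) * exp (q * L))" by (simp add: exp_diff exp_minus field_simps)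
        also have "\<dots> \<le> C" using L0[OF L(1)] by simp
        finally show ?thesis .
      next
        case False
        have "norm (h (exp \<zeta>)) \<le> C * exp (Re \<zeta>) ^ M"
        proof -
          consider "Re \<zeta> = 0" | "Im \<zeta> = \<alpha>" | "Im \<zeta> = \<beta>" using cs False by blast
          then show ?thesis
          proof cases
            case 1 then show ?thesis using arc[of "Im \<zeta>"] b unfolding exp by simp
          next
            case 2 then show ?thesis using ray1[OF ge1] unfolding exp by simp
          next
            case 3 then show ?thesis using ray2[OF ge1] unfolding exp by simp
          qed
        qed
        then have "norm (h (exp \<zeta>)) * exp (- real M * Re \<zeta>) * exp (- (e * cc) * exp (q * Re \<zeta>))
           \<le> (C * exp (Re \<zeta>) ^ M) * exp (- real M * Re \<zeta>) * 1"
          using le1 C by (intro mult_mono) auto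
        also have "\<dots> = C" using pow by (simp add: mult.assoc)
        finally show ?thesis .
      qed
      then show "norm (H e \<zeta>) \<le> C" using Hnorm[OF e b(3,4)] by linarith
    qed
  qed
  let ?z = "Complex (ln r) \<theta>"
  have "((\<lambda>e. H e ?z) \<longlongrightarrow> h (exp ?z) * exp (- of_nat M * ?z) * exp (- of_real 0 * exp (of_real q * (?z - \<i> * of_real \<mu>)))) (at_right 0)"
    unfolding H_def by (intro tendsto_intros)
  then have "norm (h (exp ?z) * exp (- of_nat M * ?z) * exp (- of_real 0 * exp (of_real q * (?z - \<i> * of_real \<mu>)))) \<le> C"
    by (rule Lim_norm_ubound[rotated]) (use key in \<open>auto simp: eventually_at_right_less eventually_at_filter\<close>)
  then have "norm (h (exp ?z)) * exp (- real M * ln r) \<le> C" by (simp add: norm_mult norm_exp_eq_Re)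
  moreover have "exp (- real M * ln r) = inverse (r ^ M)"
    using r by (simp add: exp_minus exp_of_nat_mult)
  moreover have "exp ?z = of_real r * cis \<theta>" using r by (simp add: exp_eq_polar exp_of_real[symmetric] of_real_exp)
  moreover have "r ^ M > 0" using r by simp
  ultimately show ?thesis by (simp add: field_simps)
qed

text \<open>Completing the square around \<open>\<xi> = - s\<close> with
  \<open>s = pi * Im z / a\<close> produces the Gaussian factor exactly, without loss in the rate;
  at \<open>a = pi\<close> no loss could be afforded. The polynomial weight splits into a factor in
  \<open>s\<close>, hence in \<open>Im z\<close>, and one that is integrated.\<close>

lemma fourier_laplace_growth:
  fixes \<psi> :: "real \<Rightarrow> complex"
  assumes m: "\<psi> \<in> borel_measurable borel" and a: "a > 0"
    and bd: "\<And>\<xi>. norm (\<psi> \<xi>) \<le> D * (1 + \<bar>\<xi>\<bar>) ^ p * exp (- a * \<xi>\<^sup>2)"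
  obtains C where "C > 0" "\<And>z. norm (fourier_laplace \<psi> z) \<le> C * (1 + \<bar>Im z\<bar>) ^ p * exp (pi\<^sup>2 / a * (Im z)\<^sup>2)"
proof -
  have D: "D \<ge> 0" using order_trans[OF norm_ge_zero bd[of 0]] by simp
  define I where "I = (LINT v|lborel. (1 + \<bar>v\<bar>) ^ p * exp (- a * v\<^sup>2))"
  have I: "integrable lborel (\<lambda>v. (1 + \<bar>v\<bar>) ^ p * exp (- a * v\<^sup>2))"
    using integrable_gaussian_weight[OF a, of p 0] by simp
  have I0: "I \<ge> 0" unfolding I_def by (intro integral_nonneg_AE) auto
  define C where "C = D * (1 + pi / a) ^ p * I"
  have C0: "C \<ge> 0" unfolding C_def using D I0 a by (intro mult_nonneg_nonneg zero_le_power) (auto intro: add_nonneg_nonneg divide_nonneg_nonneg)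
  have main: "norm (fourier_laplace \<psi> z) \<le> C * (1 + \<bar>Im z\<bar>) ^ p * exp (pi\<^sup>2 / a * (Im z)\<^sup>2)" for z
  proof -
    define y where "y = Im z"
    define s where "s = pi * y / a"
    define E where "E = D * (1 + \<bar>s\<bar>) ^ p * exp (pi\<^sup>2 / a * y\<^sup>2)"
    have E0: "E \<ge> 0" using D by (simp add: E_def)
    have Iint: "integrable lborel (\<lambda>\<xi>. E * ((1 + \<bar>s + \<xi>\<bar>) ^ p * exp (- a * (s + \<xi>)\<^sup>2)))"
      using lborel_integrable_real_affine[OF I, of 1 s] by simp
    have "norm (fourier_laplace \<psi> z) \<le> (LINT \<xi>|lborel. norm (\<psi> \<xi> * exp (2 * of_real pi * \<i> * of_real \<xi> * z)))"
      unfolding fourier_laplace_def by (rule integral_norm_bound)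
    also have "\<dots> \<le> (LINT \<xi>|lborel. E * ((1 + \<bar>s + \<xi>\<bar>) ^ p * exp (- a * (s + \<xi>)\<^sup>2)))"
    proof (rule integral_mono)
      show "integrable lborel (\<lambda>\<xi>. norm (\<psi> \<xi> * exp (2 * of_real pi * \<i> * of_real \<xi> * z)))"
        by (intro integrable_norm integrable_fourier_laplace[OF m a bd])
      fix \<xi> :: real
      have e: "- a * \<xi>\<^sup>2 - 2 * pi * \<xi> * y = - a * (s + \<xi>)\<^sup>2 + pi\<^sup>2 / a * y\<^sup>2"
        using a by (simp add: s_def power2_eq_square field_simps)
      have "1 + \<bar>\<xi>\<bar> \<le> (1 + \<bar>s\<bar>) * (1 + \<bar>s + \<xi>\<bar>)"
      proof -
        have "\<bar>\<xi>\<bar> \<le> \<bar>s\<bar> + \<bar>s + \<xi>\<bar>" by linarith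
        moreover have "0 \<le> \<bar>s\<bar> * \<bar>s + \<xi>\<bar>" by simp
        moreover have "(1 + \<bar>s\<bar>) * (1 + \<bar>s + \<xi>\<bar>) = 1 + \<bar>s\<bar> + \<bar>s + \<xi>\<bar> + \<bar>s\<bar> * \<bar>s + \<xi>\<bar>"
          by (simp add: distrib_left distrib_right)
        ultimately show ?thesis by linarith
      qed
      then have pw: "(1 + \<bar>\<xi>\<bar>) ^ p \<le> (1 + \<bar>s\<bar>) ^ p * (1 + \<bar>s + \<xi>\<bar>) ^ p"
        unfolding power_mult_distrib[symmetric] by (intro power_mono) auto
      have "norm (\<psi> \<xi> * exp (2 * of_real pi * \<i> * of_real \<xi> * z)) \<le> (D * (1 + \<bar>\<xi>\<bar>) ^ p * exp (- a * \<xi>\<^sup>2)) * exp (- (2 * pi * \<xi> * y))"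
        unfolding norm_mult norm_exp_fourier y_def by (intro mult_right_mono bd) auto
      also have "\<dots> = D * (1 + \<bar>\<xi>\<bar>) ^ p * exp (- a * \<xi>\<^sup>2 - 2 * pi * \<xi> * y)"
        by (simp add: exp_diff exp_minus field_simps)
      also have "\<dots> \<le> D * ((1 + \<bar>s\<bar>) ^ p * (1 + \<bar>s + \<xi>\<bar>) ^ p) * exp (- a * \<xi>\<^sup>2 - 2 * pi * \<xi> * y)"
        using D pw by (intro mult_right_mono mult_left_mono) auto
      also have "\<dots> = E * ((1 + \<bar>s + \<xi>\<bar>) ^ p * exp (- a * (s + \<xi>)\<^sup>2))"
        unfolding e by (simp only: E_def exp_add mult_ac)
      finally show "norm (\<psi> \<xi> * exp (2 * of_real pi * \<i> * of_real \<xi> * z)) \<le> E * ((1 + \<bar>s + \<xi>\<bar>) ^ p * exp (- a * (s + \<xi>)\<^sup>2))" .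
    qed (rule Iint)
    also have "\<dots> = E * I"
      unfolding I_def using lborel_integral_real_affine[of 1 "\<lambda>v. (1 + \<bar>v\<bar>) ^ p * exp (- a * v\<^sup>2)" s] by simp
    also have "\<dots> \<le> (D * ((1 + pi / a) ^ p * (1 + \<bar>y\<bar>) ^ p) * exp (pi\<^sup>2 / a * y\<^sup>2)) * I"
    proof -
      have "1 + \<bar>s\<bar> \<le> (1 + pi / a) * (1 + \<bar>y\<bar>)"
        using a by (simp add: s_def abs_mult distrib_left distrib_right)
      then have "(1 + \<bar>s\<bar>) ^ p \<le> (1 + pi / a) ^ p * (1 + \<bar>y\<bar>) ^ p"
        unfolding power_mult_distrib[symmetric] by (intro power_mono) auto
      then show ?thesis unfolding E_def using D I0 by (intro mult_right_mono mult_left_mono) auto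
    qed
    also have "\<dots> = C * (1 + \<bar>y\<bar>) ^ p * exp (pi\<^sup>2 / a * y\<^sup>2)" by (simp add: C_def)
    finally show ?thesis by (simp add: y_def)
  qed
  show ?thesis
  proof (rule that[of "C + 1"])
    fix z
    have "C * (1 + \<bar>Im z\<bar>) ^ p * exp (pi\<^sup>2 / a * (Im z)\<^sup>2) \<le> (C + 1) * (1 + \<bar>Im z\<bar>) ^ p * exp (pi\<^sup>2 / a * (Im z)\<^sup>2)"
      by (intro mult_right_mono) auto
    then show "norm (fourier_laplace \<psi> z) \<le> (C + 1) * (1 + \<bar>Im z\<bar>) ^ p * exp (pi\<^sup>2 / a * (Im z)\<^sup>2)"
      using main[of z] by linarith
  qed (use C0 in auto)
qed

text \<open>\<open>K\<close> and the angle \<open>\<theta>0\<close> with \<open>sin \<theta>0 = a / pi\<close> are chosen such that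
  \<open>\<Phi> z * exp ((a + \<i> * K) * z\<^sup>2)\<close> is bounded on the ray at angle \<open>\<theta>0\<close>. What matters below is
  that \<open>K < pi\<close>.\<close>
lemma gaussian_sector_bound:
  fixes \<Phi> :: "complex \<Rightarrow> complex"
  assumes hol: "\<Phi> holomorphic_on UNIV" and a: "0 < a" "a < pi" and C: "C > 0"
    and im: "\<And>z. norm (\<Phi> z) \<le> C * exp (pi\<^sup>2 / a * (Im z)\<^sup>2)"
    and re: "\<And>x. norm (\<Phi> (of_real x)) \<le> C * exp (- a * x\<^sup>2)"
  defines "K \<equiv> sqrt (pi\<^sup>2 - a\<^sup>2)"
  shows "norm (\<Phi> z) \<le> C * exp (pi\<^sup>2 / a + a + K) * exp (- a * (Re z)\<^sup>2 + 2 * K * \<bar>Re z\<bar> * \<bar>Im z\<bar> + (pi\<^sup>2 / a + K\<^sup>2 / a) * (Im z)\<^sup>2)"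
proof -
  have a2: "a\<^sup>2 < pi\<^sup>2" using a by (intro power_strict_mono) auto
  have K: "K > 0" "K\<^sup>2 = pi\<^sup>2 - a\<^sup>2" using a2 by (auto simp: K_def)
  define B where "B = pi\<^sup>2 / a"
  have aB: "a \<le> B" "B > 0" using a a2 by (auto simp: B_def field_simps power2_eq_square)
  define C2 where "C2 = C * exp (B + a + K)"
  have C2: "C2 > 0" "C \<le> C2" using C a K aB by (auto simp: C2_def intro!: mult_left_le_imp_le[of 1] )
  define \<theta>0 where "\<theta>0 = arctan (a / K)"
  have sq: "sqrt (1 + (a / K)\<^sup>2) = pi / K"
  proof -
    have "1 + (a / K)\<^sup>2 = (pi / K)\<^sup>2" using K by (simp add: power_divide field_simps)
    then show ?thesis using K by (simp add: real_sqrt_unique)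
  qed
  have \<theta>0: "sin \<theta>0 = a / pi" "cos \<theta>0 = K / pi" "0 < \<theta>0" "\<theta>0 < pi / 2"
    unfolding \<theta>0_def using a K arctan_bounded[of "a / K"] by (auto simp: sin_arctan cos_arctan sq)
  \<comment> \<open>With \<open>u = tan \<theta>\<close> the exponent vanishes if
    \<open>(B - a) * u\<^sup>2 - 2 * K * u + a = 0\<close>. Since
    \<open>K\<^sup>2 = a * (B - a)\<close>, the discriminant is 0: \<open>K\<close> is the smallest
    value for which such a ray exists, and \<open>tan \<theta>0 = a / K\<close> is the double
    root.\<close>
  have edge: "B * (sin \<theta>0)\<^sup>2 + a * cos (2 * \<theta>0) - K * sin (2 * \<theta>0) = 0"
  proof -
    have 1: "B * (sin \<theta>0)\<^sup>2 = a" using a by (simp add: B_def \<theta>0 power2_eq_square)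
    have 2: "a * cos (2 * \<theta>0) = a * ((pi\<^sup>2 - 2 * a\<^sup>2) / pi\<^sup>2)"
      by (simp add: cos_double \<theta>0 power_divide K(2) diff_divide_distrib)
    have "K * sin (2 * \<theta>0) = 2 * a * (K\<^sup>2 / pi\<^sup>2)" by (simp add: sin_double \<theta>0 power2_eq_square)
    also have "\<dots> = a * ((2 * pi\<^sup>2 - 2 * a\<^sup>2) / pi\<^sup>2)" unfolding K(2) by simp
    finally have 3: "K * sin (2 * \<theta>0) = a * ((2 * pi\<^sup>2 - 2 * a\<^sup>2) / pi\<^sup>2)" .
    show ?thesis unfolding 1 2 3 by (simp add: diff_divide_distrib right_diff_distrib)
  qed
  \<comment> \<open>Proved for a general \<open>\<Psi>\<close>, because it is applied to
    \<open>\<Phi>\<close> and to its reflection \<open>\<Phi> (- z)\<close>, which covers the left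
    half plane. The sign \<open>\<sigma>\<close> below selects the sector above or below the real
    axis.\<close>
  have sector: "norm (\<Psi> (of_real r * cis \<theta>)) \<le> C2 * exp (- r\<^sup>2 * (a * cos (2 * \<theta>) - K * \<bar>sin (2 * \<theta>)\<bar>))"
    if \<Psi>hol: "\<Psi> holomorphic_on UNIV" and \<Psi>im: "\<And>z. norm (\<Psi> z) \<le> C * exp (B * (Im z)\<^sup>2)"
      and \<Psi>re: "\<And>x. norm (\<Psi> (of_real x)) \<le> C * exp (- a * x\<^sup>2)" and r: "r \<ge> 1" and \<theta>: "\<bar>\<theta>\<bar> \<le> \<theta>0"
    for \<Psi> :: "complex \<Rightarrow> complex" and r \<theta>
  proof -
    define \<sigma> :: real where "\<sigma> = (if \<theta> \<ge> 0 then 1 else - 1)"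
    define h where "h z = \<Psi> z * exp ((of_real a + \<i> * of_real (\<sigma> * K)) * z\<^sup>2)" for z
    have hnorm: "norm (h (of_real r * cis \<theta>)) = norm (\<Psi> (of_real r * cis \<theta>)) * exp (r\<^sup>2 * (a * cos (2 * \<theta>) - \<sigma> * K * sin (2 * \<theta>)))" for r \<theta>
      by (simp add: h_def norm_mult norm_exp_eq_Re power_mult_distrib Complex.DeMoivre algebra_simps)
    have imr: "norm (\<Psi> (of_real r * cis \<theta>)) \<le> C * exp (B * (r\<^sup>2 * (sin \<theta>)\<^sup>2))" for r \<theta>
      using \<Psi>im[of "of_real r * cis \<theta>"] by (simp add: power_mult_distrib)
    have \<sigma>: "\<sigma> = 1 \<or> \<sigma> = - 1" by (simp add: \<sigma>_def)
    have hedge: "norm (h (of_real r * cis (\<sigma> * \<theta>0))) \<le> C" for r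
    proof -
      have "norm (h (of_real r * cis (\<sigma> * \<theta>0))) \<le> C * exp (B * (r\<^sup>2 * (sin \<theta>0)\<^sup>2)) * exp (r\<^sup>2 * (a * cos (2 * \<theta>0) - K * sin (2 * \<theta>0)))"
        unfolding hnorm using imr[of r "\<sigma> * \<theta>0"] \<sigma> by auto
      also have "\<dots> = C * exp (r\<^sup>2 * (B * (sin \<theta>0)\<^sup>2 + a * cos (2 * \<theta>0) - K * sin (2 * \<theta>0)))"
        by (simp add: exp_add[symmetric] algebra_simps)
      finally show ?thesis unfolding edge by simp
    qed
    have hre: "norm (h (of_real r * cis 0)) \<le> C" for r
      using mult_right_mono[OF \<Psi>re[of r], of "exp (r\<^sup>2 * a)"] unfolding hnorm by (simp add: exp_minus field_simps)
    have crude: "a * cos (2 * \<theta>) - \<sigma> * K * sin (2 * \<theta>) \<le> a + K" for \<theta>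
    proof -
      have "a * cos (2 * \<theta>) \<le> a * 1" using a by (intro mult_left_mono) auto
      moreover have "K * (- (\<sigma> * sin (2 * \<theta>))) \<le> K * 1" using K \<sigma> abs_sin_le_one[of "2 * \<theta>"]
        by (intro mult_left_mono) (auto simp: abs_le_iff)
      ultimately show ?thesis by (simp add: mult_ac)
    qed
    have hgr: "norm (h (of_real r * cis \<theta>)) \<le> C * exp (r\<^sup>2 * (B + a + K))" for r \<theta>
    proof -
      have "B * (r\<^sup>2 * (sin \<theta>)\<^sup>2) \<le> B * (r\<^sup>2 * 1)"
        using aB abs_square_le_1[of "sin \<theta>"] by (intro mult_left_mono) auto
      then have "norm (\<Psi> (of_real r * cis \<theta>)) \<le> C * exp (B * r\<^sup>2)"
        using imr[of r \<theta>] C by (elim order_trans) (auto intro!: mult_left_mono)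
      then have "norm (h (of_real r * cis \<theta>)) \<le> C * exp (B * r\<^sup>2) * exp (r\<^sup>2 * (a + K))"
        unfolding hnorm using C crude by (intro mult_mono) (auto intro: mult_left_mono)
      then show ?thesis by (simp add: exp_add[symmetric] algebra_simps)
    qed
    have hhol: "h holomorphic_on UNIV" unfolding h_def[abs_def] by (intro holomorphic_intros \<Psi>hol)
    have growth: "norm (h z) \<le> exp ((C + B + a + K) * (1 + (norm z)\<^sup>2))" for z
    proof -
      have "norm (h z) \<le> C * exp ((norm z)\<^sup>2 * (B + a + K))"
        using hgr[of "norm z" "Arg z"] rcis_cmod_Arg[of z] by (simp add: rcis_def)
      also have "\<dots> \<le> exp C * exp ((norm z)\<^sup>2 * (B + a + K))"
        using self_le_exp[of C] by (intro mult_right_mono) auto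
      also have "\<dots> \<le> exp ((C + B + a + K) * (1 + (norm z)\<^sup>2))"
        using C aB a K by (simp add: exp_add[symmetric] algebra_simps)
      finally show ?thesis .
    qed
    have arc: "norm (h (cis \<theta>)) \<le> C2" for \<theta> using hgr[of 1 \<theta>] by (simp add: C2_def)
    have "norm (h (of_real r * cis \<theta>)) \<le> C2 * r ^ 0"
    proof (cases "\<theta> \<ge> 0")
      case True
      then have s: "\<sigma> = 1" by (simp add: \<sigma>_def)
      show ?thesis
        by (rule phragmen_lindelof_sector[where \<alpha>=0 and \<beta>=\<theta>0, OF hhol _ _ growth C2(1)])
           (use \<theta>0 True \<theta> r hre hedge C2 arc s in \<open>auto intro: order_trans\<close>)
    next
      case False
      then have s: "\<sigma> = - 1" by (simp add: \<sigma>_def)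
      show ?thesis
        by (rule phragmen_lindelof_sector[where \<alpha>="- \<theta>0" and \<beta>=0, OF hhol _ _ growth C2(1)])
           (use \<theta>0 False \<theta> r hre hedge C2 arc s in \<open>auto intro: order_trans\<close>)
    qed
    then have le: "norm (\<Psi> (of_real r * cis \<theta>)) * exp (r\<^sup>2 * (a * cos (2 * \<theta>) - \<sigma> * K * sin (2 * \<theta>))) \<le> C2"
      unfolding hnorm by simp
    have "\<sigma> * sin (2 * \<theta>) = \<bar>sin (2 * \<theta>)\<bar>"
    proof (cases "\<theta> \<ge> 0")
      case True
      then have "sin (2 * \<theta>) \<ge> 0" using \<theta> \<theta>0 by (intro sin_ge_zero) auto
      then show ?thesis using True by (simp add: \<sigma>_def)
    next
      case False
      then have "sin (2 * (- \<theta>)) \<ge> 0" using \<theta> \<theta>0 by (intro sin_ge_zero) auto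
      then show ?thesis using False by (simp add: \<sigma>_def)
    qed
    then have s: "\<sigma> * K * sin (2 * \<theta>) = K * \<bar>sin (2 * \<theta>)\<bar>" by (simp add: mult_ac)
    show ?thesis using le_mult_exp_minus[OF le[unfolded s]] by simp
  qed
  define x y where "x = Re z" and "y = Im z"
  have z: "z = Complex x y" by (simp add: x_def y_def)
  let ?E = "- a * x\<^sup>2 + 2 * K * \<bar>x\<bar> * \<bar>y\<bar> + (B + K\<^sup>2 / a) * y\<^sup>2"
  have imz: "norm (\<Phi> z) \<le> C * exp (B * y\<^sup>2)" using im[of z] by (simp add: B_def y_def)
  have "norm (\<Phi> z) \<le> C2 * exp ?E"
  proof (cases "K * \<bar>y\<bar> \<ge> a * \<bar>x\<bar>")
    \<comment> \<open>Outside the sectors the bound in terms of \<open>Im z\<close> alone is strong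
      enough: there \<open>K\<^sup>2 / a * y\<^sup>2\<close> compensates
      \<open>- a * x\<^sup>2\<close>, which is why this term appears in the claim.\<close>
    case True
    then have "(a * \<bar>x\<bar>)\<^sup>2 \<le> (K * \<bar>y\<bar>)\<^sup>2" using a by (intro power_mono) auto
    then have "a * x\<^sup>2 \<le> K\<^sup>2 / a * y\<^sup>2" using a by (simp add: field_simps power_mult_distrib power2_eq_square)
    moreover have "0 \<le> 2 * K * \<bar>x\<bar> * \<bar>y\<bar>" using K by simp
    ultimately have "B * y\<^sup>2 \<le> ?E" by (simp add: distrib_right)
    then have "C * exp (B * y\<^sup>2) \<le> C2 * exp ?E" using C C2 by (intro mult_mono) auto
    then show ?thesis using imz by linarith
  next
    case False
    show ?thesis
    proof (cases "norm z \<ge> 1")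
      \<comment> \<open>The sector bound starts at radius 1. In the unit disc the factor
        \<open>exp (B + a + K)\<close> of the constant outweighs all exponents involved.\<close>
      case big: False
      then have "(norm z)\<^sup>2 \<le> 1" by (simp add: power_le_one)
      then have xy: "x\<^sup>2 + y\<^sup>2 \<le> 1" by (simp add: z cmod_power2)
      have "B * y\<^sup>2 \<le> B * 1" using aB xy by (intro mult_left_mono) (auto intro: order_trans[of _ "x\<^sup>2 + y\<^sup>2"])
      moreover have "a * x\<^sup>2 \<le> a * 1" using a xy by (intro mult_left_mono) (auto intro: order_trans[of _ "x\<^sup>2 + y\<^sup>2"])
      moreover have "0 \<le> 2 * K * \<bar>x\<bar> * \<bar>y\<bar>" "0 \<le> (B + K\<^sup>2 / a) * y\<^sup>2" using K aB a by auto
      ultimately have "B * y\<^sup>2 \<le> (B + a + K) + ?E" using K by linarith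
      then have "C * exp (B * y\<^sup>2) \<le> C * exp ((B + a + K) + ?E)" using C by (intro mult_left_mono) auto
      then show ?thesis using imz by (simp add: C2_def exp_add)
    next
      case True
      have x0: "x \<noteq> 0" using False K by auto
      define \<theta> where "\<theta> = arctan (y / x)"
      define r where "r = norm z"
      have rr: "r = sqrt (x\<^sup>2 + y\<^sup>2)" by (simp add: r_def z cmod_def)
      have "\<bar>y / x\<bar> \<le> a / K" using False K x0 by (simp add: field_simps)
      then have "\<bar>\<theta>\<bar> \<le> \<theta>0" unfolding \<theta>_def \<theta>0_def
        by (metis abs_arctan arctan_le_iff)
      have s1: "sqrt (1 + (y / x)\<^sup>2) = r / \<bar>x\<bar>"
      proof -
        have "1 + (y / x)\<^sup>2 = (x\<^sup>2 + y\<^sup>2) / x\<^sup>2" using x0 by (simp add: power_divide field_simps)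
        then show ?thesis by (simp add: rr real_sqrt_divide)
      qed
      have r0: "r > 0" using True r_def by linarith
      have cs: "r * cos \<theta> = \<bar>x\<bar>" "r * sin \<theta> = y / x * \<bar>x\<bar>"
        unfolding \<theta>_def cos_arctan sin_arctan s1 using r0 x0 by auto
      have "r\<^sup>2 * cos (2 * \<theta>) = (r * cos \<theta>)\<^sup>2 - (r * sin \<theta>)\<^sup>2" by (simp add: cos_double power_mult_distrib right_diff_distrib)
      also have "\<dots> = x\<^sup>2 - y\<^sup>2" unfolding cs using x0 by (simp add: power_mult_distrib power_divide)
      finally have c2: "r\<^sup>2 * cos (2 * \<theta>) = x\<^sup>2 - y\<^sup>2" .
      have "r\<^sup>2 * \<bar>sin (2 * \<theta>)\<bar> = \<bar>2 * (r * sin \<theta>) * (r * cos \<theta>)\<bar>"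
        by (simp add: sin_double abs_mult power2_eq_square)
      also have "\<dots> = 2 * \<bar>x\<bar> * \<bar>y\<bar>" unfolding cs using x0 by (simp add: abs_mult)
      finally have s2: "r\<^sup>2 * \<bar>sin (2 * \<theta>)\<bar> = 2 * \<bar>x\<bar> * \<bar>y\<bar>" .
      have ee: "- r\<^sup>2 * (a * cos (2 * \<theta>) - K * \<bar>sin (2 * \<theta>)\<bar>) = - a * (r\<^sup>2 * cos (2 * \<theta>)) + K * (r\<^sup>2 * \<bar>sin (2 * \<theta>)\<bar>)"
        by (simp add: algebra_simps)
      have "norm (\<Phi> z) \<le> C2 * exp (- r\<^sup>2 * (a * cos (2 * \<theta>) - K * \<bar>sin (2 * \<theta>)\<bar>))"
      proof (cases "x > 0")
        case pos: True
        have "z = of_real r * cis \<theta>" using cs pos by (simp add: complex_eq_iff z)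
        then show ?thesis
          using sector[OF hol _ re, of r \<theta>] im True \<open>\<bar>\<theta>\<bar> \<le> \<theta>0\<close> by (simp add: r_def B_def)
      next
        case neg: False
        have "z = - (of_real r * cis \<theta>)" using cs neg x0 by (simp add: complex_eq_iff z)
        moreover have "(\<Phi> \<circ> (\<lambda>z. - z)) holomorphic_on UNIV"
          by (intro holomorphic_on_compose holomorphic_intros holomorphic_on_subset[OF hol]) auto
        then have "(\<lambda>z. \<Phi> (- z)) holomorphic_on UNIV" by (simp add: o_def)
        ultimately show ?thesis
          using sector[of "\<lambda>z. \<Phi> (- z)" r \<theta>] im[of "- _"] re[of "- _"] True \<open>\<bar>\<theta>\<bar> \<le> \<theta>0\<close> by (simp add: r_def B_def)
      qed
      also have "\<dots> \<le> C2 * exp ?E"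
        unfolding ee c2 s2
      proof (intro mult_left_mono exp_mono)
        have "a * y\<^sup>2 \<le> (B + K\<^sup>2 / a) * y\<^sup>2" using aB a by (intro mult_right_mono) (auto intro: add_increasing2)
        then show "- a * (x\<^sup>2 - y\<^sup>2) + K * (2 * \<bar>x\<bar> * \<bar>y\<bar>) \<le> ?E" by (simp add: algebra_simps)
      qed (use C2 in auto)
      finally show ?thesis .
    qed
  qed
  then show ?thesis by (simp add: C2_def B_def x_def y_def)
qed

section \<open>Frequency localisation by shifting the contour\<close>

text \<open>An entire function has a primitive \<open>P\<close>, so integrals over horizontal
  segments are differences of values of \<open>P\<close>. The vertical sides contribute nothing in
  the limit, because the Gaussian bound is uniform in the strip swept by the shift.\<close>

lemma contour_shift:
  fixes g :: "complex \<Rightarrow> complex"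
  assumes hol: "g holomorphic_on UNIV"
    and bd: "\<And>x t. \<bar>t\<bar> \<le> \<bar>Y\<bar> \<Longrightarrow> norm (g (Complex x t)) \<le> D * exp (- (1 / 2) * (x - x0)\<^sup>2)"
  shows "(LINT x|lborel. g (Complex x Y)) = (LINT x|lborel. g (Complex x 0))"
proof -
  obtain P where P: "\<And>z. (P has_field_derivative g z) (at z)"
    using holomorphic_convex_primitive'[OF convex_UNIV open_UNIV hol] by auto
  have D: "D \<ge> 0"
    using order_trans[OF norm_ge_zero bd[of 0 x0]] by simp
  have gm: "continuous_on UNIV (\<lambda>x. g (Complex x t))" for t
  proof -
    have "continuous_on UNIV (g \<circ> (\<lambda>x. Complex x t))"
      by (intro continuous_on_compose continuous_on_subset[OF holomorphic_on_imp_continuous_on[OF hol]])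
         (auto simp: Complex_eq intro!: continuous_intros)
    then show ?thesis by (simp add: o_def)
  qed
  have int: "integrable lborel (\<lambda>x. g (Complex x t))" if "\<bar>t\<bar> \<le> \<bar>Y\<bar>" for t
  proof (rule Bochner_Integration.integrable_bound)
    show "integrable lborel (\<lambda>x. D * exp (- (1 / 2) * (x - x0)\<^sup>2))"
      using gaussian_integral(1)[of "1/2" x0] by simp
    show "AE x in lborel. norm (g (Complex x t)) \<le> norm (D * exp (- (1 / 2) * (x - x0)\<^sup>2))"
      using bd[OF that] D by (intro AE_I2) simp
    show "(\<lambda>x. g (Complex x t)) \<in> borel_measurable lborel"
      using borel_measurable_continuous_onI[OF gm] by simp
  qed
  have FTC: "(LINT x|lborel. indicator {- real n..real n} x *\<^sub>R g (Complex x t)) = P (Complex (real n) t) - P (Complex (- real n) t)" for n t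
  proof -
    have "((\<lambda>x. P (Complex x t)) has_vector_derivative g (Complex x t)) (at x within {- real n..real n})" for x
    proof -
      have "((\<lambda>x. Complex x t) has_vector_derivative 1) (at x within {- real n..real n})"
        unfolding Complex_eq has_vector_derivative_def
        by (auto intro!: derivative_eq_intros simp: scaleR_conv_of_real)
      from field_vector_diff_chain_within[OF this has_field_derivative_at_within[OF P]]
      show ?thesis by (simp add: o_def)
    qed
    then show ?thesis
      by (intro integral_FTC_atLeastAtMost continuous_on_subset[OF gm]) auto
  qed
  have lim: "(\<lambda>n. P (Complex (real n) t) - P (Complex (- real n) t)) \<longlonglongrightarrow> (LINT x|lborel. g (Complex x t))" if "\<bar>t\<bar> \<le> \<bar>Y\<bar>" for t
    unfolding FTC[symmetric]
  proof (rule integral_dominated_convergence[where w="\<lambda>x. norm (g (Complex x t))"])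
    show "AE x in lborel. (\<lambda>n. indicator {- real n..real n} x *\<^sub>R g (Complex x t)) \<longlonglongrightarrow> g (Complex x t)"
    proof (rule AE_I2)
      fix x :: real
      obtain N :: nat where "\<bar>x\<bar> \<le> N" using real_arch_simple by blast
      then have "\<forall>n\<ge>N. indicator {- real n..real n} x *\<^sub>R g (Complex x t) = g (Complex x t)"
        by (auto simp: indicator_def abs_le_iff)
      then show "(\<lambda>n. indicator {- real n..real n} x *\<^sub>R g (Complex x t)) \<longlonglongrightarrow> g (Complex x t)"
        by (intro tendsto_eventually) (auto simp: eventually_sequentially)
    qed
    show "AE x in lborel. norm (indicator {- real n..real n} x *\<^sub>R g (Complex x t)) \<le> norm (g (Complex x t))" for n
      by (rule AE_I2) (auto simp: indicator_def)
  qed (use int[OF that] in \<open>auto intro!: borel_measurable_scaleR\<close>)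
  have vert: "norm (P (Complex x Y) - P (Complex x 0)) \<le> D * exp (- (1 / 2) * (x - x0)\<^sup>2) * \<bar>Y\<bar>" for x
  proof -
    have "norm (P (Complex x Y) - P (Complex x 0)) \<le> D * exp (- (1 / 2) * (x - x0)\<^sup>2) * norm (Complex x Y - Complex x 0)"
    proof (rule field_differentiable_bound[of "closed_segment (Complex x 0) (Complex x Y)"])
      fix w assume "w \<in> closed_segment (Complex x 0) (Complex x Y)"
      then obtain u where u: "0 \<le> u" "u \<le> 1" "w = (1 - u) *\<^sub>R Complex x 0 + u *\<^sub>R Complex x Y"
        unfolding closed_segment_def by auto
      then have w: "w = Complex x (u * Y)" by (simp add: complex_eq_iff algebra_simps)
      show "norm (g w) \<le> D * exp (- (1 / 2) * (x - x0)\<^sup>2)"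
        unfolding w using u by (intro bd) (simp add: abs_mult mult_left_le_one_le)
    qed (auto intro: has_field_derivative_at_within P)
    also have "norm (Complex x Y - Complex x 0) = \<bar>Y\<bar>" by (simp add: complex_diff cmod_def)
    finally show ?thesis .
  qed
  have z1: "(\<lambda>n. P (Complex (real n) Y) - P (Complex (real n) 0)) \<longlonglongrightarrow> 0"
  proof (rule Lim_null_comparison)
    show "\<forall>\<^sub>F n in sequentially. norm (P (Complex (real n) Y) - P (Complex (real n) 0)) \<le> D * exp (- (1 / 2) * (real n - x0)\<^sup>2) * \<bar>Y\<bar>"
      using vert by simp
    have "(\<lambda>n. exp (- (1 / 2) * (real n - x0)\<^sup>2)) \<longlonglongrightarrow> 0" by real_asymp
    then show "(\<lambda>n. D * exp (- (1 / 2) * (real n - x0)\<^sup>2) * \<bar>Y\<bar>) \<longlonglongrightarrow> 0"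
      by (intro tendsto_mult_left_zero tendsto_mult_right_zero)
  qed
  have z2: "(\<lambda>n. P (Complex (- real n) Y) - P (Complex (- real n) 0)) \<longlonglongrightarrow> 0"
  proof (rule Lim_null_comparison)
    show "\<forall>\<^sub>F n in sequentially. norm (P (Complex (- real n) Y) - P (Complex (- real n) 0)) \<le> D * exp (- (1 / 2) * (- real n - x0)\<^sup>2) * \<bar>Y\<bar>"
      using vert by simp
    have "(\<lambda>n. exp (- (1 / 2) * (- real n - x0)\<^sup>2)) \<longlonglongrightarrow> 0" by real_asymp
    then show "(\<lambda>n. D * exp (- (1 / 2) * (- real n - x0)\<^sup>2) * \<bar>Y\<bar>) \<longlonglongrightarrow> 0"
      by (intro tendsto_mult_left_zero tendsto_mult_right_zero)
  qed
  have "(\<lambda>n. (P (Complex (real n) Y) - P (Complex (real n) 0)) - (P (Complex (- real n) Y) - P (Complex (- real n) 0))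
      + (P (Complex (real n) 0) - P (Complex (- real n) 0))) \<longlonglongrightarrow> 0 - 0 + (LINT x|lborel. g (Complex x 0))"
    using lim[of 0] by (intro tendsto_add tendsto_diff z1 z2) auto
  then have "(\<lambda>n. P (Complex (real n) Y) - P (Complex (- real n) Y)) \<longlonglongrightarrow> (LINT x|lborel. g (Complex x 0))" by simp
  then show ?thesis using lim[of Y] LIMSEQ_unique by auto
qed

text \<open>The contour is shifted by an amount proportional to \<open>\<xi>\<close>, namely by
  \<open>(pi - K) / B * \<bar>\<xi>\<bar>\<close>.\<close>
lemma shifted_fourier_bound:
  fixes k :: "complex \<Rightarrow> complex"
  assumes hol: "k holomorphic_on UNIV" and C: "C \<ge> 0" and K: "0 \<le> K" "K < pi" and B: "B > 0" and X: "X \<ge> 0"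
    and bd: "\<And>x y. norm (k (Complex x y)) \<le> C * exp (L + 2 * K * X * \<bar>y\<bar> + B * y\<^sup>2 - (1 / 2) * (x - x0)\<^sup>2)"
  defines "\<delta> \<equiv> (pi - K)\<^sup>2 / (2 * B)"
  assumes L: "L \<le> \<delta> * X\<^sup>2" and \<xi>: "\<bar>\<xi>\<bar> \<ge> X"
  shows "norm (fourier (\<lambda>x. k (of_real x)) \<xi>) \<le> C * sqrt (2 * pi) * exp (- \<delta> * \<xi>\<^sup>2)"
proof -
  \<comment> \<open>For \<open>Y = - \<tau> * \<xi>\<close> and
    \<open>X \<le> \<bar>\<xi>\<bar>\<close> the exponent changes by at most
    \<open>(B * \<tau>\<^sup>2 - 2 * (pi - K) * \<tau>) * \<xi>\<^sup>2\<close>. This is minimal at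
    the chosen \<open>\<tau>\<close>, with value \<open>- 2 * \<delta> * \<xi>\<^sup>2\<close>. One
    \<open>\<delta>\<close> pays for \<open>L\<close>, the other remains as decay.\<close>
  define \<tau> where "\<tau> = (pi - K) / B"
  have \<tau>: "\<tau> > 0" using K B by (simp add: \<tau>_def)
  have \<delta>1: "B * \<tau>\<^sup>2 = 2 * \<delta>" "(pi - K) * \<tau> = 2 * \<delta>"
    using B by (simp_all add: \<tau>_def \<delta>_def power2_eq_square)
  define Y where "Y = - \<tau> * \<xi>"
  have Yabs: "\<bar>Y\<bar> = \<tau> * \<bar>\<xi>\<bar>" using \<tau> by (simp add: Y_def abs_mult)
  define g where "g z = k z * exp (- (2 * of_real pi * \<i> * of_real \<xi> * z))" for z
  have ghol: "g holomorphic_on UNIV" unfolding g_def[abs_def] by (intro holomorphic_intros hol)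
  have gnorm: "norm (g (Complex x t)) = norm (k (Complex x t)) * exp (2 * pi * \<xi> * t)" for x t
    by (simp add: g_def norm_mult norm_exp_eq_Re mult.assoc)
  have gb: "norm (g (Complex x t)) \<le> C * exp (L + 2 * K * X * \<bar>t\<bar> + B * t\<^sup>2 + 2 * pi * \<xi> * t) * exp (- (1 / 2) * (x - x0)\<^sup>2)" for x t
  proof -
    have "norm (g (Complex x t)) \<le> C * exp (L + 2 * K * X * \<bar>t\<bar> + B * t\<^sup>2 - (1 / 2) * (x - x0)\<^sup>2) * exp (2 * pi * \<xi> * t)"
      unfolding gnorm by (intro mult_right_mono bd) auto
    also have "\<dots> = C * exp (L + 2 * K * X * \<bar>t\<bar> + B * t\<^sup>2 + 2 * pi * \<xi> * t) * exp (- (1 / 2) * (x - x0)\<^sup>2)"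
      by (simp add: exp_add[symmetric] mult.assoc algebra_simps)
    finally show ?thesis .
  qed
  have "fourier (\<lambda>x. k (of_real x)) \<xi> = (LINT x|lborel. g (Complex x 0))"
    unfolding fourier_def g_def
    by (intro Bochner_Integration.integral_cong refl) (simp add: complex_of_real_def[symmetric] mult_ac)
  also have "\<dots> = (LINT x|lborel. g (Complex x Y))"
  proof (rule contour_shift[symmetric, OF ghol])
    fix x t :: real assume t: "\<bar>t\<bar> \<le> \<bar>Y\<bar>"
    have "\<xi> * t \<le> \<bar>\<xi>\<bar> * \<bar>Y\<bar>"
      using t by (metis abs_ge_self abs_ge_zero abs_mult mult_left_mono order_trans)
    then have "L + 2 * K * X * \<bar>t\<bar> + B * t\<^sup>2 + 2 * pi * (\<xi> * t) \<le> L + 2 * K * X * \<bar>Y\<bar> + B * Y\<^sup>2 + 2 * pi * (\<bar>\<xi>\<bar> * \<bar>Y\<bar>)"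
      using t K X B by (intro add_mono mult_left_mono) (auto intro: abs_le_square_iff[THEN iffD1])
    then have "C * exp (L + 2 * K * X * \<bar>t\<bar> + B * t\<^sup>2 + 2 * pi * \<xi> * t) \<le> C * exp (L + 2 * K * X * \<bar>Y\<bar> + B * Y\<^sup>2 + 2 * pi * (\<bar>\<xi>\<bar> * \<bar>Y\<bar>))"
      using C by (intro mult_left_mono) (auto simp: mult.assoc)
    then have "C * exp (L + 2 * K * X * \<bar>t\<bar> + B * t\<^sup>2 + 2 * pi * \<xi> * t) * exp (- (1 / 2) * (x - x0)\<^sup>2)
       \<le> C * exp (L + 2 * K * X * \<bar>Y\<bar> + B * Y\<^sup>2 + 2 * pi * (\<bar>\<xi>\<bar> * \<bar>Y\<bar>)) * exp (- (1 / 2) * (x - x0)\<^sup>2)"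
      by (rule mult_right_mono) auto
    then show "norm (g (Complex x t)) \<le> C * exp (L + 2 * K * X * \<bar>Y\<bar> + B * Y\<^sup>2 + 2 * pi * (\<bar>\<xi>\<bar> * \<bar>Y\<bar>)) * exp (- (1 / 2) * (x - x0)\<^sup>2)"
      using gb[of x t] by linarith
  qed
  finally have eq: "fourier (\<lambda>x. k (of_real x)) \<xi> = (LINT x|lborel. g (Complex x Y))" .
  have expo: "L + 2 * K * X * \<bar>Y\<bar> + B * Y\<^sup>2 + 2 * pi * \<xi> * Y \<le> - \<delta> * \<xi>\<^sup>2"
  proof -
    have "X\<^sup>2 \<le> \<xi>\<^sup>2" using \<xi> X by (intro abs_le_square_iff[THEN iffD1]) auto
    moreover have "\<delta> \<ge> 0" using B by (simp add: \<delta>_def)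
    ultimately have 1: "L \<le> \<delta> * \<xi>\<^sup>2" using L by (meson mult_left_mono order_trans)
    have "X * \<bar>\<xi>\<bar> \<le> \<bar>\<xi>\<bar> * \<bar>\<xi>\<bar>" using \<xi> by (intro mult_right_mono) auto
    then have "2 * K * \<tau> * (X * \<bar>\<xi>\<bar>) \<le> 2 * K * \<tau> * \<xi>\<^sup>2" using K \<tau> by (intro mult_left_mono) (auto simp: power2_eq_square)
    then have 2: "2 * K * X * \<bar>Y\<bar> \<le> 2 * K * \<tau> * \<xi>\<^sup>2" unfolding Yabs by (simp add: mult_ac)
    have 3: "B * Y\<^sup>2 = 2 * \<delta> * \<xi>\<^sup>2" using \<delta>1(1) by (simp add: Y_def power_mult_distrib)
    have 4: "2 * pi * \<xi> * Y = - (2 * pi * \<tau> * \<xi>\<^sup>2)" by (simp add: Y_def power2_eq_square)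
    have "2 * K * \<tau> * \<xi>\<^sup>2 - 2 * pi * \<tau> * \<xi>\<^sup>2 = - 2 * ((pi - K) * \<tau>) * \<xi>\<^sup>2" by (simp add: algebra_simps)
    then have "2 * K * \<tau> * \<xi>\<^sup>2 - 2 * pi * \<tau> * \<xi>\<^sup>2 = - 4 * (\<delta> * \<xi>\<^sup>2)" unfolding \<delta>1 by simp
    then show ?thesis using 1 2 3 4 by linarith
  qed
  have "norm (LINT x|lborel. g (Complex x Y)) \<le> (LINT x|lborel. C * exp (- \<delta> * \<xi>\<^sup>2) * exp (- (1 / 2) * (x - x0)\<^sup>2))"
  proof (rule order_trans[OF integral_norm_bound], rule integral_mono')
    show "integrable lborel (\<lambda>x. C * exp (- \<delta> * \<xi>\<^sup>2) * exp (- (1 / 2) * (x - x0)\<^sup>2))"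
      using gaussian_integral(1)[of "1/2" x0] by simp
    fix x :: real
    have "C * exp (L + 2 * K * X * \<bar>Y\<bar> + B * Y\<^sup>2 + 2 * pi * \<xi> * Y) * exp (- (1 / 2) * (x - x0)\<^sup>2) \<le> C * exp (- \<delta> * \<xi>\<^sup>2) * exp (- (1 / 2) * (x - x0)\<^sup>2)"
      using C expo by (intro mult_right_mono mult_left_mono) auto
    then show "norm (g (Complex x Y)) \<le> C * exp (- \<delta> * \<xi>\<^sup>2) * exp (- (1 / 2) * (x - x0)\<^sup>2)" using gb[of x Y] by linarith
  qed (use C in auto)
  also have "\<dots> = C * sqrt (2 * pi) * exp (- \<delta> * \<xi>\<^sup>2)"
    using gaussian_integral(2)[of "1/2" x0] by (simp add: mult.commute)
  finally show ?thesis unfolding eq .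
qed

text \<open>Near \<open>x0\<close> the entire function \<open>\<Phi> z * exp ((a + s) * z\<^sup>2 - (z - x0)\<^sup>2)\<close> has frequencies
  essentially below \<open>\<bar>x0\<bar>\<close> because \<open>K0 < pi\<close>, and it is polynomially bounded at the nodes, so that
  the sampling inequality bounds it at \<open>x0\<close>. The admissible \<open>s\<close> depend on \<open>a0\<close> only, so the step
  can be iterated.\<close>
lemma gaussian_step:
  fixes \<phi> \<psi> :: "real \<Rightarrow> complex"
  assumes \<gamma>: "0 < \<gamma>" "\<gamma> < 1" and \<eta>: "\<eta> > 0" and X: "X > 0" and samp: "sampling S \<gamma> \<eta> X"
    and a0: "0 < a0" "a0 \<le> a" "a < pi"
  defines "K0 \<equiv> sqrt (pi\<^sup>2 - a0\<^sup>2)"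
  defines "B3 \<equiv> 2 * pi\<^sup>2 / a0 + 1 + 4 * K0\<^sup>2"
  defines "\<delta> \<equiv> (pi - K0)\<^sup>2 / (2 * B3)"
  assumes s: "0 \<le> s" "s \<le> 1 / 8" "s \<le> \<eta>\<^sup>2 / 8" "2 * s \<le> \<delta>" "a + s \<le> pi"
    and \<psi>m: "\<psi> \<in> borel_measurable borel" and \<psi>: "\<And>\<xi>. norm (\<psi> \<xi>) \<le> C * exp (- a * \<xi>\<^sup>2)"
    and \<phi>: "\<And>x. norm (\<phi> x) \<le> C * exp (- a * x\<^sup>2)"
    and \<phi>\<psi>: "\<And>t. \<phi> t = fourier_laplace \<psi> (of_real t)"
    and S: "\<And>t. t \<in> S \<Longrightarrow> norm (\<phi> t) \<le> D * (1 + \<bar>t\<bar>) ^ N * exp (- pi * t\<^sup>2)"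
  shows "\<exists>C'. \<forall>x. norm (\<phi> x) \<le> C' * (1 + \<bar>x\<bar>) ^ (2 * N + 1) * exp (- (a + s) * x\<^sup>2)"
proof -
  have a: "0 < a" using a0 by simp
  define \<Phi> where "\<Phi> = fourier_laplace \<psi>"
  have \<psi>': "norm (\<psi> \<xi>) \<le> C * (1 + \<bar>\<xi>\<bar>) ^ 0 * exp (- a * \<xi>\<^sup>2)" for \<xi> using \<psi>[of \<xi>] by simp
  have hol: "\<Phi> holomorphic_on UNIV"
    unfolding \<Phi>_def holomorphic_on_def field_differentiable_def
    using fourier_laplace_has_field_derivative[OF \<psi>m a \<psi>'] has_field_derivative_at_within by blast
  obtain C1 where C1: "C1 > 0" "\<And>z. norm (\<Phi> z) \<le> C1 * (1 + \<bar>Im z\<bar>) ^ 0 * exp (pi\<^sup>2 / a * (Im z)\<^sup>2)"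
    using fourier_laplace_growth[OF \<psi>m a \<psi>'] unfolding \<Phi>_def by blast
  define C2 where "C2 = max C C1"
  have C2: "C2 > 0" "C \<le> C2" "C1 \<le> C2" using C1 by (auto simp: C2_def)
  define K where "K = sqrt (pi\<^sup>2 - a\<^sup>2)"
  have a2: "a\<^sup>2 < pi\<^sup>2" "a0\<^sup>2 \<le> a\<^sup>2" using a0 a by (auto intro: power_strict_mono power_mono)
  have K: "0 \<le> K" "K \<le> K0" "0 \<le> K0" "K\<^sup>2 = pi\<^sup>2 - a\<^sup>2" using a2 by (auto simp: K_def K0_def)
  have "K0\<^sup>2 < pi\<^sup>2" using a2 a0 by (simp add: K0_def)
  then have K0: "K0 < pi" using pi_gt_zero power2_less_imp_less by (meson less_imp_le)
  have B3: "B3 > 0" unfolding B3_def using a0 by (intro add_pos_nonneg) auto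
  have \<delta>: "\<delta> > 0" using K0 B3 by (simp add: \<delta>_def)
  define CC where "CC = C2 * exp (pi\<^sup>2 / a + a + K)"
  have CC: "CC > 0" using C2 by (simp add: CC_def)
  \<comment> \<open>Replacing \<open>a\<close> by \<open>a0\<close>, and later \<open>K\<close> by
    \<open>K0\<close>, makes \<open>\<delta>\<close> and thus the size of the step the same for all
    rates between \<open>a0\<close> and \<open>pi\<close>.\<close>
  have B0: "pi\<^sup>2 / a + K\<^sup>2 / a \<le> 2 * pi\<^sup>2 / a0"
  proof -
    have "pi\<^sup>2 / a + K\<^sup>2 / a = (2 * pi\<^sup>2 - a\<^sup>2) / a" unfolding K by (simp add: add_divide_distrib[symmetric])
    also have "\<dots> \<le> 2 * pi\<^sup>2 / a0" using a0 by (intro frac_le) auto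
    finally show ?thesis .
  qed
  have \<Phi>b: "norm (\<Phi> z) \<le> CC * exp (- a * (Re z)\<^sup>2 + 2 * K * \<bar>Re z\<bar> * \<bar>Im z\<bar> + (pi\<^sup>2 / a + K\<^sup>2 / a) * (Im z)\<^sup>2)" for z
    unfolding CC_def K_def
  proof (rule gaussian_sector_bound[OF hol a a0(3) C2(1)])
    fix z
    have "C1 * exp (pi\<^sup>2 / a * (Im z)\<^sup>2) \<le> C2 * exp (pi\<^sup>2 / a * (Im z)\<^sup>2)" using C2 by (intro mult_right_mono) auto
    moreover have "norm (\<Phi> z) \<le> C1 * exp (pi\<^sup>2 / a * (Im z)\<^sup>2)" using C1(2)[of z] by simp
    ultimately show "norm (\<Phi> z) \<le> C2 * exp (pi\<^sup>2 / a * (Im z)\<^sup>2)" by linarith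
  next
    fix x :: real
    have "C * exp (- a * x\<^sup>2) \<le> C2 * exp (- a * x\<^sup>2)" using C2 by (intro mult_right_mono) auto
    then show "norm (\<Phi> (of_real x)) \<le> C2 * exp (- a * x\<^sup>2)" using \<phi>[of x] unfolding \<phi>\<psi> \<Phi>_def by linarith
  qed
  define T where "T = (LINT \<xi>|lborel. (1 + \<bar>\<xi>\<bar>)\<^sup>2 * exp (- (2 * \<delta>) * \<xi>\<^sup>2)) * (CC * sqrt (2 * pi))\<^sup>2"
  have Tint: "integrable lborel (\<lambda>\<xi>. (1 + \<bar>\<xi>\<bar>)\<^sup>2 * exp (- (2 * \<delta>) * \<xi>\<^sup>2))"
    using integrable_gaussian_weight[of "2 * \<delta>" 2 0] \<delta> by simp
  have T0: "T \<ge> 0" unfolding T_def by (intro mult_nonneg_nonneg integral_nonneg_AE) auto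
  define F where "F = CC\<^sup>2 * sqrt (2 * pi)"
  have F0: "F \<ge> 0" by (simp add: F_def)
  define G where "G = 4 / cos (pi * sqrt \<gamma> / 2)"
  have G0: "G > 0"
  proof -
    have "pi * sqrt \<gamma> < pi" using \<gamma> by simp
    moreover have "pi * sqrt \<gamma> \<ge> 0" using \<gamma> by simp
    ultimately show ?thesis unfolding G_def using pi_gt_zero by (intro divide_pos_pos cos_gt_zero_pi) linarith+
  qed
  define H where "H = CC * sqrt (2 * pi) * sqrt (pi / \<delta>)"
  have H0: "H \<ge> 0" using CC \<delta> by (simp add: H_def)
  define X1 where "X1 = max X 1"
  \<comment> \<open>Bounds the total mass of the localised function: the near part after division by
    \<open>1 - \<gamma>\<close>, plus the far part, which is at most \<open>F\<close>.\<close>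
  define P where "P x0 = (F + T + G * x0 * (\<bar>D\<bar> * (1 + 2 * x0) ^ N)\<^sup>2) / (1 - \<gamma>) + F" for x0
  have big: "norm (\<phi> x0) * exp ((a + s) * x0\<^sup>2) \<le> 2 * \<bar>x0\<bar> + P \<bar>x0\<bar> + H" if x0: "\<bar>x0\<bar> \<ge> X1" for x0
  proof -
    have x01: "\<bar>x0\<bar> \<ge> X" "\<bar>x0\<bar> \<ge> 1" using x0 by (auto simp: X1_def)
    then have x0sq: "x0\<^sup>2 \<ge> 1" using abs_le_square_iff[of 1 x0] by simp
    \<comment> \<open>The first exponent cancels the decay known so far and asks for the surplus
      \<open>s\<close>. The second localises at \<open>x0\<close>; unlike a cutoff it is entire, so
      the contour can be shifted.\<close>
    define k where "k z = \<Phi> z * exp (of_real (a + s) * z\<^sup>2 - (z - of_real x0)\<^sup>2)" for z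
    have khol: "k holomorphic_on UNIV" unfolding k_def[abs_def] by (intro holomorphic_intros hol)
    have kb: "norm (k (Complex x y)) \<le> CC * exp (2 * s * x0\<^sup>2 + 2 * K0 * \<bar>x0\<bar> * \<bar>y\<bar> + B3 * y\<^sup>2 - (1 / 2) * (x - x0)\<^sup>2)" for x y
    proof -
      define v where "v = x - x0"
      have Re: "Re (of_real (a + s) * (Complex x y)\<^sup>2 - (Complex x y - of_real x0)\<^sup>2) = (a + s) * (x\<^sup>2 - y\<^sup>2) - (v\<^sup>2 - y\<^sup>2)"
        by (simp add: v_def power2_eq_square)
      have "norm (k (Complex x y)) \<le> CC * exp (- a * x\<^sup>2 + 2 * K * \<bar>x\<bar> * \<bar>y\<bar> + (pi\<^sup>2 / a + K\<^sup>2 / a) * y\<^sup>2) * exp ((a + s) * (x\<^sup>2 - y\<^sup>2) - (v\<^sup>2 - y\<^sup>2))"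
        unfolding k_def norm_mult norm_exp_eq_Re Re using \<Phi>b[of "Complex x y"] by (intro mult_right_mono) auto
      also have "\<dots> = CC * exp ((- a * x\<^sup>2 + 2 * K * \<bar>x\<bar> * \<bar>y\<bar> + (pi\<^sup>2 / a + K\<^sup>2 / a) * y\<^sup>2) + ((a + s) * (x\<^sup>2 - y\<^sup>2) - (v\<^sup>2 - y\<^sup>2)))"
        by (simp add: exp_add[symmetric] mult.assoc)
      \<comment> \<open>The localising \<open>- v\<^sup>2\<close> is shared out: one quarter pays
        for \<open>s * x\<^sup>2\<close>, using \<open>s \<le> 1 / 8\<close>, one quarter for the
        cross term in \<open>\<bar>v\<bar> * \<bar>y\<bar>\<close>, and one half is kept. The cross
        term leaves \<open>4 * K0\<^sup>2\<close> in \<open>B3\<close>; the summand 1 there is the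
        \<open>y\<^sup>2\<close> from the localising Gaussian.\<close>
      also have "\<dots> \<le> CC * exp (2 * s * x0\<^sup>2 + 2 * K0 * \<bar>x0\<bar> * \<bar>y\<bar> + B3 * y\<^sup>2 - (1 / 2) * v\<^sup>2)"
      proof (intro mult_left_mono exp_mono)
        have 1: "s * x\<^sup>2 \<le> 2 * s * x0\<^sup>2 + 1 / 4 * v\<^sup>2"
        proof -
          have "0 \<le> (x0 - v)\<^sup>2" by simp
          then have "x\<^sup>2 \<le> 2 * x0\<^sup>2 + 2 * v\<^sup>2" by (simp add: v_def power2_eq_square algebra_simps)
          then have "s * x\<^sup>2 \<le> s * (2 * x0\<^sup>2 + 2 * v\<^sup>2)" using s by (intro mult_left_mono) auto
          moreover have "2 * s * v\<^sup>2 \<le> 1 / 4 * v\<^sup>2" using s by (intro mult_right_mono) auto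
          ultimately show ?thesis by (simp add: distrib_left)
        qed
        have 2: "2 * K * \<bar>x\<bar> * \<bar>y\<bar> \<le> 2 * K0 * \<bar>x0\<bar> * \<bar>y\<bar> + 1 / 4 * v\<^sup>2 + 4 * K0\<^sup>2 * y\<^sup>2"
        proof -
          have "\<bar>x\<bar> \<le> \<bar>x0\<bar> + \<bar>v\<bar>" by (simp add: v_def)
          then have "2 * K * \<bar>x\<bar> * \<bar>y\<bar> \<le> 2 * K0 * (\<bar>x0\<bar> + \<bar>v\<bar>) * \<bar>y\<bar>"
            using K by (intro mult_right_mono mult_mono) auto
          moreover have "2 * K0 * (\<bar>x0\<bar> + \<bar>v\<bar>) * \<bar>y\<bar> = 2 * K0 * \<bar>x0\<bar> * \<bar>y\<bar> + 2 * K0 * \<bar>v\<bar> * \<bar>y\<bar>"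
            by (simp add: algebra_simps)
          moreover have "0 \<le> (\<bar>v\<bar> / 2 - 2 * K0 * \<bar>y\<bar>)\<^sup>2" by simp
          moreover have "(\<bar>v\<bar> / 2 - 2 * K0 * \<bar>y\<bar>)\<^sup>2 = 1 / 4 * v\<^sup>2 - 2 * K0 * \<bar>v\<bar> * \<bar>y\<bar> + 4 * K0\<^sup>2 * y\<^sup>2"
            by (simp add: power2_diff power_mult_distrib power_divide)
          ultimately show ?thesis by linarith
        qed
        have 3: "(pi\<^sup>2 / a + K\<^sup>2 / a) * y\<^sup>2 \<le> 2 * pi\<^sup>2 / a0 * y\<^sup>2" by (intro mult_right_mono B0) auto
        have 4: "0 \<le> (a + s) * y\<^sup>2" using a s by simp
        have 5: "(a + s) * (x\<^sup>2 - y\<^sup>2) = a * x\<^sup>2 + s * x\<^sup>2 - (a + s) * y\<^sup>2" by (simp add: algebra_simps)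
        have 6: "B3 * y\<^sup>2 = 2 * pi\<^sup>2 / a0 * y\<^sup>2 + y\<^sup>2 + 4 * K0\<^sup>2 * y\<^sup>2" by (simp add: B3_def distrib_right)
        show "(- a * x\<^sup>2 + 2 * K * \<bar>x\<bar> * \<bar>y\<bar> + (pi\<^sup>2 / a + K\<^sup>2 / a) * y\<^sup>2) + ((a + s) * (x\<^sup>2 - y\<^sup>2) - (v\<^sup>2 - y\<^sup>2))
            \<le> 2 * s * x0\<^sup>2 + 2 * K0 * \<bar>x0\<bar> * \<bar>y\<bar> + B3 * y\<^sup>2 - (1 / 2) * v\<^sup>2"
          unfolding 5 6 using 1 2 3 4 by linarith
      qed (use CC in auto)
      finally show ?thesis by (simp add: v_def)
    qed
    define \<kappa> where "\<kappa> x = k (of_real x)" for x :: real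
    have \<kappa>b: "norm (\<kappa> x) \<le> CC * exp (2 * s * x0\<^sup>2) * exp (- (1 / 2) * (x - x0)\<^sup>2)" for x
      using kb[of x 0] by (simp add: \<kappa>_def complex_of_real_def exp_add[symmetric] mult.assoc)
    have \<kappa>b': "norm (\<kappa> x) \<le> CC * exp (2 * s * x0\<^sup>2)" for x
    proof -
      have "CC * exp (2 * s * x0\<^sup>2) * exp (- (1 / 2) * (x - x0)\<^sup>2) \<le> CC * exp (2 * s * x0\<^sup>2) * 1"
        using CC by (intro mult_left_mono) auto
      then show ?thesis using \<kappa>b[of x] by simp
    qed
    have \<kappa>cont: "continuous_on UNIV \<kappa>"
    proof -
      have "continuous_on UNIV (k \<circ> of_real)"
        by (intro continuous_on_compose continuous_on_subset[OF holomorphic_on_imp_continuous_on[OF khol]])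
           (auto intro!: continuous_intros)
      then show ?thesis by (simp add: o_def \<kappa>_def[abs_def])
    qed
    have [measurable]: "\<kappa> \<in> borel_measurable borel" using \<kappa>cont by (rule borel_measurable_continuous_onI)
    have \<kappa>int: "integrable lborel \<kappa>"
    proof (rule Bochner_Integration.integrable_bound)
      show "integrable lborel (\<lambda>x. CC * exp (2 * s * x0\<^sup>2) * exp (- (1 / 2) * (x - x0)\<^sup>2))"
        using gaussian_integral(1)[of "1/2" x0] by simp
      show "AE x in lborel. norm (\<kappa> x) \<le> norm (CC * exp (2 * s * x0\<^sup>2) * exp (- (1 / 2) * (x - x0)\<^sup>2))"
        by (intro AE_I2 order_trans[OF \<kappa>b]) auto
    qed simp
    have \<kappa>hm [measurable]: "fourier \<kappa> \<in> borel_measurable borel" by (rule fourier_measurable[OF \<kappa>int])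
    \<comment> \<open>Beyond \<open>\<bar>x0\<bar>\<close> the transform is Gaussian small:
      \<open>2 * s \<le> \<delta>\<close> lets the contour shift absorb the factor
      \<open>exp (2 * s * x0\<^sup>2)\<close>.\<close>
    have tail: "norm (fourier \<kappa> \<xi>) \<le> CC * sqrt (2 * pi) * exp (- \<delta> * \<xi>\<^sup>2)" if "\<bar>\<xi>\<bar> \<ge> \<bar>x0\<bar>" for \<xi>
      unfolding \<kappa>_def \<delta>_def
    proof (rule shifted_fourier_bound[OF khol _ K(3) K0 B3 abs_ge_zero kb _ that])
      show "2 * s * x0\<^sup>2 \<le> (pi - K0)\<^sup>2 / (2 * B3) * \<bar>x0\<bar>\<^sup>2"
        unfolding \<delta>_def[symmetric] using s by (simp add: mult_right_mono)
    qed (use CC in auto)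
    let ?I = "{x0 - \<eta> * \<bar>x0\<bar>..x0 + \<eta> * \<bar>x0\<bar>}"
    define near where "near = (\<integral>\<^sup>+t. ennreal ((norm (\<kappa> t))\<^sup>2) * indicator ?I t \<partial>lborel)"
    define far where "far = (\<integral>\<^sup>+t. ennreal ((norm (\<kappa> t))\<^sup>2) * indicator (- ?I) t \<partial>lborel)"
    define Z where "Z = (\<integral>\<^sup>+\<xi>. ennreal ((norm (fourier \<kappa> \<xi>))\<^sup>2) \<partial>lborel)"
    have Zeq: "Z = near + far"
    proof -
      have "Z = (\<integral>\<^sup>+t. ennreal ((norm (\<kappa> t))\<^sup>2) \<partial>lborel)"
        unfolding Z_def by (rule plancherel[OF \<kappa>int \<kappa>cont \<kappa>b'])
      also have "\<dots> = (\<integral>\<^sup>+t. ennreal ((norm (\<kappa> t))\<^sup>2) * indicator ?I t + ennreal ((norm (\<kappa> t))\<^sup>2) * indicator (- ?I) t \<partial>lborel)"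
        by (intro nn_integral_cong) (auto simp: indicator_def)
      also have "\<dots> = near + far" unfolding near_def far_def by (intro nn_integral_add) auto
      finally show ?thesis .
    qed
    \<comment> \<open>Here \<open>s \<le> \<eta>\<^sup>2 / 8\<close> enters. After squaring, the
      surplus costs \<open>exp (4 * s * x0\<^sup>2)\<close>, which at distance
      \<open>\<eta> * \<bar>x0\<bar>\<close> is compensated by half of the squared localisation; the
      other half is integrated.\<close>
    have far: "far \<le> ennreal F"
    proof -
      have "far \<le> (\<integral>\<^sup>+t. ennreal (CC\<^sup>2) * ennreal (exp (- (1 / 2) * (t - x0)\<^sup>2)) \<partial>lborel)"
        unfolding far_def
      proof (rule nn_integral_mono)
        fix t :: real
        show "ennreal ((norm (\<kappa> t))\<^sup>2) * indicator (- ?I) t \<le> ennreal (CC\<^sup>2) * ennreal (exp (- (1 / 2) * (t - x0)\<^sup>2))"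
        proof (cases "t \<in> ?I")
          case False
          then have "\<eta> * \<bar>x0\<bar> \<le> \<bar>t - x0\<bar>" by auto
          then have "(\<eta> * \<bar>x0\<bar>)\<^sup>2 \<le> (t - x0)\<^sup>2" using \<eta> by (intro abs_le_square_iff[THEN iffD1]) (auto simp: abs_mult)
          then have e1: "\<eta>\<^sup>2 * x0\<^sup>2 \<le> (t - x0)\<^sup>2" by (simp add: power_mult_distrib)
          have e2: "4 * s * x0\<^sup>2 \<le> \<eta>\<^sup>2 / 2 * x0\<^sup>2" using s by (intro mult_right_mono) auto
          have "(norm (\<kappa> t))\<^sup>2 \<le> (CC * exp (2 * s * x0\<^sup>2) * exp (- (1 / 2) * (t - x0)\<^sup>2))\<^sup>2"
            by (intro power_mono \<kappa>b) auto
          also have "\<dots> = CC\<^sup>2 * exp (4 * s * x0\<^sup>2 - (t - x0)\<^sup>2)"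
            by (simp add: power_mult_distrib exp_double[symmetric] mult.assoc exp_add[symmetric])
          also have "\<dots> \<le> CC\<^sup>2 * exp (- (1 / 2) * (t - x0)\<^sup>2)"
            using e1 e2 by (intro mult_left_mono exp_mono) auto
          finally show ?thesis using False by (simp add: ennreal_mult[symmetric] ennreal_leI)
        qed simp
      qed
      also have "\<dots> = ennreal (CC\<^sup>2) * (\<integral>\<^sup>+t. ennreal (exp (- (1 / 2) * (t - x0)\<^sup>2)) \<partial>lborel)" by (rule nn_integral_cmult) simp
      also have "(\<integral>\<^sup>+t. ennreal (exp (- (1 / 2) * (t - x0)\<^sup>2)) \<partial>lborel) = ennreal (sqrt (2 * pi))"
        using gaussian_integral[of "1/2" x0] by (subst nn_integral_eq_integral) (auto simp: mult.commute)
      finally show ?thesis by (simp add: F_def ennreal_mult)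
    qed
    define Q where "Q = (\<integral>\<^sup>+\<xi>. ennreal (\<xi>\<^sup>2 * (norm (fourier \<kappa> \<xi>))\<^sup>2) \<partial>lborel)"
    \<comment> \<open>The second moment exceeds \<open>x0\<^sup>2\<close> times the mass only by the
      constant \<open>T\<close>. The sampling inequality therefore compares the near mass with
      \<open>\<gamma>\<close> times the total mass, and the former can be solved for.\<close>
    have Q: "Q \<le> ennreal (x0\<^sup>2) * Z + ennreal T"
    proof -
      have "Q \<le> (\<integral>\<^sup>+\<xi>. ennreal (x0\<^sup>2) * ennreal ((norm (fourier \<kappa> \<xi>))\<^sup>2) + ennreal ((1 + \<bar>\<xi>\<bar>)\<^sup>2 * exp (- (2 * \<delta>) * \<xi>\<^sup>2)) * ennreal ((CC * sqrt (2 * pi))\<^sup>2) \<partial>lborel)"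
        unfolding Q_def
      proof (rule nn_integral_mono)
        fix \<xi> :: real
        have "\<xi>\<^sup>2 * (norm (fourier \<kappa> \<xi>))\<^sup>2 \<le> x0\<^sup>2 * (norm (fourier \<kappa> \<xi>))\<^sup>2 + (1 + \<bar>\<xi>\<bar>)\<^sup>2 * exp (- (2 * \<delta>) * \<xi>\<^sup>2) * (CC * sqrt (2 * pi))\<^sup>2"
        proof (cases "\<bar>\<xi>\<bar> \<ge> \<bar>x0\<bar>")
          case True
          have "\<xi>\<^sup>2 * (norm (fourier \<kappa> \<xi>))\<^sup>2 \<le> (1 + \<bar>\<xi>\<bar>)\<^sup>2 * (CC * sqrt (2 * pi) * exp (- \<delta> * \<xi>\<^sup>2))\<^sup>2"
            by (intro mult_mono power_mono tail True abs_le_square_iff[THEN iffD1]) auto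
          also have "\<dots> = (1 + \<bar>\<xi>\<bar>)\<^sup>2 * exp (- (2 * \<delta>) * \<xi>\<^sup>2) * (CC * sqrt (2 * pi))\<^sup>2"
            by (simp add: power_mult_distrib exp_double[symmetric] mult.assoc)
          finally show ?thesis by (simp add: add_increasing)
        next
          case False
          then have "\<xi>\<^sup>2 \<le> x0\<^sup>2" by (intro abs_le_square_iff[THEN iffD1]) auto
          then show ?thesis by (simp add: mult_right_mono add_increasing2)
        qed
        then have "ennreal (\<xi>\<^sup>2 * (norm (fourier \<kappa> \<xi>))\<^sup>2) \<le> ennreal (x0\<^sup>2 * (norm (fourier \<kappa> \<xi>))\<^sup>2 + (1 + \<bar>\<xi>\<bar>)\<^sup>2 * exp (- (2 * \<delta>) * \<xi>\<^sup>2) * (CC * sqrt (2 * pi))\<^sup>2)"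
          by (rule ennreal_leI)
        also have "\<dots> = ennreal (x0\<^sup>2) * ennreal ((norm (fourier \<kappa> \<xi>))\<^sup>2) + ennreal ((1 + \<bar>\<xi>\<bar>)\<^sup>2 * exp (- (2 * \<delta>) * \<xi>\<^sup>2)) * ennreal ((CC * sqrt (2 * pi))\<^sup>2)"
          by (subst ennreal_add_mult) (simp_all only: ennreal_mult zero_le_power2 mult_nonneg_nonneg exp_ge_zero)
        finally show "ennreal (\<xi>\<^sup>2 * (norm (fourier \<kappa> \<xi>))\<^sup>2) \<le> ennreal (x0\<^sup>2) * ennreal ((norm (fourier \<kappa> \<xi>))\<^sup>2) + ennreal ((1 + \<bar>\<xi>\<bar>)\<^sup>2 * exp (- (2 * \<delta>) * \<xi>\<^sup>2)) * ennreal ((CC * sqrt (2 * pi))\<^sup>2)" .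
      qed
      also have "\<dots> = ennreal (x0\<^sup>2) * Z + (\<integral>\<^sup>+\<xi>. ennreal ((1 + \<bar>\<xi>\<bar>)\<^sup>2 * exp (- (2 * \<delta>) * \<xi>\<^sup>2)) \<partial>lborel) * ennreal ((CC * sqrt (2 * pi))\<^sup>2)"
        unfolding Z_def by (subst nn_integral_add) (auto simp: nn_integral_cmult nn_integral_multc)
      also have "(\<integral>\<^sup>+\<xi>. ennreal ((1 + \<bar>\<xi>\<bar>)\<^sup>2 * exp (- (2 * \<delta>) * \<xi>\<^sup>2)) \<partial>lborel) = ennreal (LINT \<xi>|lborel. (1 + \<bar>\<xi>\<bar>)\<^sup>2 * exp (- (2 * \<delta>) * \<xi>\<^sup>2))"
        by (rule nn_integral_eq_integral[OF Tint]) auto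
      finally show ?thesis unfolding T_def by (simp add: ennreal_mult integral_nonneg_AE)
    qed
    \<comment> \<open>At the nodes the factor \<open>exp (- pi * t\<^sup>2)\<close> outweighs
      \<open>exp ((a + s) * t\<^sup>2)\<close> as long as \<open>a + s \<le> pi\<close>, and only
      the polynomial is left. This is what stops the improvement at \<open>pi\<close>.\<close>
    define m where "m = \<bar>D\<bar> * (1 + 2 * \<bar>x0\<bar>) ^ N"
    have mm: "norm (\<kappa> t) \<le> m" if "t \<in> S" "\<bar>x0\<bar> / 2 \<le> \<bar>t\<bar>" "\<bar>t\<bar> \<le> 2 * \<bar>x0\<bar>" for t
    proof -
      have "norm (\<kappa> t) = norm (\<phi> t) * exp ((a + s) * t\<^sup>2 - (t - x0)\<^sup>2)"
      proof -
        have "of_real (a + s) * (of_real t)\<^sup>2 - (of_real t - of_real x0)\<^sup>2 = complex_of_real ((a + s) * t\<^sup>2 - (t - x0)\<^sup>2)"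
          by simp
        then show ?thesis by (simp only: \<kappa>_def k_def \<Phi>_def \<phi>\<psi> norm_mult norm_exp_eq_Re Re_complex_of_real)
      qed
      also have "\<dots> \<le> (\<bar>D\<bar> * (1 + \<bar>t\<bar>) ^ N * exp (- pi * t\<^sup>2)) * exp ((a + s) * t\<^sup>2)"
      proof (intro mult_mono exp_mono)
        have "D * (1 + \<bar>t\<bar>) ^ N * exp (- pi * t\<^sup>2) \<le> \<bar>D\<bar> * (1 + \<bar>t\<bar>) ^ N * exp (- pi * t\<^sup>2)"
          by (intro mult_right_mono) auto
        then show "norm (\<phi> t) \<le> \<bar>D\<bar> * (1 + \<bar>t\<bar>) ^ N * exp (- pi * t\<^sup>2)" using S[OF that(1)] by linarith
      qed auto
      also have "\<dots> = \<bar>D\<bar> * (1 + \<bar>t\<bar>) ^ N * exp ((a + s - pi) * t\<^sup>2)" by (simp add: mult.assoc exp_add[symmetric] algebra_simps)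
      also have "\<dots> \<le> \<bar>D\<bar> * (1 + 2 * \<bar>x0\<bar>) ^ N * 1"
        using that(3) s by (intro mult_mono mult_left_mono power_mono) (auto simp: mult_nonpos_nonneg)
      finally show ?thesis by (simp add: m_def)
    qed
    have main: "ennreal (x0\<^sup>2) * near \<le> ennreal \<gamma> * Q + ennreal (G * \<bar>x0\<bar> ^ 3 * m\<^sup>2)"
      unfolding near_def Q_def G_def
      by (rule sampling_inequality[OF \<gamma> X samp \<kappa>int \<kappa>cont \<kappa>b' x01(1) mm])
    have "near < \<infinity>"
    proof -
      have "near \<le> (\<integral>\<^sup>+t. ennreal ((CC * exp (2 * s * x0\<^sup>2))\<^sup>2) * indicator ?I t \<partial>lborel)"
        unfolding near_def by (intro nn_integral_mono mult_right_mono ennreal_leI power_mono \<kappa>b') auto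
      also have "\<dots> < \<infinity>" by (subst nn_integral_cmult_indicator) (auto simp: ennreal_mult_less_top emeasure_lborel_Icc_eq)
      finally show ?thesis .
    qed
    \<comment> \<open>A real value is needed so that \<open>\<gamma> * nr\<close> can be moved to
      the other side.\<close>
    then obtain nr where nr: "near = ennreal nr" "nr \<ge> 0" by (cases near rule: ennreal_cases) auto
    obtain fr where fr: "far = ennreal fr" "fr \<ge> 0" "fr \<le> F"
      using far F0 by (cases far rule: ennreal_cases) (auto simp: top_unique)
    have Zr: "Z = ennreal (nr + fr)" using Zeq nr fr by simp
    have "ennreal (x0\<^sup>2 * nr) \<le> ennreal \<gamma> * (ennreal (x0\<^sup>2) * Z + ennreal T) + ennreal (G * \<bar>x0\<bar> ^ 3 * m\<^sup>2)"
      using order_trans[OF main add_right_mono[OF mult_left_mono[OF Q]]] nr by (simp add: ennreal_mult)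
    also have "\<dots> = ennreal (\<gamma> * (x0\<^sup>2 * (nr + fr) + T) + G * \<bar>x0\<bar> ^ 3 * m\<^sup>2)"
      unfolding Zr using nr fr T0 G0 \<gamma> by (simp add: ennreal_mult[symmetric] ennreal_plus[symmetric] del: ennreal_plus)
    finally have "x0\<^sup>2 * nr \<le> \<gamma> * (x0\<^sup>2 * (nr + fr) + T) + G * \<bar>x0\<bar> ^ 3 * m\<^sup>2"
      using nr fr T0 G0 \<gamma> by (subst (asm) ennreal_le_iff) auto
    also have "\<dots> \<le> \<gamma> * (x0\<^sup>2 * nr) + x0\<^sup>2 * F + x0\<^sup>2 * T + x0\<^sup>2 * (G * \<bar>x0\<bar> * m\<^sup>2)"
    proof -
      have "\<gamma> * (x0\<^sup>2 * fr) \<le> 1 * (x0\<^sup>2 * F)" using \<gamma> fr by (intro mult_mono mult_left_mono) auto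
      moreover have "\<gamma> * T \<le> x0\<^sup>2 * T" using \<gamma> T0 x0sq by (intro mult_right_mono) auto
      moreover have "G * \<bar>x0\<bar> ^ 3 * m\<^sup>2 = x0\<^sup>2 * (G * \<bar>x0\<bar> * m\<^sup>2)" by (simp add: power3_eq_cube power2_eq_square)
      moreover have "\<gamma> * (x0\<^sup>2 * (nr + fr) + T) = \<gamma> * (x0\<^sup>2 * nr) + \<gamma> * (x0\<^sup>2 * fr) + \<gamma> * T"
        by (simp add: algebra_simps)
      ultimately show ?thesis by linarith
    qed
    also have "\<dots> = x0\<^sup>2 * (\<gamma> * nr + F + T + G * \<bar>x0\<bar> * m\<^sup>2)" by (simp add: algebra_simps)
    finally have "nr \<le> \<gamma> * nr + F + T + G * \<bar>x0\<bar> * m\<^sup>2" using x0sq by (subst (asm) mult_le_cancel_left_pos) auto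
    then have "nr * (1 - \<gamma>) \<le> F + T + G * \<bar>x0\<bar> * m\<^sup>2" by (simp add: algebra_simps)
    then have "nr \<le> (F + T + G * \<bar>x0\<bar> * m\<^sup>2) / (1 - \<gamma>)" using \<gamma> by (simp add: pos_le_divide_eq)
    then have Pb: "nr + fr \<le> P \<bar>x0\<bar>" using fr by (simp add: P_def m_def)
    have "ennreal (norm (\<kappa> x0)) \<le> (\<integral>\<^sup>+\<xi>. ennreal (norm (fourier \<kappa> \<xi>)) \<partial>lborel)"
      using \<kappa>cont by (intro norm_le_nn_integral_fourier \<kappa>int) (simp add: continuous_on_eq_continuous_at)
    \<comment> \<open>From the mass to a pointwise bound: for
      \<open>\<bar>\<xi>\<bar> < \<bar>x0\<bar>\<close> the estimate
      \<open>u \<le> 1 + u\<^sup>2\<close> costs the length \<open>2 * \<bar>x0\<bar>\<close> of the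
      interval, and beyond it the tail bound is integrable.\<close>
    also have "\<dots> \<le> (\<integral>\<^sup>+\<xi>. (indicator {- \<bar>x0\<bar>..\<bar>x0\<bar>} \<xi> + ennreal ((norm (fourier \<kappa> \<xi>))\<^sup>2)) + ennreal (CC * sqrt (2 * pi)) * ennreal (exp (- \<delta> * \<xi>\<^sup>2)) \<partial>lborel)"
    proof (rule nn_integral_mono)
      fix \<xi> :: real
      show "ennreal (norm (fourier \<kappa> \<xi>)) \<le> (indicator {- \<bar>x0\<bar>..\<bar>x0\<bar>} \<xi> + ennreal ((norm (fourier \<kappa> \<xi>))\<^sup>2)) + ennreal (CC * sqrt (2 * pi)) * ennreal (exp (- \<delta> * \<xi>\<^sup>2))"
      proof (cases "\<bar>\<xi>\<bar> \<ge> \<bar>x0\<bar>")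
        case True
        have "ennreal (norm (fourier \<kappa> \<xi>)) \<le> ennreal (CC * sqrt (2 * pi)) * ennreal (exp (- \<delta> * \<xi>\<^sup>2))"
          using tail[OF True] CC by (simp add: ennreal_mult[symmetric] ennreal_leI)
        then show ?thesis by (simp add: add_increasing)
      next
        case False
        have "0 \<le> (norm (fourier \<kappa> \<xi>) - 1)\<^sup>2" by simp
        also have "\<dots> = (norm (fourier \<kappa> \<xi>))\<^sup>2 - 2 * norm (fourier \<kappa> \<xi>) + 1" by (simp add: power2_diff)
        finally have "norm (fourier \<kappa> \<xi>) \<le> 1 + (norm (fourier \<kappa> \<xi>))\<^sup>2" using norm_ge_zero[of "fourier \<kappa> \<xi>"] by linarith
        then have "ennreal (norm (fourier \<kappa> \<xi>)) \<le> ennreal (1 + (norm (fourier \<kappa> \<xi>))\<^sup>2)" by (rule ennreal_leI)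
        also have "\<dots> = indicator {- \<bar>x0\<bar>..\<bar>x0\<bar>} \<xi> + ennreal ((norm (fourier \<kappa> \<xi>))\<^sup>2)"
        proof -
          have "- \<bar>x0\<bar> \<le> \<xi>" "\<xi> \<le> \<bar>x0\<bar>" using False by linarith+
          then show ?thesis by (simp add: indicator_def)
        qed
        finally show ?thesis by (simp add: add_increasing2)
      qed
    qed
    also have "\<dots> = (emeasure lborel {- \<bar>x0\<bar>..\<bar>x0\<bar>} + Z) + ennreal (CC * sqrt (2 * pi)) * (\<integral>\<^sup>+\<xi>. ennreal (exp (- \<delta> * \<xi>\<^sup>2)) \<partial>lborel)"
      unfolding Z_def by (subst nn_integral_add, simp, simp, subst nn_integral_add) (auto simp: nn_integral_cmult)
    also have "(\<integral>\<^sup>+\<xi>. ennreal (exp (- \<delta> * \<xi>\<^sup>2)) \<partial>lborel) = ennreal (sqrt (pi / \<delta>))"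
      using gaussian_integral_0[OF \<delta>] by (subst nn_integral_eq_integral) auto
    also have "(emeasure lborel {- \<bar>x0\<bar>..\<bar>x0\<bar>} + Z) + ennreal (CC * sqrt (2 * pi)) * ennreal (sqrt (pi / \<delta>)) = ennreal (2 * \<bar>x0\<bar> + (nr + fr) + H)"
      unfolding Zr H_def using nr fr CC \<delta> by (simp add: ennreal_mult[symmetric] ennreal_plus[symmetric] del: ennreal_plus)
    finally have "norm (\<kappa> x0) \<le> 2 * \<bar>x0\<bar> + (nr + fr) + H"
      using nr fr H0 by (subst (asm) ennreal_le_iff) auto
    moreover have "norm (\<kappa> x0) = norm (\<phi> x0) * exp ((a + s) * x0\<^sup>2)"
    proof -
      have "of_real (a + s) * (of_real x0)\<^sup>2 - (of_real x0 - of_real x0)\<^sup>2 = complex_of_real ((a + s) * x0\<^sup>2)"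
        by simp
      then show ?thesis by (simp only: \<kappa>_def k_def \<Phi>_def \<phi>\<psi> norm_mult norm_exp_eq_Re Re_complex_of_real)
    qed
    ultimately show ?thesis using Pb by linarith
  qed
  \<comment> \<open>The highest power in \<open>P\<close> is \<open>x0\<close> times the square of a
    polynomial of degree \<open>N\<close>, whence the exponent \<open>2 * N + 1\<close>;
    \<open>V\<close> is the constant after comparison with that power of
    \<open>1 + \<bar>x\<bar>\<close>.\<close>
  define V where "V = (F + T + G * D\<^sup>2 * 4 ^ N) / (1 - \<gamma>) + F"
  define C' where "C' = 2 + V + H + \<bar>C\<bar> * exp (pi * X1\<^sup>2)"
  have V0: "V \<ge> 0" using F0 T0 G0 \<gamma> by (simp add: V_def)
  have pol: "2 * \<bar>x\<bar> + P \<bar>x\<bar> + H \<le> (2 + V + H) * (1 + \<bar>x\<bar>) ^ (2 * N + 1)" for x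
  proof -
    define w where "w = (1 + \<bar>x\<bar>) ^ (2 * N + 1)"
    have pw: "(1 + \<bar>x\<bar>) ^ (2 * N) \<ge> 1" by (rule one_le_power) simp
    have w: "w = (1 + \<bar>x\<bar>) * (1 + \<bar>x\<bar>) ^ (2 * N)" by (simp add: w_def)
    have w1: "w \<ge> 1" unfolding w_def by (rule one_le_power) simp
    have "1 + \<bar>x\<bar> \<le> w" unfolding w using pw mult_left_mono[OF pw, of "1 + \<bar>x\<bar>"] by simp
    then have w2: "\<bar>x\<bar> \<le> w" by simp
    have "(1 + 2 * \<bar>x\<bar>) ^ N \<le> (2 * (1 + \<bar>x\<bar>)) ^ N" by (intro power_mono) auto
    then have "(\<bar>D\<bar> * (1 + 2 * \<bar>x\<bar>) ^ N)\<^sup>2 \<le> (\<bar>D\<bar> * (2 * (1 + \<bar>x\<bar>)) ^ N)\<^sup>2" by (intro power_mono mult_left_mono) auto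
    also have "\<dots> = D\<^sup>2 * 4 ^ N * (1 + \<bar>x\<bar>) ^ (2 * N)"
    proof -
      have "((2::real) ^ N)\<^sup>2 = (2\<^sup>2) ^ N" by (simp only: power_mult[symmetric] mult.commute[of N 2])
      then have "((2::real) ^ N)\<^sup>2 = 4 ^ N" by simp
      moreover have "((1 + \<bar>x\<bar>) ^ N)\<^sup>2 = (1 + \<bar>x\<bar>) ^ (2 * N)" by (simp only: power_mult[symmetric] mult.commute[of N 2])
      ultimately show ?thesis by (simp only: power_mult_distrib power2_abs mult.assoc)
    qed
    finally have sq: "(\<bar>D\<bar> * (1 + 2 * \<bar>x\<bar>) ^ N)\<^sup>2 \<le> D\<^sup>2 * 4 ^ N * (1 + \<bar>x\<bar>) ^ (2 * N)" .
    have "G * \<bar>x\<bar> * (\<bar>D\<bar> * (1 + 2 * \<bar>x\<bar>) ^ N)\<^sup>2 \<le> G * (1 + \<bar>x\<bar>) * (D\<^sup>2 * 4 ^ N * (1 + \<bar>x\<bar>) ^ (2 * N))"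
      using G0 sq by (intro mult_mono) auto
    also have "\<dots> = G * D\<^sup>2 * 4 ^ N * w" by (simp add: w)
    finally have 1: "G * \<bar>x\<bar> * (\<bar>D\<bar> * (1 + 2 * \<bar>x\<bar>) ^ N)\<^sup>2 \<le> G * D\<^sup>2 * 4 ^ N * w" .
    have "F + T + G * \<bar>x\<bar> * (\<bar>D\<bar> * (1 + 2 * \<bar>x\<bar>) ^ N)\<^sup>2 \<le> F * w + T * w + G * D\<^sup>2 * 4 ^ N * w"
      using 1 mult_left_mono[OF w1 F0] mult_left_mono[OF w1 T0] by simp
    then have "P \<bar>x\<bar> \<le> (F * w + T * w + G * D\<^sup>2 * 4 ^ N * w) / (1 - \<gamma>) + F * w"
      unfolding P_def abs_idempotent using \<gamma> mult_left_mono[OF w1 F0] by (intro add_mono[OF divide_right_mono]) simp_all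
    also have "\<dots> = V * w" by (simp add: V_def distrib_right add_divide_distrib)
    finally have "P \<bar>x\<bar> \<le> V * w" .
    moreover have "H \<le> H * w" using mult_left_mono[OF w1 H0] by simp
    ultimately show ?thesis using w2 unfolding w_def[symmetric] distrib_right by linarith
  qed
  have "norm (\<phi> x) \<le> C' * (1 + \<bar>x\<bar>) ^ (2 * N + 1) * exp (- (a + s) * x\<^sup>2)" for x
  proof (cases "\<bar>x\<bar> \<ge> X1")
    case True
    have "norm (\<phi> x) * exp ((a + s) * x\<^sup>2) \<le> (2 + V + H) * (1 + \<bar>x\<bar>) ^ (2 * N + 1)"
      using big[OF True] pol[of x] by linarith
    also have "\<dots> \<le> C' * (1 + \<bar>x\<bar>) ^ (2 * N + 1)" unfolding C'_def by (intro mult_right_mono) auto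
    finally have "norm (\<phi> x) * exp ((a + s) * x\<^sup>2) \<le> C' * (1 + \<bar>x\<bar>) ^ (2 * N + 1)" .
    from le_mult_exp_minus[OF this] show ?thesis by (simp only: mult_minus_left)
  next
    case False
    have "x\<^sup>2 \<le> X1\<^sup>2" using False by (intro abs_le_square_iff[THEN iffD1]) (auto simp: X1_def)
    then have "(a + s) * x\<^sup>2 \<le> pi * X1\<^sup>2" using s a by (intro mult_mono) auto
    then have "1 \<le> exp (pi * X1\<^sup>2 + - (a + s) * x\<^sup>2)" by (simp add: algebra_simps)
    then have e: "1 \<le> exp (pi * X1\<^sup>2) * exp (- (a + s) * x\<^sup>2)" unfolding exp_add .
    have w1: "(1 + \<bar>x\<bar>) ^ (2 * N + 1) \<ge> 1" by (rule one_le_power) simp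
    have "norm (\<phi> x) \<le> \<bar>C\<bar> * 1"
    proof -
      have "C * exp (- a * x\<^sup>2) \<le> \<bar>C\<bar> * 1" using a by (intro mult_mono) auto
      then show ?thesis using \<phi>[of x] by linarith
    qed
    also have "\<dots> \<le> \<bar>C\<bar> * (exp (pi * X1\<^sup>2) * exp (- (a + s) * x\<^sup>2))" by (intro mult_left_mono e) auto
    also have "\<dots> = (\<bar>C\<bar> * exp (pi * X1\<^sup>2)) * 1 * exp (- (a + s) * x\<^sup>2)" by simp
    also have "\<dots> \<le> C' * (1 + \<bar>x\<bar>) ^ (2 * N + 1) * exp (- (a + s) * x\<^sup>2)"
      unfolding C'_def using w1 V0 H0 by (intro mult_right_mono mult_mono) auto
    finally show ?thesis .
  qed
  then show ?thesis by blast
qed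

section \<open>Iteration up to the critical rate\<close>

text \<open>Puts the transform of \<open>F\<close> into the form required by the improvement step,
  so that one lemma treats \<open>F\<close> and its transform.\<close>

lemma fourier_laplace_reflect:
  "fourier_laplace (\<lambda>x. F (- x)) (of_real t) = fourier F t"
proof -
  have "fourier F t = (LINT x|lborel. F (0 + - 1 * x) * exp (- 2 * of_real pi * \<i> * of_real (0 + - 1 * x) * of_real t))"
    unfolding fourier_def by (subst lborel_integral_real_affine[where c="-1" and t=0]) auto
  also have "\<dots> = fourier_laplace (\<lambda>x. F (- x)) (of_real t)"
    unfolding fourier_laplace_def by (intro Bochner_Integration.integral_cong refl) simp
  finally show ?thesis ..
qed

lemma fourier_laplace_inversion:
  assumes "integrable lborel F" "continuous_on UNIV F" "integrable lborel (fourier F)"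
  shows "F t = fourier_laplace (fourier F) (of_real t)"
proof -
  have "F t = (LINT \<xi>|lborel. fourier F \<xi> * cis (2 * pi * t * \<xi>))"
    using assms by (intro fourier_inversion) (auto simp: continuous_on_eq_continuous_at)
  also have "\<dots> = fourier_laplace (fourier F) (of_real t)"
    unfolding fourier_laplace_def cis_conv_exp
    by (intro Bochner_Integration.integral_cong refl) (simp add: mult_ac)
  finally show ?thesis .
qed

text \<open>A step produces a polynomial factor but has to start from a pure Gaussian bound. So each
  step of size \<open>s0\<close> is followed by giving up half of the gain to absorb the polynomial.
  The last step has size \<open>pi - a\<close>, lands on \<open>pi\<close> exactly and retains its
  polynomial.\<close>

theorem sharp_gaussian_decay:
  fixes F :: "real \<Rightarrow> complex"
  defines "G \<equiv> fourier F"
  assumes F: "integrable lborel F" "continuous_on UNIV F" and G: "integrable lborel G"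
    and \<gamma>: "0 < \<gamma>" "\<gamma> < 1" and \<eta>: "\<eta> > 0" and X: "X > 0"
    and samp: "sampling S \<gamma> \<eta> X" "sampling T \<gamma> \<eta> X"
    and S: "\<And>t. t \<in> S \<Longrightarrow> norm (F t) \<le> D * (1 + \<bar>t\<bar>) ^ N * exp (- pi * t\<^sup>2)"
    and T: "\<And>t. t \<in> T \<Longrightarrow> norm (G t) \<le> D * (1 + \<bar>t\<bar>) ^ N * exp (- pi * t\<^sup>2)"
    and a1: "0 < a1" "\<And>t. norm (F t) \<le> C1 * exp (- a1 * t\<^sup>2)" "\<And>t. norm (G t) \<le> C1 * exp (- a1 * t\<^sup>2)"
  obtains C where "\<And>t. norm (F t) \<le> C * (1 + \<bar>t\<bar>) ^ (2 * N + 1) * exp (- pi * t\<^sup>2)"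
    "\<And>t. norm (G t) \<le> C * (1 + \<bar>t\<bar>) ^ (2 * N + 1) * exp (- pi * t\<^sup>2)"
proof -
  have mF: "(\<lambda>x. F (- x)) \<in> borel_measurable borel" and mG: "G \<in> borel_measurable borel"
    using borel_measurable_integrable[OF F(1)] borel_measurable_integrable[OF G] by measurable
  define bounded_by where "bounded_by M a \<longleftrightarrow> (\<exists>C. \<forall>t. norm (F t) \<le> C * (1 + \<bar>t\<bar>) ^ M * exp (- a * t\<^sup>2) \<and> norm (G t) \<le> C * (1 + \<bar>t\<bar>) ^ M * exp (- a * t\<^sup>2))" for M a
  \<comment> \<open>The cap keeps the starting rate below \<open>pi\<close>, where the step applies,
    even if the decay known so far is faster.\<close>
  define a0 where "a0 = min a1 (pi / 2)"
  have a0: "0 < a0" "a0 < pi" "a0 \<le> a1" using a1(1) by (auto simp: a0_def min_def)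
  define \<delta> where "\<delta> = (pi - sqrt (pi\<^sup>2 - a0\<^sup>2))\<^sup>2 / (2 * (2 * pi\<^sup>2 / a0 + 1 + 4 * (sqrt (pi\<^sup>2 - a0\<^sup>2))\<^sup>2))"
  have \<delta>: "\<delta> > 0"
  proof -
    have "sqrt (pi\<^sup>2 - a0\<^sup>2) < pi" using a0 by (intro real_less_lsqrt) auto
    moreover have "2 * pi\<^sup>2 / a0 + 1 + 4 * (sqrt (pi\<^sup>2 - a0\<^sup>2))\<^sup>2 > 0"
      using a0 by (intro add_pos_nonneg) auto
    ultimately show ?thesis unfolding \<delta>_def by (intro divide_pos_pos) auto
  qed
  define s0 where "s0 = min (1 / 8) (min (\<eta>\<^sup>2 / 8) (\<delta> / 2))"
  have s0: "s0 > 0" using \<delta> \<eta> by (simp add: s0_def)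
  have step: "bounded_by (2 * N + 1) (a + s)" if a: "a0 \<le> a" "a < pi" "bounded_by 0 a" and s: "0 \<le> s" "s \<le> s0" "a + s \<le> pi" for a s
  proof -
    obtain C where C: "\<And>t. norm (F t) \<le> C * exp (- a * t\<^sup>2)" "\<And>t. norm (G t) \<le> C * exp (- a * t\<^sup>2)"
      using a(3) unfolding bounded_by_def by auto
    have ss: "s \<le> 1 / 8" "s \<le> \<eta>\<^sup>2 / 8" "2 * s \<le> \<delta>" using s(2) by (auto simp: s0_def)
    have FL: "F t = fourier_laplace G (of_real t)" for t
      unfolding G_def by (rule fourier_laplace_inversion[OF F G[unfolded G_def]])
    have GL: "G t = fourier_laplace (\<lambda>x. F (- x)) (of_real t)" for t
      unfolding G_def fourier_laplace_reflect ..
    have CF: "norm (F (- \<xi>)) \<le> C * exp (- a * \<xi>\<^sup>2)" for \<xi> using C(1)[of "- \<xi>"] by simp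
    have "\<exists>C'. \<forall>t. norm (F t) \<le> C' * (1 + \<bar>t\<bar>) ^ (2 * N + 1) * exp (- (a + s) * t\<^sup>2)"
      by (rule gaussian_step[OF \<gamma> \<eta> X samp(1) a0(1) a(1,2) s(1) ss(1,2) ss(3)[unfolded \<delta>_def] s(3) mG C(2,1) FL S])
    then obtain C2 where C2: "\<And>t. norm (F t) \<le> C2 * (1 + \<bar>t\<bar>) ^ (2 * N + 1) * exp (- (a + s) * t\<^sup>2)" by blast
    have "\<exists>C'. \<forall>t. norm (G t) \<le> C' * (1 + \<bar>t\<bar>) ^ (2 * N + 1) * exp (- (a + s) * t\<^sup>2)"
      by (rule gaussian_step[OF \<gamma> \<eta> X samp(2) a0(1) a(1,2) s(1) ss(1,2) ss(3)[unfolded \<delta>_def] s(3) mF CF C(2) GL T])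
    then obtain C3 where C3: "\<And>t. norm (G t) \<le> C3 * (1 + \<bar>t\<bar>) ^ (2 * N + 1) * exp (- (a + s) * t\<^sup>2)" by blast
    define w where "w t = (1 + \<bar>t\<bar>) ^ (2 * N + 1) * exp (- (a + s) * t\<^sup>2)" for t
    have w: "w t \<ge> 0" for t by (simp add: w_def)
    have "norm (F t) \<le> max C2 C3 * w t \<and> norm (G t) \<le> max C2 C3 * w t" for t
      using C2[of t] C3[of t] mult_right_mono[OF max.cobounded1[of C2 C3] w[of t]] mult_right_mono[OF max.cobounded2[of C3 C2] w[of t]]
      unfolding w_def mult.assoc by linarith
    then show ?thesis unfolding bounded_by_def w_def mult.assoc by blast
  qed
  have absorb: "bounded_by 0 (a + s / 2)" if bM: "bounded_by M (a + s)" and s: "s > 0" for M a s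
  proof -
    obtain C where C: "\<And>t. norm (F t) \<le> C * (1 + \<bar>t\<bar>) ^ M * exp (- (a + s) * t\<^sup>2)" "\<And>t. norm (G t) \<le> C * (1 + \<bar>t\<bar>) ^ M * exp (- (a + s) * t\<^sup>2)"
      using bM unfolding bounded_by_def by auto
    have C0: "C \<ge> 0" using order_trans[OF norm_ge_zero C(1)[of 0]] by simp
    define B where "B = exp ((real M)\<^sup>2 / (2 * (s / 2)))"
    have "C * (1 + \<bar>t\<bar>) ^ M * exp (- (a + s) * t\<^sup>2) \<le> C * B * exp (- (a + s / 2) * t\<^sup>2)" for t
    proof -
      have "(1 + \<bar>t\<bar>) ^ M * exp (- (s / 2) * t\<^sup>2) \<le> B * exp (- (s / 2 / 2) * t\<^sup>2)"
        unfolding B_def using s by (intro poly_gaussian_bound) simp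
      also have "\<dots> \<le> B * 1" using s by (intro mult_left_mono) (auto simp: B_def)
      finally have "C * ((1 + \<bar>t\<bar>) ^ M * exp (- (s / 2) * t\<^sup>2)) * exp (- (a + s / 2) * t\<^sup>2) \<le> C * B * exp (- (a + s / 2) * t\<^sup>2)"
        using C0 by (intro mult_right_mono mult_left_mono) auto
      also have "C * ((1 + \<bar>t\<bar>) ^ M * exp (- (s / 2) * t\<^sup>2)) * exp (- (a + s / 2) * t\<^sup>2) = C * (1 + \<bar>t\<bar>) ^ M * exp (- (a + s) * t\<^sup>2)"
        by (simp add: mult.assoc exp_add[symmetric] algebra_simps)
      finally show ?thesis .
    qed
    then have "norm (F t) \<le> C * B * (1 + \<bar>t\<bar>) ^ 0 * exp (- (a + s / 2) * t\<^sup>2) \<and> norm (G t) \<le> C * B * (1 + \<bar>t\<bar>) ^ 0 * exp (- (a + s / 2) * t\<^sup>2)" for t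
      unfolding power_0 mult_1_right using C(1)[of t] C(2)[of t] by (meson order_trans)
    then show ?thesis unfolding bounded_by_def by blast
  qed
  have base: "bounded_by 0 a0"
  proof -
    have C1: "C1 \<ge> 0" using order_trans[OF norm_ge_zero a1(2)[of 0]] by simp
    have "C1 * exp (- a1 * t\<^sup>2) \<le> C1 * exp (- a0 * t\<^sup>2)" for t
      using a0 C1 by (intro mult_left_mono) (auto intro: mult_right_mono)
    then have "norm (F t) \<le> C1 * (1 + \<bar>t\<bar>) ^ 0 * exp (- a0 * t\<^sup>2) \<and> norm (G t) \<le> C1 * (1 + \<bar>t\<bar>) ^ 0 * exp (- a0 * t\<^sup>2)" for t
      using a1(2)[of t] a1(3)[of t] unfolding power_0 mult_1_right by (meson order_trans)
    then show ?thesis unfolding bounded_by_def by blast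
  qed
  have "bounded_by (2 * N + 1) pi"
  proof (rule ccontr)
    assume not: "\<not> bounded_by (2 * N + 1) pi"
    \<comment> \<open>If the bound at \<open>pi\<close> failed, no rate could come within
      \<open>s0\<close> of \<open>pi\<close>, as a single step would reach it. Hence the rate could
      be raised by \<open>s0 / 2\<close> arbitrarily often without reaching
      \<open>pi\<close>.\<close>
    have iter: "bounded_by 0 (a0 + real n * (s0 / 2)) \<and> a0 + real n * (s0 / 2) < pi" for n
    proof (induction n)
      case 0
      then show ?case using base a0 by simp
    next
      case (Suc n)
      define a where "a = a0 + real n * (s0 / 2)"
      have a: "bounded_by 0 a" "a < pi" "a0 \<le> a" using Suc s0 by (auto simp: a_def)
      have lt: "a + s0 < pi"
      proof (rule ccontr)
        assume "\<not> a + s0 < pi"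
        then have "bounded_by (2 * N + 1) (a + (pi - a))" using a by (intro step) auto
        then show False using not by simp
      qed
      have "bounded_by 0 (a + s0 / 2)" using lt a s0 by (intro absorb[OF step]) auto
      moreover have "a0 + real (Suc n) * (s0 / 2) = a + s0 / 2" by (simp add: a_def field_simps)
      ultimately show ?case using lt s0 by simp
    qed
    obtain n :: nat where "pi < real n * (s0 / 2)" using reals_Archimedean3[of "s0 / 2"] s0 by auto
    then show False using iter[of n] a0 by linarith
  qed
  then show ?thesis unfolding bounded_by_def using that by blast
qed

section \<open>Hardy's theorem with a polynomial factor\<close>

lemma right_half_plane_polar:
  fixes x y :: real
  assumes "x > 0"
  defines "r \<equiv> sqrt (x\<^sup>2 + y\<^sup>2)" and "\<theta> \<equiv> arctan (y / x)"
  shows "r * cos \<theta> = x" "r * sin \<theta> = y"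
proof -
  have "1 + (y / x)\<^sup>2 = (x\<^sup>2 + y\<^sup>2) / x\<^sup>2" using assms(1) by (simp add: power_divide field_simps)
  then have s1: "sqrt (1 + (y / x)\<^sup>2) = r / x" using assms(1) by (simp add: r_def real_sqrt_divide)
  have "r > 0" using assms(1) unfolding r_def by (simp add: add_pos_nonneg)
  then show "r * cos \<theta> = x" "r * sin \<theta> = y"
    unfolding \<theta>_def cos_arctan sin_arctan s1 using assms(1) by auto
qed

text \<open>Phragmen-Lindelof for growth of order 2 requires an opening below \<open>pi / 2\<close>,
  but \<open>g\<close> is controlled on the real and the imaginary axis, which enclose exactly
  \<open>pi / 2\<close>. The factor \<open>exp (\<i> * \<sigma> * K * z\<^sup>2)\<close> has modulus
  1 on the real axis and makes the product polynomially bounded on a ray slightly before the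
  imaginary axis; then \<open>K\<close> tends to 0.\<close>

lemma hardy_right_half_plane:
  fixes g :: "complex \<Rightarrow> complex"
  assumes hol: "g holomorphic_on UNIV" and C: "C > 0"
    and re: "\<And>x. norm (g (of_real x)) \<le> C * (1 + \<bar>x\<bar>) ^ M"
    and bd: "\<And>z. norm (g z) \<le> C * (1 + \<bar>Im z\<bar>) ^ M * exp (pi * (Re z)\<^sup>2)"
    and z: "norm z \<ge> 1" "Re z > 0"
  shows "norm (g z) \<le> C * 2 ^ M * exp pi * norm z ^ M"
proof -
  define x y r \<theta> where "x = Re z" and "y = Im z" and "r = norm z" and "\<theta> = arctan (y / x)"
  have x: "x > 0" and r: "r \<ge> 1" using z by (auto simp: x_def r_def)
  have rr: "r = sqrt (x\<^sup>2 + y\<^sup>2)" by (simp add: r_def x_def y_def cmod_def)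
  have cs: "r * cos \<theta> = x" "r * sin \<theta> = y"
    using right_half_plane_polar[OF x, of y] by (simp_all add: rr \<theta>_def)
  have zr: "z = of_real r * cis \<theta>" using cs by (simp add: complex_eq_iff x_def y_def)
  define \<sigma> :: real where "\<sigma> = (if y \<ge> 0 then 1 else - 1)"
  have \<sigma>: "\<sigma> = 1 \<or> \<sigma> = - 1" "\<sigma> * y = \<bar>y\<bar>" by (auto simp: \<sigma>_def)
  \<comment> \<open>The condition on \<open>K\<close> says that \<open>z\<close> lies between the
    real axis and the ray with \<open>tan \<theta>1 = pi / (2 * K)\<close>, above or below according
    to \<open>\<sigma>\<close>. For fixed \<open>z\<close> it holds for all small
    \<open>K\<close>.\<close>
  have key: "norm (g z) \<le> C * 2 ^ M * exp (pi + K) * r ^ M * exp (2 * K * (x * \<bar>y\<bar>))"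
    if K: "0 < K" "K * \<bar>y\<bar> \<le> pi / 2 * x" for K
  proof -
    define \<theta>1 where "\<theta>1 = arctan (pi / (2 * K))"
    have \<theta>1: "0 < \<theta>1" "\<theta>1 < pi / 2" using K arctan_ubound[of "pi / (2 * K)"] by (auto simp: \<theta>1_def)
    have "\<bar>y / x\<bar> \<le> pi / (2 * K)" using K x by (simp add: field_simps)
    then have \<theta>: "\<bar>\<theta>\<bar> \<le> \<theta>1" unfolding \<theta>_def \<theta>1_def by (metis abs_arctan arctan_le_iff)
    have cpos: "cos \<theta>1 > 0" using \<theta>1 by (intro cos_gt_zero_pi) auto
    have tan: "tan \<theta>1 = pi / (2 * K)" by (simp add: \<theta>1_def tan_arctan)
    have "sin \<theta>1 = tan \<theta>1 * cos \<theta>1" using cpos by (simp add: tan_def)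
    then have "2 * K * sin \<theta>1 = 2 * K * (pi / (2 * K) * cos \<theta>1)" unfolding tan by (rule arg_cong)
    then have "2 * K * sin \<theta>1 = pi * cos \<theta>1" using K by simp
    moreover have "K * sin (2 * \<theta>1) = (2 * K * sin \<theta>1) * cos \<theta>1" by (simp add: sin_double)
    \<comment> \<open>On this ray the factor cancels the growth
      \<open>exp (pi * r\<^sup>2 * (cos \<theta>1)\<^sup>2)\<close> of \<open>g\<close>; this
      determines \<open>\<theta>1\<close>.\<close>
    ultimately have edge: "pi * (cos \<theta>1)\<^sup>2 - K * sin (2 * \<theta>1) = 0" by (simp only: power2_eq_square mult.assoc diff_self)
    define h where "h z = g z * exp (\<i> * of_real (\<sigma> * K) * z\<^sup>2)" for z
    have hhol: "h holomorphic_on UNIV" unfolding h_def[abs_def] by (intro holomorphic_intros hol)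
    have hnorm: "norm (h (of_real r * cis \<theta>)) = norm (g (of_real r * cis \<theta>)) * exp (- (\<sigma> * K * r\<^sup>2 * sin (2 * \<theta>)))" for r \<theta>
      by (simp add: h_def norm_mult norm_exp_eq_Re power_mult_distrib Complex.DeMoivre mult_ac)
    have gb: "norm (g (of_real r * cis \<theta>)) \<le> C * (1 + \<bar>r * sin \<theta>\<bar>) ^ M * exp (pi * r\<^sup>2 * (cos \<theta>)\<^sup>2)" for r \<theta>
      using bd[of "of_real r * cis \<theta>"] by (simp add: power_mult_distrib mult.assoc)
    have sabs: "\<bar>r * sin \<theta>\<bar> \<le> \<bar>r\<bar>" for r \<theta> :: real by (simp add: abs_mult mult_left_le)
    have pw: "(1 + \<bar>r * sin \<theta>\<bar>) ^ M \<le> 2 ^ M * r ^ M" if "r \<ge> 1" for r \<theta> :: real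
    proof -
      have "1 + \<bar>r * sin \<theta>\<bar> \<le> 2 * r" using sabs[of r \<theta>] that by linarith
      then have "(1 + \<bar>r * sin \<theta>\<bar>) ^ M \<le> (2 * r) ^ M" by (intro power_mono) auto
      then show ?thesis by (simp add: power_mult_distrib)
    qed
    define C2 where "C2 = C * 2 ^ M * exp (pi + K)"
    have C2: "C2 > 0" using C by (simp add: C2_def)
    have C2': "C * 2 ^ M \<le> C2" unfolding C2_def using C K mult_left_mono[of 1 "exp (pi + K)" "C * 2 ^ M"] by simp
    have hedge: "norm (h (of_real r * cis (\<sigma> * \<theta>1))) \<le> C2 * r ^ M" if r: "r \<ge> 1" for r
    proof -
      have sc: "cos (\<sigma> * \<theta>1) = cos \<theta>1" "\<sigma> * K * r\<^sup>2 * sin (2 * (\<sigma> * \<theta>1)) = K * r\<^sup>2 * sin (2 * \<theta>1)"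
        using \<sigma>(1) by auto
      have "norm (g (of_real r * cis (\<sigma> * \<theta>1))) \<le> C * (1 + \<bar>r * sin (\<sigma> * \<theta>1)\<bar>) ^ M * exp (pi * r\<^sup>2 * (cos \<theta>1)\<^sup>2)"
        using gb[of r "\<sigma> * \<theta>1"] unfolding sc .
      also have "\<dots> \<le> C * (2 ^ M * r ^ M) * exp (pi * r\<^sup>2 * (cos \<theta>1)\<^sup>2)"
        using C pw[OF r] by (intro mult_right_mono mult_left_mono) auto
      finally have "norm (h (of_real r * cis (\<sigma> * \<theta>1))) \<le> C * (2 ^ M * r ^ M) * exp (pi * r\<^sup>2 * (cos \<theta>1)\<^sup>2) * exp (- (K * r\<^sup>2 * sin (2 * \<theta>1)))"
        unfolding hnorm sc by (rule mult_right_mono) simp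
      also have "\<dots> = C * (2 ^ M * r ^ M) * exp (r\<^sup>2 * (pi * (cos \<theta>1)\<^sup>2 - K * sin (2 * \<theta>1)))"
        by (simp add: exp_add[symmetric] algebra_simps)
      also have "\<dots> = C * 2 ^ M * r ^ M" unfolding edge by simp
      also have "\<dots> \<le> C2 * r ^ M" using C2' r by (intro mult_right_mono) auto
      finally show ?thesis .
    qed
    have hre: "norm (h (of_real r * cis 0)) \<le> C2 * r ^ M" if r: "r \<ge> 1" for r
    proof -
      have "norm (h (of_real r * cis 0)) \<le> C * (1 + r) ^ M" using re[of r] r unfolding hnorm by simp
      also have "\<dots> \<le> C * (2 * r) ^ M" using C r by (intro mult_left_mono power_mono) auto
      also have "\<dots> \<le> C2 * r ^ M" using C2' r by (simp add: power_mult_distrib mult_right_mono mult.assoc[symmetric])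
      finally show ?thesis .
    qed
    have hK: "exp (- (\<sigma> * K * r\<^sup>2 * sin (2 * \<theta>))) \<le> exp (K * r\<^sup>2)" for r \<theta> :: real
    proof -
      have "- (\<sigma> * sin (2 * \<theta>)) \<le> 1" using \<sigma>(1) abs_sin_le_one[of "2 * \<theta>"] by (auto simp: abs_le_iff)
      then have "K * r\<^sup>2 * - (\<sigma> * sin (2 * \<theta>)) \<le> K * r\<^sup>2 * 1" using K by (intro mult_left_mono) auto
      then show ?thesis by (simp add: mult_ac)
    qed
    have cos2: "exp (pi * r\<^sup>2 * (cos \<theta>)\<^sup>2) \<le> exp (pi * r\<^sup>2)" for r \<theta> :: real
      by (simp add: abs_square_le_1 mult_left_le)
    have arc: "norm (h (cis \<theta>)) \<le> C2" for \<theta>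
    proof -
      have "norm (h (cis \<theta>)) \<le> (C * 2 ^ M * exp pi) * exp K"
      proof -
        have "norm (g (cis \<theta>)) \<le> C * (1 + \<bar>sin \<theta>\<bar>) ^ M * exp (pi * (cos \<theta>)\<^sup>2)" using gb[of 1 \<theta>] by simp
        also have "\<dots> \<le> C * 2 ^ M * exp pi"
          using C pw[of 1 \<theta>] cos2[of 1 \<theta>] by (intro mult_mono) auto
        finally have "norm (g (cis \<theta>)) \<le> C * 2 ^ M * exp pi" .
        then show ?thesis using hnorm[of 1 \<theta>] hK[of 1 \<theta>] C by (simp add: mult_mono)
      qed
      then show ?thesis by (simp add: C2_def exp_add)
    qed
    have growth: "norm (h z) \<le> exp ((C + real M + pi + K) * (1 + (norm z)\<^sup>2))" for z
    proof -
      define r \<theta> where "r = norm z" and "\<theta> = Arg z"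
      have z: "z = of_real r * cis \<theta>" using rcis_cmod_Arg[of z] by (simp add: r_def \<theta>_def rcis_def)
      have r0: "r \<ge> 0" by (simp add: r_def)
      have "(1 + \<bar>r * sin \<theta>\<bar>) ^ M \<le> (1 + r) ^ M" using sabs[of r \<theta>] r0 by (intro power_mono) auto
      also have "\<dots> \<le> exp r ^ M" using r0 by (intro power_mono) auto
      also have "\<dots> = exp (real M * r)" by (simp add: exp_of_nat_mult)
      also have "\<dots> \<le> exp (real M * (1 + r\<^sup>2))"
      proof -
        have "0 \<le> (r - 1)\<^sup>2" by simp
        then have "2 * r \<le> 1 + r\<^sup>2" by (simp add: power2_diff)
        then have "r \<le> 1 + r\<^sup>2" using r0 by linarith
        then show ?thesis by (simp add: mult_left_mono)
      qed
      finally have 1: "(1 + \<bar>r * sin \<theta>\<bar>) ^ M \<le> exp (real M * (1 + r\<^sup>2))" .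
      have "norm (h z) \<le> (C * (1 + \<bar>r * sin \<theta>\<bar>) ^ M * exp (pi * r\<^sup>2 * (cos \<theta>)\<^sup>2)) * exp (K * r\<^sup>2)"
        unfolding z hnorm using C by (intro mult_mono gb hK) auto
      also have "\<dots> \<le> (exp C * exp (real M * (1 + r\<^sup>2)) * exp (pi * r\<^sup>2)) * exp (K * r\<^sup>2)"
        using C by (intro mult_right_mono mult_mono self_le_exp 1 cos2) auto
      also have "\<dots> = exp (C + real M * (1 + r\<^sup>2) + pi * r\<^sup>2 + K * r\<^sup>2)" by (simp add: exp_add)
      also have "\<dots> \<le> exp ((C + real M + pi + K) * (1 + (norm z)\<^sup>2))"
        using C K by (simp add: r_def algebra_simps)
      finally show ?thesis .
    qed
    have "norm (h (of_real r * cis \<theta>)) \<le> C2 * r ^ M"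
    proof (cases "y \<ge> 0")
      case True
      then have s: "\<sigma> = 1" and t: "\<theta> \<ge> 0" using x by (auto simp: \<sigma>_def \<theta>_def)
      show ?thesis
        by (rule phragmen_lindelof_sector[where \<alpha>=0 and \<beta>=\<theta>1, OF hhol _ _ growth C2])
           (use \<theta>1 t \<theta> r hre hedge arc s in auto)
    next
      case False
      then have s: "\<sigma> = - 1" and t: "\<theta> \<le> 0" using x by (auto simp: \<sigma>_def \<theta>_def divide_nonpos_pos)
      show ?thesis
        by (rule phragmen_lindelof_sector[where \<alpha>="- \<theta>1" and \<beta>=0, OF hhol _ _ growth C2])
           (use \<theta>1 t \<theta> r hre hedge arc s in auto)
    qed
    then have "norm (g z) * exp (- (\<sigma> * K * r\<^sup>2 * sin (2 * \<theta>))) \<le> C2 * r ^ M" unfolding hnorm zr .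
    from le_mult_exp_minus[OF this] have "norm (g z) \<le> C2 * r ^ M * exp (\<sigma> * K * r\<^sup>2 * sin (2 * \<theta>))" by simp
    also have "\<sigma> * K * r\<^sup>2 * sin (2 * \<theta>) = 2 * K * ((r * cos \<theta>) * (\<sigma> * (r * sin \<theta>)))"
      by (simp add: sin_double power2_eq_square)
    also have "\<dots> = 2 * K * (x * \<bar>y\<bar>)" unfolding cs \<sigma>(2) ..
    finally show ?thesis by (simp add: C2_def)
  qed
  have "((\<lambda>K. C * 2 ^ M * exp (pi + K) * r ^ M * exp (2 * K * (x * \<bar>y\<bar>))) \<longlongrightarrow> C * 2 ^ M * exp (pi + 0) * r ^ M * exp (2 * 0 * (x * \<bar>y\<bar>))) (at_right 0)"
    by (intro tendsto_intros)
  moreover have "\<forall>\<^sub>F K in at_right 0. norm (g z) \<le> C * 2 ^ M * exp (pi + K) * r ^ M * exp (2 * K * (x * \<bar>y\<bar>))"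
  proof -
    have "((\<lambda>K. K * \<bar>y\<bar>) \<longlongrightarrow> 0 * \<bar>y\<bar>) (at_right 0)" by (intro tendsto_intros)
    then have "\<forall>\<^sub>F K in at_right 0. K * \<bar>y\<bar> < pi / 2 * x" using x by (intro order_tendstoD(2)) auto
    moreover have "\<forall>\<^sub>F K in at_right (0::real). 0 < K" by (rule eventually_at_right_less)
    ultimately show ?thesis by eventually_elim (use key in auto)
  qed
  ultimately have "norm (g z) \<le> C * 2 ^ M * exp (pi + 0) * r ^ M * exp (2 * 0 * (x * \<bar>y\<bar>))"
    by (intro tendsto_lowerbound) auto
  then show ?thesis by (simp add: r_def)
qed

text \<open>Both rates have to be exactly \<open>pi\<close>: then
  \<open>exp (pi * z\<^sup>2)\<close> cancels the decay on the real axis as well as the growth of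
  the entire extension on the imaginary axis, leaving polynomial bounds on both.\<close>

lemma hardy_polynomial:
  fixes \<phi> \<psi> :: "real \<Rightarrow> complex"
  assumes \<psi>m: "\<psi> \<in> borel_measurable borel" and \<psi>: "\<And>\<xi>. norm (\<psi> \<xi>) \<le> D * (1 + \<bar>\<xi>\<bar>) ^ M * exp (- pi * \<xi>\<^sup>2)"
    and \<phi>: "\<And>x. norm (\<phi> x) \<le> D * (1 + \<bar>x\<bar>) ^ M * exp (- pi * x\<^sup>2)"
    and \<phi>\<psi>: "\<And>t. \<phi> t = fourier_laplace \<psi> (of_real t)"
  obtains p :: "complex poly" where "\<And>x. \<phi> x = poly p (complex_of_real x) * complex_of_real (exp (- pi * x\<^sup>2))"
proof -
  define \<Phi> where "\<Phi> = fourier_laplace \<psi>"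
  have hol: "\<Phi> holomorphic_on UNIV"
    unfolding \<Phi>_def holomorphic_on_def field_differentiable_def
    using fourier_laplace_has_field_derivative[OF \<psi>m pi_gt_zero \<psi>] has_field_derivative_at_within by blast
  obtain C1 where C1: "C1 > 0" "\<And>z. norm (\<Phi> z) \<le> C1 * (1 + \<bar>Im z\<bar>) ^ M * exp (pi\<^sup>2 / pi * (Im z)\<^sup>2)"
    using fourier_laplace_growth[OF \<psi>m pi_gt_zero \<psi>] unfolding \<Phi>_def by blast
  define C where "C = max D C1"
  have C: "C > 0" "D \<le> C" "C1 \<le> C" using C1 by (auto simp: C_def)
  define g where "g z = \<Phi> z * exp (of_real pi * z\<^sup>2)" for z
  have ghol: "g holomorphic_on UNIV" unfolding g_def[abs_def] by (intro holomorphic_intros hol)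
  have gim: "norm (g z) \<le> C * (1 + \<bar>Im z\<bar>) ^ M * exp (pi * (Re z)\<^sup>2)" for z
  proof -
    have "norm (g z) = norm (\<Phi> z) * exp (pi * ((Re z)\<^sup>2 - (Im z)\<^sup>2))"
      by (simp add: g_def norm_mult norm_exp_eq_Re power2_eq_square)
    also have "\<dots> \<le> (C * (1 + \<bar>Im z\<bar>) ^ M * exp (pi * (Im z)\<^sup>2)) * exp (pi * ((Re z)\<^sup>2 - (Im z)\<^sup>2))"
    proof (intro mult_right_mono)
      have "C1 * (1 + \<bar>Im z\<bar>) ^ M * exp (pi * (Im z)\<^sup>2) \<le> C * (1 + \<bar>Im z\<bar>) ^ M * exp (pi * (Im z)\<^sup>2)"
        using C by (intro mult_right_mono) auto
      moreover have "norm (\<Phi> z) \<le> C1 * (1 + \<bar>Im z\<bar>) ^ M * exp (pi * (Im z)\<^sup>2)"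
        using C1(2)[of z] by (simp add: power2_eq_square)
      ultimately show "norm (\<Phi> z) \<le> C * (1 + \<bar>Im z\<bar>) ^ M * exp (pi * (Im z)\<^sup>2)" by linarith
    qed auto
    also have "\<dots> = C * (1 + \<bar>Im z\<bar>) ^ M * exp (pi * (Re z)\<^sup>2)" by (simp add: mult.assoc exp_add[symmetric] algebra_simps)
    finally show ?thesis .
  qed
  have gre: "norm (g (of_real x)) \<le> C * (1 + \<bar>x\<bar>) ^ M" for x
  proof -
    have "norm (g (of_real x)) = norm (\<phi> x) * exp (pi * x\<^sup>2)"
      by (simp add: g_def \<Phi>_def \<phi>\<psi> norm_mult norm_exp_eq_Re power2_eq_square)
    also have "\<dots> \<le> (D * (1 + \<bar>x\<bar>) ^ M * exp (- pi * x\<^sup>2)) * exp (pi * x\<^sup>2)" by (intro mult_right_mono \<phi>) auto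
    also have "\<dots> = D * (1 + \<bar>x\<bar>) ^ M" by (simp add: mult.assoc exp_add[symmetric])
    also have "\<dots> \<le> C * (1 + \<bar>x\<bar>) ^ M" using C by (intro mult_right_mono) auto
    finally show ?thesis .
  qed
  have bound: "norm (g z) \<le> C * 2 ^ M * exp pi * norm z ^ M" if z: "1 \<le> norm z" for z
  proof -
    consider "Re z > 0" | "Re z = 0" | "Re z < 0" by linarith
    then show ?thesis
    proof cases
      case 1
      then show ?thesis by (intro hardy_right_half_plane[OF ghol C(1) gre gim z])
    next
      \<comment> \<open>The imaginary axis belongs to none of the sectors, but there the general
        bound contains no exponential growth.\<close>
      case 2
      then have "norm (g z) \<le> C * (1 + norm z) ^ M" using gim[of z] by (simp add: cmod_def)
      also have "\<dots> \<le> C * (2 * norm z) ^ M" using C z by (intro mult_left_mono power_mono) auto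
      also have "\<dots> = C * 2 ^ M * 1 * norm z ^ M" by (simp add: power_mult_distrib)
      also have "\<dots> \<le> C * 2 ^ M * exp pi * norm z ^ M" using C by (intro mult_right_mono mult_left_mono) auto
      finally show ?thesis .
    next
      case 3
      have "(g \<circ> (\<lambda>z. - z)) holomorphic_on UNIV"
        by (intro holomorphic_on_compose holomorphic_intros holomorphic_on_subset[OF ghol]) auto
      then have "(\<lambda>z. g (- z)) holomorphic_on UNIV" by (simp add: o_def)
      from hardy_right_half_plane[OF this C(1), of M "- z"] show ?thesis
        using gre[of "- _"] gim[of "- _"] z 3 by simp
    qed
  qed
  define p where "p = (\<Sum>k\<le>M. monom ((deriv ^^ k) g 0 / fact k) k)"
  have gp: "g z = poly p z" for z
    unfolding p_def poly_sum poly_monom by (rule Liouville_polynomial[OF ghol bound])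
  show ?thesis
  proof (rule that[of p])
    fix x :: real
    have "exp (complex_of_real pi * (complex_of_real x)\<^sup>2) * complex_of_real (exp (- pi * x\<^sup>2)) = 1"
      by (simp add: exp_of_real[symmetric] exp_add[symmetric])
    then show "\<phi> x = poly p (complex_of_real x) * complex_of_real (exp (- pi * x\<^sup>2))"
      unfolding gp[symmetric] g_def \<phi>\<psi> \<Phi>_def by (simp add: mult.assoc)
  qed
qed

section \<open>Supercritical sequences\<close>

lemma two_sided_floor:
  fixes l :: "int \<Rightarrow> real"
  assumes "filterlim l at_top at_top" "filterlim l at_bot at_bot"
  obtains i where "l i \<le> y" "y < l (i + 1)"
proof -
  have "\<forall>\<^sub>F j in at_bot. l j \<le> y" "\<forall>\<^sub>F j in at_top. y < l j"
    using assms unfolding filterlim_at_bot filterlim_at_top_dense by blast+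
  then obtain a b where ab: "\<And>j. j \<le> a \<Longrightarrow> l j \<le> y" "\<And>j. j \<ge> b \<Longrightarrow> y < l j"
    unfolding eventually_at_bot_linorder eventually_at_top_linorder by blast
  have "\<exists>i. l i \<le> y \<and> y < l (i + 1)"
  proof (rule ccontr)
    assume no: "\<nexists>i. l i \<le> y \<and> y < l (i + 1)"
    have "l (a + int n) \<le> y" for n
    proof (induction n)
      case (Suc n)
      then have "\<not> y < l (a + int n + 1)" using no by blast
      then show ?case by (simp add: algebra_simps)
    qed (use ab in simp)
    moreover have "b \<le> a + int (nat (b - a))" by simp
    ultimately show False using ab(2) by (meson not_le)
  qed
  then show ?thesis using that by blast
qed

text \<open>The condition of \<open>sampling\<close> at a single positive point; negative points are
  reached through the reflected sequence.\<close>

definition node_chain_at :: "real set \<Rightarrow> real \<Rightarrow> real \<Rightarrow> real \<Rightarrow> bool" where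
  "node_chain_at S \<gamma> \<eta> x \<longleftrightarrow> (\<exists>(t :: nat \<Rightarrow> real) n. t 0 \<le> x - \<eta> * x \<and> x + \<eta> * x \<le> t n \<and>
     (\<forall>i\<le>n. t i \<in> S \<and> x / 2 \<le> t i \<and> t i \<le> 2 * x) \<and>
     (\<forall>i<n. t i \<le> t (Suc i) \<and> t (Suc i) - t i \<le> \<gamma> / (2 * x)))"

text \<open>The nodes of a chain around \<open>x\<close> are at least
  \<open>(1 - 2 * \<eta>) * x\<close>, so the gaps are at most
  \<open>g / ((1 - 2 * \<eta>) * x)\<close>. The hypothesis relating \<open>g\<close>,
  \<open>\<eta>\<close> and \<open>\<gamma>\<close> says precisely that this does not exceed
  \<open>\<gamma> / (2 * x)\<close>.\<close>

lemma node_chain: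
  fixes l :: "int \<Rightarrow> real"
  assumes mono: "strict_mono l" and lim: "filterlim l at_top at_top" "filterlim l at_bot at_bot"
    and gap: "\<forall>\<^sub>F j in at_top. \<bar>l j\<bar> * (l (j + 1) - l j) \<le> g"
    and g: "0 < g" "g \<le> 1" and \<eta>: "0 < \<eta>" "\<eta> \<le> 1 / 8" and \<gamma>: "2 * g \<le> (1 - 2 * \<eta>) * \<gamma>"
  obtains X where "X > 0" "\<And>x. x \<ge> X \<Longrightarrow> node_chain_at (range l) \<gamma> \<eta> x"
proof -
  have "\<forall>\<^sub>F j in at_top. 1 \<le> l j" using lim(1) unfolding filterlim_at_top by blast
  with gap have "\<forall>\<^sub>F j in at_top. 1 \<le> l j \<and> \<bar>l j\<bar> * (l (j + 1) - l j) \<le> g" by eventually_elim simp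
  then obtain J where J: "\<And>j. j \<ge> J \<Longrightarrow> 1 \<le> l j \<and> \<bar>l j\<bar> * (l (j + 1) - l j) \<le> g"
    unfolding eventually_at_top_linorder by blast
  have incr: "l i < l j \<longleftrightarrow> i < j" for i j using mono by (simp add: strict_mono_less)
  \<comment> \<open>From \<open>1 / \<eta>\<close> on, \<open>\<eta> * x\<close> is at least 1 and
    hence at least one gap of the chain, so the extra node at either end does not overshoot much.
    The term \<open>2 * l J\<close> keeps the chain among the indices where the gap bound
    holds.\<close>
  define X where "X = max (1 / \<eta>) (2 * l J)"
  have X: "X > 0" using \<eta> by (simp add: X_def less_max_iff_disj)
  show ?thesis
  proof (rule that[OF X])
    fix x assume x: "x \<ge> X"
    have x1: "\<eta> * x \<ge> 1" "x \<ge> 2 * l J" using x \<eta> by (auto simp: X_def field_simps)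
    have x0: "x > 0" using x X by linarith
    have \<eta>x: "\<eta> * x \<le> 1 / 8 * x" using \<eta> x0 by (intro mult_right_mono) auto
    obtain i where i: "l i \<le> x - \<eta> * x" "x - \<eta> * x < l (i + 1)" by (rule two_sided_floor[OF lim])
    obtain k where k: "l k \<le> x + \<eta> * x" "x + \<eta> * x < l (k + 1)" by (rule two_sided_floor[OF lim])
    have "l J < l (i + 1)" using x1 \<eta>x i x0 by linarith
    then have iJ: "i \<ge> J" using incr by simp
    have "l i < l (k + 1)" using i k x1 by linarith
    then have ik: "i \<le> k" using incr by simp
    have gap1: "l (j + 1) - l j \<le> g / l j" "l (j + 1) - l j \<le> 1" if "j \<ge> i" for j
    proof -
      have lj: "l j \<ge> 1" "l j * (l (j + 1) - l j) \<le> g" using J[of j] iJ that by auto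
      then show 1: "l (j + 1) - l j \<le> g / l j" by (simp add: pos_le_divide_eq mult.commute)
      have "g / l j \<le> 1" using lj(1) g by (simp add: field_simps)
      then show "l (j + 1) - l j \<le> 1" using 1 by linarith
    qed
    have li: "l i \<ge> (1 - 2 * \<eta>) * x" using i gap1(2)[of i] x1 by (simp add: algebra_simps)
    have mono': "l j \<le> l j'" if "j \<le> j'" for j j' using incr that by (metis le_less order_refl)
    have gap2: "l (j + 1) - l j \<le> \<gamma> / (2 * x)" if "j \<ge> i" for j
    proof -
      define q where "q = (1 - 2 * \<eta>) * x"
      have pos: "q > 0" unfolding q_def using \<eta> x0 by (intro mult_pos_pos) auto
      have "q \<le> l j" using li mono'[OF that] unfolding q_def by linarith
      then have "g / l j \<le> g / q" using pos g by (intro divide_left_mono) auto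
      also have "\<dots> \<le> \<gamma> / (2 * x)"
      proof -
        have "2 * g * x \<le> (1 - 2 * \<eta>) * \<gamma> * x" using \<gamma> x0 by (intro mult_right_mono) auto
        also have "\<dots> = \<gamma> * q" by (simp add: q_def)
        finally show ?thesis using pos x0 by (simp add: field_simps)
      qed
      finally show ?thesis using gap1(1)[OF that] by linarith
    qed
    \<comment> \<open>The chain runs from index \<open>i\<close> to \<open>k + 1\<close>, one past
      the last node not exceeding \<open>x + \<eta> * x\<close>, so that it covers the right
      end.\<close>
    define n where "n = nat (k + 1 - i)"
    define t where "t m = l (i + int m)" for m
    have tn: "t n = l (k + 1)" using ik by (simp add: t_def n_def)
    show "node_chain_at (range l) \<gamma> \<eta> x"
      unfolding node_chain_at_def
    proof (intro exI conjI allI impI)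
      show "t 0 \<le> x - \<eta> * x" using i by (simp add: t_def)
      show "x + \<eta> * x \<le> t n" using k tn by simp
    next
      fix m assume m: "m \<le> n"
      show "t m \<in> range l" by (simp add: t_def)
      have "(1 - 2 * \<eta>) * x = x - 2 * (\<eta> * x)" by (simp add: algebra_simps)
      then show "x / 2 \<le> t m" using li mono'[of i "i + int m", simplified] \<eta>x x0 unfolding t_def by linarith
      have "i + int m \<le> k + 1" using m ik by (simp add: n_def)
      then have "t m \<le> l (k + 1)" unfolding t_def by (rule mono')
      then show "t m \<le> 2 * x" using gap1(2)[OF ik] k x1 \<eta>x by linarith
    next
      fix m assume m: "m < n"
      show "t m \<le> t (Suc m)" unfolding t_def by (rule mono') simp
      show "t (Suc m) - t m \<le> \<gamma> / (2 * x)" using gap2[of "i + int m"] by (simp add: t_def add_ac)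
    qed
  qed
qed

lemma sampling_of_sequence:
  fixes l :: "int \<Rightarrow> real"
  assumes l: "two_sided_sequence l" and lim: "limsup_both (\<lambda>j. \<bar>l j\<bar> * (l (j + 1) - l j)) < ereal (1 / 2)"
  obtains \<gamma> \<eta> X where "0 < \<gamma>" "\<gamma> < 1" "0 < \<eta>" "X > 0" "sampling (range l) \<gamma> \<eta> X"
proof -
  have mono: "strict_mono l" and top: "filterlim l at_top at_top" and bot: "filterlim l at_bot at_bot"
    using l by (auto simp: two_sided_sequence_def)
  obtain g0 where g0: "limsup_both (\<lambda>j. \<bar>l j\<bar> * (l (j + 1) - l j)) < ereal g0" "ereal g0 < ereal (1 / 2)"
    using ereal_dense2[OF lim] by blast
  define g where "g = max g0 (1 / 4)"
  have g: "0 < g" "g < 1 / 2" "g0 \<le> g" using g0(2) by (auto simp: g_def)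
  have ev: "\<forall>\<^sub>F j in at_top. \<bar>l j\<bar> * (l (j + 1) - l j) \<le> g" "\<forall>\<^sub>F j in at_bot. \<bar>l j\<bar> * (l (j + 1) - l j) \<le> g"
  proof -
    have "Limsup at_top (\<lambda>j. ereal (\<bar>l j\<bar> * (l (j + 1) - l j))) < ereal g0" "Limsup at_bot (\<lambda>j. ereal (\<bar>l j\<bar> * (l (j + 1) - l j))) < ereal g0"
      using g0(1) by (auto simp: limsup_both_def)
    then have "\<forall>\<^sub>F j in at_top. ereal (\<bar>l j\<bar> * (l (j + 1) - l j)) < ereal g0" "\<forall>\<^sub>F j in at_bot. ereal (\<bar>l j\<bar> * (l (j + 1) - l j)) < ereal g0"
      by (auto dest: Limsup_lessD)
    then show "\<forall>\<^sub>F j in at_top. \<bar>l j\<bar> * (l (j + 1) - l j) \<le> g" "\<forall>\<^sub>F j in at_bot. \<bar>l j\<bar> * (l (j + 1) - l j) \<le> g"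
      using g(3) by (auto elim: eventually_mono)
  qed
  \<comment> \<open>The midpoint of \<open>2 * g\<close> and 1. Being above \<open>2 * g\<close> it
    leaves room for a positive \<open>\<eta>\<close> with
    \<open>2 * g \<le> (1 - 2 * \<eta>) * \<gamma>\<close>.\<close>
  define \<gamma> where "\<gamma> = g + 1 / 2"
  define \<eta> where "\<eta> = min (1 / 8) ((\<gamma> - 2 * g) / (2 * \<gamma>))"
  have \<gamma>: "0 < \<gamma>" "\<gamma> < 1" "2 * g < \<gamma>" using g by (auto simp: \<gamma>_def)
  have "0 < \<eta>" using \<gamma> by (simp add: \<eta>_def)
  moreover have "\<eta> \<le> 1 / 8" unfolding \<eta>_def by (rule min.cobounded1)
  moreover have "\<eta> \<le> (\<gamma> - 2 * g) / (2 * \<gamma>)" unfolding \<eta>_def by (rule min.cobounded2)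
  ultimately have \<eta>: "0 < \<eta>" "\<eta> \<le> 1 / 8" "\<eta> \<le> (\<gamma> - 2 * g) / (2 * \<gamma>)" by blast+
  have \<gamma>\<eta>: "2 * g \<le> (1 - 2 * \<eta>) * \<gamma>" using \<eta>(3) \<gamma> by (simp add: field_simps)
  \<comment> \<open>Reversing both sign and index gives again an increasing two-sided sequence,
    whose behaviour at plus infinity is that of \<open>l\<close> at minus infinity.\<close>
  define l' where "l' j = - l (- j)" for j
  have mono': "strict_mono l'" using mono by (auto simp: strict_mono_def l'_def)
  have neg: "filterlim (\<lambda>j::int. - j - c) at_bot at_top" "filterlim (\<lambda>j::int. - j) at_top at_bot" for c
    unfolding filterlim_at_bot filterlim_at_top eventually_at_top_linorder eventually_at_bot_linorder
    by presburger+
  have top': "filterlim l' at_top at_top" unfolding l'_def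
    using filterlim_compose[OF filterlim_uminus_at_top_at_bot filterlim_compose[OF bot neg(1)[of 0]]] by simp
  have bot': "filterlim l' at_bot at_bot" unfolding l'_def
    by (rule filterlim_compose[OF filterlim_uminus_at_bot_at_top filterlim_compose[OF top neg(2)]])
  have gap': "\<forall>\<^sub>F j in at_top. \<bar>l' j\<bar> * (l' (j + 1) - l' j) \<le> g"
  proof -
    have "\<forall>\<^sub>F j in at_top. \<bar>l (- j - 1)\<bar> * (l (- j - 1 + 1) - l (- j - 1)) \<le> g"
      using neg(1)[of 1] ev(2) unfolding filterlim_iff by blast
    moreover have "\<forall>\<^sub>F j in at_top. 0 \<le> l' j" using top' unfolding filterlim_at_top by blast
    ultimately show ?thesis
    proof eventually_elim
      case (elim j)
      have le: "l' j \<le> l' (j + 1)" using mono' by (simp add: strict_mono_less_eq)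
      \<comment> \<open>The gap of \<open>l'\<close> at \<open>j\<close> is the gap of
        \<open>l\<close> at \<open>- j - 1\<close>, whose bound carries the weight of the outer node
        \<open>l' (j + 1)\<close>. For nonnegative \<open>l' j\<close> this weight is the larger
        one, so the shift by one index is harmless.\<close>
      have "\<bar>l' j\<bar> * (l' (j + 1) - l' j) \<le> \<bar>l' (j + 1)\<bar> * (l' (j + 1) - l' j)"
        using le elim(2) by (intro mult_right_mono) auto
      also have "\<dots> = \<bar>l (- j - 1)\<bar> * (l (- j - 1 + 1) - l (- j - 1))" by (simp add: l'_def)
      finally show ?case using elim(1) by linarith
    qed
  qed
  have g1: "g \<le> 1" using g by simp
  obtain X1 where X1: "X1 > 0" "\<And>x. x \<ge> X1 \<Longrightarrow> node_chain_at (range l) \<gamma> \<eta> x"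
    using node_chain[OF mono top bot ev(1) g(1) g1 \<eta>(1,2) \<gamma>\<eta>] by blast
  obtain X2 where X2: "X2 > 0" "\<And>x. x \<ge> X2 \<Longrightarrow> node_chain_at (range l') \<gamma> \<eta> x"
    using node_chain[OF mono' top' bot' gap' g(1) g1 \<eta>(1,2) \<gamma>\<eta>] by blast
  define X where "X = max X1 X2"
  have X: "X > 0" using X1(1) by (simp add: X_def)
  have "sampling (range l) \<gamma> \<eta> X"
    unfolding sampling_def
  proof (intro allI impI)
    fix x assume x: "\<bar>x\<bar> \<ge> X"
    show "\<exists>(t :: nat \<Rightarrow> real) n. t 0 \<le> x - \<eta> * \<bar>x\<bar> \<and> x + \<eta> * \<bar>x\<bar> \<le> t n \<and>
     (\<forall>i\<le>n. t i \<in> range l \<and> \<bar>x\<bar> / 2 \<le> \<bar>t i\<bar> \<and> \<bar>t i\<bar> \<le> 2 * \<bar>x\<bar>) \<and>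
     (\<forall>i<n. t i \<le> t (Suc i) \<and> t (Suc i) - t i \<le> \<gamma> / (2 * \<bar>x\<bar>))"
    proof (cases "x \<ge> 0")
      case True
      then have "x \<ge> X1" using x by (simp add: X_def)
      from X1(2)[OF this, unfolded node_chain_at_def] obtain t :: "nat \<Rightarrow> real" and n where t: "t 0 \<le> x - \<eta> * x" "x + \<eta> * x \<le> t n"
        "\<And>i. i \<le> n \<Longrightarrow> t i \<in> range l \<and> x / 2 \<le> t i \<and> t i \<le> 2 * x"
        "\<And>i. i < n \<Longrightarrow> t i \<le> t (Suc i) \<and> t (Suc i) - t i \<le> \<gamma> / (2 * x)" by blast
      have "\<bar>t i\<bar> = t i" if "i \<le> n" for i using t(3)[OF that] True by linarith
      then show ?thesis using t True by (intro exI[of _ t] exI[of _ n]) auto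
    next
      case False
      define u where "u = - x"
      have u: "u > 0" "\<bar>x\<bar> = u" "x = - u" using False by (auto simp: u_def)
      have "u \<ge> X2" using x u by (simp add: X_def)
      from X2(2)[OF this, unfolded node_chain_at_def] obtain t :: "nat \<Rightarrow> real" and n where t: "t 0 \<le> u - \<eta> * u" "u + \<eta> * u \<le> t n"
        "\<And>i. i \<le> n \<Longrightarrow> t i \<in> range l' \<and> u / 2 \<le> t i \<and> t i \<le> 2 * u"
        "\<And>i. i < n \<Longrightarrow> t i \<le> t (Suc i) \<and> t (Suc i) - t i \<le> \<gamma> / (2 * u)" by blast
      define t' where "t' i = - t (n - i)" for i
      have "t' i \<in> range l" if "i \<le> n" for i
        using t(3)[of "n - i"] by (auto simp: t'_def l'_def)
      moreover have "\<bar>x\<bar> / 2 \<le> \<bar>t' i\<bar> \<and> \<bar>t' i\<bar> \<le> 2 * \<bar>x\<bar>" if "i \<le> n" for i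
        using t(3)[of "n - i"] u by (auto simp: t'_def)
      moreover have "t' i \<le> t' (Suc i) \<and> t' (Suc i) - t' i \<le> \<gamma> / (2 * \<bar>x\<bar>)" if "i < n" for i
        using t(4)[of "n - Suc i"] that u by (auto simp: t'_def Suc_diff_Suc)
      moreover have "t' 0 \<le> x - \<eta> * \<bar>x\<bar>" "x + \<eta> * \<bar>x\<bar> \<le> t' n" using t(1,2) u by (auto simp: t'_def)
      ultimately show ?thesis by blast
    qed
  qed
  from that[OF \<gamma>(1,2) \<eta>(1) X this] show ?thesis .
qed

lemma sampling_mono:
  assumes "sampling S \<gamma> \<eta> X" "\<gamma> \<le> \<gamma>'" "\<eta>' \<le> \<eta>" "X \<le> X'"
  shows "sampling S \<gamma>' \<eta>' X'"
  unfolding sampling_def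
proof (intro allI impI)
  fix x :: real assume "X' \<le> \<bar>x\<bar>"
  then have "X \<le> \<bar>x\<bar>" using assms by simp
  then obtain t :: "nat \<Rightarrow> real" and n where t: "t 0 \<le> x - \<eta> * \<bar>x\<bar>" "x + \<eta> * \<bar>x\<bar> \<le> t n"
     "\<forall>i\<le>n. t i \<in> S \<and> \<bar>x\<bar> / 2 \<le> \<bar>t i\<bar> \<and> \<bar>t i\<bar> \<le> 2 * \<bar>x\<bar>"
     "\<forall>i<n. t i \<le> t (Suc i) \<and> t (Suc i) - t i \<le> \<gamma> / (2 * \<bar>x\<bar>)"
    using assms(1) unfolding sampling_def by blast
  have "\<eta>' * \<bar>x\<bar> \<le> \<eta> * \<bar>x\<bar>" "\<gamma> / (2 * \<bar>x\<bar>) \<le> \<gamma>' / (2 * \<bar>x\<bar>)"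
    using assms by (auto intro: mult_right_mono divide_right_mono)
  then show "\<exists>(t :: nat \<Rightarrow> real) n. t 0 \<le> x - \<eta>' * \<bar>x\<bar> \<and> x + \<eta>' * \<bar>x\<bar> \<le> t n \<and>
     (\<forall>i\<le>n. t i \<in> S \<and> \<bar>x\<bar> / 2 \<le> \<bar>t i\<bar> \<and> \<bar>t i\<bar> \<le> 2 * \<bar>x\<bar>) \<and>
     (\<forall>i<n. t i \<le> t (Suc i) \<and> t (Suc i) - t i \<le> \<gamma>' / (2 * \<bar>x\<bar>))"
    using t by (intro exI[of _ t] exI[of _ n]) force
qed


section \<open>Integrability, degree and conclusion\<close>

text \<open>For \<open>u = norm (k x)\<close> the mean inequality gives
  \<open>u \<le> (1 + x\<^sup>2) * u\<^sup>2 + 1 / (1 + x\<^sup>2)\<close>, and both terms are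
  integrable.\<close>

lemma integrable_of_second_moment:
  fixes k :: "real \<Rightarrow> complex"
  assumes [measurable]: "k \<in> borel_measurable borel"
    and fin: "(\<integral>\<^sup>+x. ennreal ((1 + x\<^sup>2) * (norm (k x))\<^sup>2) \<partial>lborel) < \<infinity>"
  shows "integrable lborel k"
proof (rule Bochner_Integration.integrable_bound)
  have 1: "integrable lborel (\<lambda>x. (1 + x\<^sup>2) * (norm (k x))\<^sup>2)"
    using fin by (intro integrableI_nonneg) auto
  have 2: "integrable lborel (\<lambda>x::real. inverse (1 + x\<^sup>2))"
    using integrable_inverse_1_plus_square by (simp add: set_integrable_def einterval_def)
  show "integrable lborel (\<lambda>x. (1 + x\<^sup>2) * (norm (k x))\<^sup>2 + inverse (1 + x\<^sup>2))"
    using 1 2 by simp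
  show "AE x in lborel. norm (k x) \<le> norm ((1 + x\<^sup>2) * (norm (k x))\<^sup>2 + inverse (1 + x\<^sup>2))"
  proof (rule AE_I2)
    fix x :: real
    have p: "1 + x\<^sup>2 > 0" by (simp add: add_pos_nonneg)
    define A B where "A = (1 + x\<^sup>2) * (norm (k x))\<^sup>2" and "B = inverse (1 + x\<^sup>2)"
    have "norm (k x) * 1 \<le> ((1 + x\<^sup>2) * (norm (k x))\<^sup>2 + 1\<^sup>2 / (1 + x\<^sup>2)) / 2" by (rule weighted_amgm[OF p])
    also have "\<dots> = (A + B) / 2" by (simp add: A_def B_def inverse_eq_divide)
    finally have "2 * norm (k x) \<le> A + B" by simp
    moreover have "norm (k x) \<le> 2 * norm (k x)" by simp
    ultimately have "norm (k x) \<le> A + B" by (rule order_trans[rotated])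
    then show "norm (k x) \<le> norm ((1 + x\<^sup>2) * (norm (k x))\<^sup>2 + inverse (1 + x\<^sup>2))" by (simp add: A_def B_def)
  qed
qed simp

lemma sample_bound:
  fixes k :: "real \<Rightarrow> complex"
  assumes "(SUP x\<in>S. ennreal (norm (k x) * (1 + \<bar>x\<bar>) powr (- N) * exp (pi * \<bar>x\<bar>\<^sup>2))) < \<infinity>"
  obtains D where "D \<ge> 0" "\<And>x. x \<in> S \<Longrightarrow> norm (k x) \<le> D * (1 + \<bar>x\<bar>) powr N * exp (- pi * x\<^sup>2)"
proof -
  define D where "D = enn2real (SUP x\<in>S. ennreal (norm (k x) * (1 + \<bar>x\<bar>) powr (- N) * exp (pi * \<bar>x\<bar>\<^sup>2)))"
  have D: "(SUP x\<in>S. ennreal (norm (k x) * (1 + \<bar>x\<bar>) powr (- N) * exp (pi * \<bar>x\<bar>\<^sup>2))) = ennreal D" "D \<ge> 0"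
    unfolding D_def using assms by (simp_all add: ennreal_enn2real)
  have "norm (k x) \<le> D * (1 + \<bar>x\<bar>) powr N * exp (- pi * x\<^sup>2)" if "x \<in> S" for x
  proof -
    have "ennreal (norm (k x) * (1 + \<bar>x\<bar>) powr (- N) * exp (pi * \<bar>x\<bar>\<^sup>2)) \<le> ennreal D"
      unfolding D(1)[symmetric] using that by (rule SUP_upper)
    then have "norm (k x) * (1 + \<bar>x\<bar>) powr (- N) * exp (pi * x\<^sup>2) \<le> D" using D(2) by simp
    from le_mult_exp_minus[OF this] have "norm (k x) * (1 + \<bar>x\<bar>) powr (- N) \<le> D * exp (- (pi * x\<^sup>2))" .
    then have "norm (k x) * (1 + \<bar>x\<bar>) powr (- N) * (1 + \<bar>x\<bar>) powr N \<le> D * exp (- (pi * x\<^sup>2)) * (1 + \<bar>x\<bar>) powr N"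
      by (rule mult_right_mono) simp
    moreover have "(1 + \<bar>x\<bar>) powr (- N) * (1 + \<bar>x\<bar>) powr N = 1"
      by (subst powr_add[symmetric]) (simp add: add_pos_nonneg less_imp_neq)
    ultimately have "norm (k x) \<le> D * exp (- (pi * x\<^sup>2)) * (1 + \<bar>x\<bar>) powr N" by (simp only: mult.assoc mult_1_right)
    then show ?thesis by (simp only: mult.assoc mult.commute[of "exp _"] mult_minus_left)
  qed
  from that[OF D(2) this] show ?thesis .
qed

text \<open>The quotient by the leading power tends to the leading coefficient, but along the nodes
  it is of order \<open>l j powr (N - degree p)\<close> at most and tends to 0 if the degree exceeds
  \<open>N\<close>. The maximum with 0 covers polynomials of degree 0.\<close>

lemma degree_le_of_growth:
  fixes p :: "complex poly"
  assumes l: "filterlim l at_top (F :: int filter)" "F \<noteq> bot"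
    and bd: "\<And>j. norm (poly p (complex_of_real (l j))) \<le> D * (1 + \<bar>l j\<bar>) powr N"
  shows "real (degree p) \<le> max N 0"
proof (cases "p = 0")
  case False
  show ?thesis
  proof (rule ccontr)
    assume "\<not> real (degree p) \<le> max N 0"
    then have N: "N < real (degree p)" by simp
    have linf: "filterlim (\<lambda>j. complex_of_real (l j)) at_infinity F"
      by (rule filterlim_compose[OF filterlim_of_real_at_infinity l(1)])
    have "((\<lambda>j. poly p (complex_of_real (l j)) / complex_of_real (l j) ^ degree p) \<longlongrightarrow> lead_coeff p) F"
      by (rule filterlim_compose[OF poly_divide_tendsto_aux linf])
    moreover have "((\<lambda>j. poly p (complex_of_real (l j)) / complex_of_real (l j) ^ degree p) \<longlongrightarrow> 0) F"
    proof (rule Lim_null_comparison)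
      have "\<forall>\<^sub>F j in F. 1 \<le> l j" using l(1) unfolding filterlim_at_top by blast
      then show "\<forall>\<^sub>F j in F. norm (poly p (complex_of_real (l j)) / complex_of_real (l j) ^ degree p) \<le> D * (1 + l j) powr N / l j powr real (degree p)"
      proof eventually_elim
        case (elim j)
        have "norm (poly p (complex_of_real (l j)) / complex_of_real (l j) ^ degree p) = norm (poly p (complex_of_real (l j))) / l j ^ degree p"
          using elim by (simp add: norm_divide norm_power)
        also have "\<dots> \<le> D * (1 + \<bar>l j\<bar>) powr N / l j ^ degree p"
          using elim by (intro divide_right_mono bd) simp
        also have "\<dots> = D * (1 + l j) powr N / l j powr real (degree p)"
          using elim powr_realpow[of "l j" "degree p"] by simp
        finally show ?case .
      qed
      have "((\<lambda>x. D * (1 + x) powr N / x powr real (degree p)) \<longlongrightarrow> 0) at_top"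
      proof -
        have h: "((\<lambda>x::real. 1 / x + 1) \<longlongrightarrow> 1) at_top" by real_asymp
        have "((\<lambda>x::real. D * ((1 / x + 1) powr N * x powr (N - real (degree p)))) \<longlongrightarrow> D * (1 powr N * 0)) at_top"
          using N by (intro tendsto_mult tendsto_const tendsto_powr h tendsto_neg_powr filterlim_ident) auto
        moreover have "\<forall>\<^sub>F x in at_top. D * ((1 / x + 1) powr N * x powr (N - real (degree p))) = D * (1 + x) powr N / x powr real (degree p)"
          using eventually_gt_at_top[of 0]
        proof eventually_elim
          case (elim x)
          have "(1 / x + 1) * x = 1 + x" using elim by (simp add: field_simps)
          then have "(1 / x + 1) powr N * x powr N = (1 + x) powr N"
            using elim powr_mult[of "1 / x + 1" x N] by simp
          then show ?case by (simp add: powr_diff)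
        qed
        ultimately show ?thesis by (simp add: tendsto_cong)
      qed
      from filterlim_compose[OF this l(1)] show "((\<lambda>j. D * (1 + l j) powr N / l j powr real (degree p)) \<longlongrightarrow> 0) F" .
    qed
    ultimately have "lead_coeff p = 0" using l(2) tendsto_unique by blast
    then show False using False by simp
  qed
qed simp

theorem corollary1:
  fixes l m :: "int \<Rightarrow> real" and f F :: "real \<Rightarrow> complex" and N :: real
  assumes "supercritical_pair 2 2 l m"
    and "max (limsup_both (\<lambda>j. \<bar>l j\<bar> * (l (j + 1) - l j)))
             (limsup_both (\<lambda>j. \<bar>m j\<bar> * (m (j + 1) - m j))) < ereal (1 / 2)"
    and "f \<in> fourier_sobolev"
    and "continuous_representative f F"
    and "N \<ge> 0"
    and "(SUP x\<in>range l. ennreal (norm (F x) * (1 + \<bar>x\<bar>) powr (- N) * exp (pi * \<bar>x\<bar>\<^sup>2)))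
       + (SUP y\<in>range m. ennreal (norm (fourier f y) * (1 + \<bar>y\<bar>) powr (- N) * exp (pi * \<bar>y\<bar>\<^sup>2)))
         < \<infinity>"
  shows "\<exists>P :: complex poly. real (degree P) \<le> N \<and>
           (\<forall>x. F x = poly P (complex_of_real x) * complex_of_real (exp (- pi * x\<^sup>2)))"
proof -
  have l: "two_sided_sequence l" and m: "two_sided_sequence m"
    using assms(1) by (auto simp: supercritical_pair_def)
  have lim: "limsup_both (\<lambda>j. \<bar>l j\<bar> * (l (j + 1) - l j)) < ereal (1 / 2)"
    "limsup_both (\<lambda>j. \<bar>m j\<bar> * (m (j + 1) - m j)) < ereal (1 / 2)"
    using assms(2) by simp_all
  obtain \<gamma>1 \<eta>1 X1 where 1: "0 < \<gamma>1" "\<gamma>1 < 1" "0 < \<eta>1" "X1 > 0" "sampling (range l) \<gamma>1 \<eta>1 X1"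
    using sampling_of_sequence[OF l lim(1)] by blast
  obtain \<gamma>2 \<eta>2 X2 where 2: "0 < \<gamma>2" "\<gamma>2 < 1" "0 < \<eta>2" "X2 > 0" "sampling (range m) \<gamma>2 \<eta>2 X2"
    using sampling_of_sequence[OF m lim(2)] by blast
  define \<gamma> \<eta> X where "\<gamma> = max \<gamma>1 \<gamma>2" and "\<eta> = min \<eta>1 \<eta>2" and "X = max X1 X2"
  have params: "0 < \<gamma>" "\<gamma> < 1" "\<eta> > 0" "X > 0" using 1 2 by (auto simp: \<gamma>_def \<eta>_def X_def)
  have samp: "sampling (range l) \<gamma> \<eta> X" "sampling (range m) \<gamma> \<eta> X"
    using sampling_mono[OF 1(5)] sampling_mono[OF 2(5)] by (auto simp: \<gamma>_def \<eta>_def X_def)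
  have [measurable]: "f \<in> borel_measurable lborel"
    and fin: "(\<integral>\<^sup>+ x. ennreal ((1 + x\<^sup>2) * (norm (f x))\<^sup>2) \<partial>lborel)
     + (\<integral>\<^sup>+ \<xi>. ennreal ((1 + \<xi>\<^sup>2) * (norm (fourier f \<xi>))\<^sup>2) \<partial>lborel) < \<infinity>"
    using assms(3) by (auto simp: fourier_sobolev_def square_integrable_def)
  have Fcont: "continuous_on UNIV F" and ae: "AE x in lborel. F x = f x"
    using assms(4) by (auto simp: continuous_representative_def)
  have Fm [measurable]: "F \<in> borel_measurable borel" using Fcont by (rule borel_measurable_continuous_onI)
  \<comment> \<open>The transform ignores null sets, so from here on \<open>f\<close> can be
    replaced by its continuous representative throughout.\<close>
  have fF: "fourier f = fourier F"
    unfolding fourier_cis[abs_def]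
  proof (intro ext integral_cong_AE)
    fix \<xi>
    show "AE x in lborel. f x * cis (- (2 * pi * \<xi>) * x) = F x * cis (- (2 * pi * \<xi>) * x)"
      using ae by eventually_elim simp
  qed measurable
  have "(\<integral>\<^sup>+ x. ennreal ((1 + x\<^sup>2) * (norm (F x))\<^sup>2) \<partial>lborel) = (\<integral>\<^sup>+ x. ennreal ((1 + x\<^sup>2) * (norm (f x))\<^sup>2) \<partial>lborel)"
    using ae by (intro nn_integral_cong_AE) auto
  then have finF: "(\<integral>\<^sup>+ x. ennreal ((1 + x\<^sup>2) * (norm (F x))\<^sup>2) \<partial>lborel) < \<infinity>"
    and finG: "(\<integral>\<^sup>+ x. ennreal ((1 + x\<^sup>2) * (norm (fourier F x))\<^sup>2) \<partial>lborel) < \<infinity>"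
    using fin by (auto simp: fF)
  have Fint: "integrable lborel F" by (rule integrable_of_second_moment[OF Fm finF])
  have Gint: "integrable lborel (fourier F)" by (rule integrable_of_second_moment[OF fourier_measurable[OF Fint] finG])
  define B where "B = max (LINT x|lborel. norm (F x)) (LINT x|lborel. norm (fourier F x))"
  have GB: "norm (fourier F \<xi>) \<le> B" for \<xi> using fourier_norm_le[of F \<xi>] by (simp add: B_def)
  have FB: "norm (F x) \<le> B" for x
  proof -
    have "norm (F x) \<le> (LINT \<xi>|lborel. norm (fourier F \<xi> * cis (2 * pi * x * \<xi>)))"
      using Fcont by (subst fourier_inversion[OF Fint _ Gint, of x])
        (auto simp: continuous_on_eq_continuous_at intro: integral_norm_bound)
    then show ?thesis by (simp add: norm_mult B_def)
  qed
  have sup: "(SUP x\<in>range l. ennreal (norm (F x) * (1 + \<bar>x\<bar>) powr (- N) * exp (pi * \<bar>x\<bar>\<^sup>2))) < \<infinity>"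
    "(SUP y\<in>range m. ennreal (norm (fourier F y) * (1 + \<bar>y\<bar>) powr (- N) * exp (pi * \<bar>y\<bar>\<^sup>2))) < \<infinity>"
    using assms(6) by (simp_all add: fF)
  obtain D1 where D1: "D1 \<ge> 0" "\<And>x. x \<in> range l \<Longrightarrow> norm (F x) \<le> D1 * (1 + \<bar>x\<bar>) powr N * exp (- pi * x\<^sup>2)"
    using sample_bound[OF sup(1)] by blast
  obtain D2 where D2: "D2 \<ge> 0" "\<And>x. x \<in> range m \<Longrightarrow> norm (fourier F x) \<le> D2 * (1 + \<bar>x\<bar>) powr N * exp (- pi * x\<^sup>2)"
    using sample_bound[OF sup(2)] by blast
  \<comment> \<open>The analysis works with natural exponents, so \<open>N\<close> is rounded up.
    The exact \<open>N\<close> returns at the end, where the node values alone bound the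
    degree.\<close>
  define n where "n = nat \<lceil>N\<rceil>"
  define D where "D = max D1 D2"
  have pw: "(1 + \<bar>x\<bar>) powr N \<le> (1 + \<bar>x\<bar>) ^ n" for x :: real
  proof -
    have "N \<le> real n" by (simp add: n_def real_nat_ceiling_ge)
    then have "(1 + \<bar>x\<bar>) powr N \<le> (1 + \<bar>x\<bar>) powr real n" by (intro powr_mono) auto
    then show ?thesis by (simp add: powr_realpow add_pos_nonneg)
  qed
  have SF: "norm (F t) \<le> D * (1 + \<bar>t\<bar>) ^ n * exp (- pi * t\<^sup>2)" if "t \<in> range l" for t
  proof -
    have "D1 * (1 + \<bar>t\<bar>) powr N * exp (- pi * t\<^sup>2) \<le> D * (1 + \<bar>t\<bar>) ^ n * exp (- pi * t\<^sup>2)"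
      using D1(1) pw[of t] by (intro mult_right_mono mult_mono) (auto simp: D_def)
    then show ?thesis using D1(2)[OF that] by linarith
  qed
  have SG: "norm (fourier F t) \<le> D * (1 + \<bar>t\<bar>) ^ n * exp (- pi * t\<^sup>2)" if "t \<in> range m" for t
  proof -
    have "D2 * (1 + \<bar>t\<bar>) powr N * exp (- pi * t\<^sup>2) \<le> D * (1 + \<bar>t\<bar>) ^ n * exp (- pi * t\<^sup>2)"
      using D2(1) pw[of t] by (intro mult_right_mono mult_mono) (auto simp: D_def)
    then show ?thesis using D2(2)[OF that] by linarith
  qed
  have "\<exists>C a. a > 0 \<and> (\<forall>t. norm (F t) \<le> C * exp (- a * t\<^sup>2)) \<and> (\<forall>t. norm (fourier F t) \<le> C * exp (- a * t\<^sup>2))"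
  proof (rule joint_gaussian_decay[OF Fint Fcont FB Gint GB finF finG params samp SF SG])
    fix C a
    assume "a > 0" "\<And>t. norm (F t) \<le> C * exp (- a * t\<^sup>2)" "\<And>t. norm (fourier F t) \<le> C * exp (- a * t\<^sup>2)"
    then show ?thesis by blast
  qed
  then obtain C a where C: "a > 0" "\<And>t. norm (F t) \<le> C * exp (- a * t\<^sup>2)" "\<And>t. norm (fourier F t) \<le> C * exp (- a * t\<^sup>2)"
    by blast
  have "\<exists>p :: complex poly. \<forall>x. F x = poly p (complex_of_real x) * complex_of_real (exp (- pi * x\<^sup>2))"
  proof (rule sharp_gaussian_decay[OF Fint Fcont Gint params samp SF SG C])
    fix C'
    assume C': "\<And>t. norm (F t) \<le> C' * (1 + \<bar>t\<bar>) ^ (2 * n + 1) * exp (- pi * t\<^sup>2)"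
      "\<And>t. norm (fourier F t) \<le> C' * (1 + \<bar>t\<bar>) ^ (2 * n + 1) * exp (- pi * t\<^sup>2)"
    show ?thesis
      by (rule hardy_polynomial[OF fourier_measurable[OF Fint] C'(2,1) fourier_laplace_inversion[OF Fint Fcont Gint]]) blast
  qed
  then obtain p :: "complex poly" where p: "\<And>x. F x = poly p (complex_of_real x) * complex_of_real (exp (- pi * x\<^sup>2))"
    by blast
  have growth: "norm (poly p (complex_of_real (l j))) \<le> D1 * (1 + \<bar>l j\<bar>) powr N" for j
  proof -
    have "norm (poly p (complex_of_real (l j))) * exp (- pi * (l j)\<^sup>2) = norm (F (l j))"
      unfolding p by (simp add: norm_mult)
    also have "\<dots> \<le> D1 * (1 + \<bar>l j\<bar>) powr N * exp (- pi * (l j)\<^sup>2)" by (rule D1(2)) simp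
    finally show ?thesis by (rule mult_right_le_imp_le) simp
  qed
  have "filterlim l at_top at_top" using l by (simp add: two_sided_sequence_def)
  from degree_le_of_growth[OF this _ growth] have "real (degree p) \<le> N" using assms(5) by simp
  then show ?thesis using p by blast
qed

end
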